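(* Let $X$ be a (non-Euclidean) analytic normed plane. Let $H$ be the graph with vertex set $\{v_1,\dots,v_6\}$ and edge set $\{v_iv_j:1\le i<j\le 4\}\cup\{v_iv_j:3\le i<j\le 6\}$ (two copies of $K_4$ sharing exactly one edge, $v_3v_4$). Then $H$ is globally rigid in $X$.
   Context: A normed plane is a $2$-dimensional real normed space. It is analytic if the restriction of its norm to $X\setminus\{0\}$ is a real analytic function (in linear coordinates), and non-Euclidean if its norm does not come from an inner product. For a finite simple graph $G=(V,E)$, a placement is an element $p=(p_v)_{v\in V}\in X^V$, and the pair $(G,p)$ is called a framework in $X$. Two frameworks $(G,p),(G,q)$ are equivalent if $\|p_v-p_w\|=\|q_v-q_w\|$ for all $vw\in E$. They are congruent if there is an isometry $g$ of $X$ with $q_v=g(p_v)$ for all $v\in V$. The framework $(G,p)$ is globally rigid in $X$ if every framework $(G,q)$ in $X$ equivalent to $(G,p)$ is congruent to $(G,p)$. The graph $G$ is globally rigid in $X$ if the set $\{p\in X^V:(G,p)\text{ is globally rigid in }X\}$ has non-empty interior in $X^V$. *)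

theory Defs
  imports "HOL-Analysis.Analysis"
begin

text \<open>
  A normed space is represented by a type of class \<open>real_normed_vector\<close>; properties of the
  space take the type as an argument of type \<open>'a itself\<close>.
\<close>

text \<open>\<open>dim\<close> is \<open>0\<close> for a space without a finite basis, so the equation also says that the space is
  finite-dimensional.\<close>

definition normed_plane :: "'a::real_normed_vector itself \<Rightarrow> bool" where
  "normed_plane X \<longleftrightarrow> dim (UNIV :: 'a set) = 2"

text \<open>A function of two real variables is real analytic at a point if it is given by a convergent
  double power series near it. For real terms, \<open>has_sum\<close> is absolute convergence.\<close>

definition real_analytic2_at :: "(real \<Rightarrow> real \<Rightarrow> real) \<Rightarrow> real \<Rightarrow> real \<Rightarrow> bool" where
  "real_analytic2_at f a b \<longleftrightarrow>
     (\<exists>(c :: nat \<Rightarrow> nat \<Rightarrow> real) r. r > 0 \<and>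
        (\<forall>s t. \<bar>s\<bar> < r \<longrightarrow> \<bar>t\<bar> < r \<longrightarrow>
           ((\<lambda>(i, j). c i j * s ^ i * t ^ j) has_sum f (a + s) (b + t)) UNIV))"

text \<open>Analyticity of the norm away from the origin, in the linear coordinates of a basis
  \<open>{e, f}\<close>. Since a linear change of coordinates preserves analyticity, it does not matter whether
  one asks this for some basis or for every basis.\<close>

definition analytic_normed_plane :: "'a::real_normed_vector itself \<Rightarrow> bool" where
  "analytic_normed_plane X \<longleftrightarrow> normed_plane X \<and>
     (\<exists>e f :: 'a. e \<noteq> f \<and> independent {e, f} \<and>
        (\<forall>a b. (a, b) \<noteq> (0, 0) \<longrightarrow>
           real_analytic2_at (\<lambda>x y. norm (x *\<^sub>R e + y *\<^sub>R f)) a b))"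

definition is_inner_product :: "('a::real_vector \<Rightarrow> 'a \<Rightarrow> real) \<Rightarrow> bool" where
  "is_inner_product B \<longleftrightarrow>
     bilinear B \<and> (\<forall>x y. B x y = B y x) \<and> (\<forall>x. x \<noteq> 0 \<longrightarrow> B x x > 0)"

definition euclidean_norm :: "'a::real_normed_vector itself \<Rightarrow> bool" where
  "euclidean_norm X \<longleftrightarrow>
     (\<exists>B :: 'a \<Rightarrow> 'a \<Rightarrow> real. is_inner_product B \<and> (\<forall>x. norm x = sqrt (B x x)))"

definition simple_graph :: "'v set \<Rightarrow> 'v set set \<Rightarrow> bool" where
  "simple_graph V E \<longleftrightarrow>
     finite V \<and> (\<forall>e\<in>E. \<exists>v\<in>V. \<exists>w\<in>V. v \<noteq> w \<and> e = {v, w})"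

text \<open>The placements of a vertex set \<open>V\<close> are the extensional functions on \<open>V\<close>; these are the points
  of \<open>product_topology (\<lambda>_. euclidean) V\<close>.\<close>

definition placements :: "'v set \<Rightarrow> ('v \<Rightarrow> 'a) set" where
  "placements V = (V \<rightarrow>\<^sub>E UNIV)"

definition equivalent_frameworks ::
    "'v set set \<Rightarrow> ('v \<Rightarrow> 'a::real_normed_vector) \<Rightarrow> ('v \<Rightarrow> 'a) \<Rightarrow> bool" where
  "equivalent_frameworks E p q \<longleftrightarrow>
     (\<forall>v w. {v, w} \<in> E \<longrightarrow> norm (p v - p w) = norm (q v - q w))"

definition is_isometry :: "('a::real_normed_vector \<Rightarrow> 'a) \<Rightarrow> bool" where
  "is_isometry g \<longleftrightarrow> bij g \<and> (\<forall>x y. dist (g x) (g y) = dist x y)"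

definition congruent_frameworks ::
    "'v set \<Rightarrow> ('v \<Rightarrow> 'a::real_normed_vector) \<Rightarrow> ('v \<Rightarrow> 'a) \<Rightarrow> bool" where
  "congruent_frameworks V p q \<longleftrightarrow> (\<exists>g. is_isometry g \<and> (\<forall>v\<in>V. q v = g (p v)))"

definition globally_rigid_framework ::
    "'v set \<Rightarrow> 'v set set \<Rightarrow> ('v \<Rightarrow> 'a::real_normed_vector) \<Rightarrow> bool" where
  "globally_rigid_framework V E p \<longleftrightarrow>
     (\<forall>q\<in>placements V. equivalent_frameworks E p q \<longrightarrow> congruent_frameworks V p q)"

definition globally_rigid_graph ::
    "'a::real_normed_vector itself \<Rightarrow> 'v set \<Rightarrow> 'v set set \<Rightarrow> bool" where
  "globally_rigid_graph X V E \<longleftrightarrow> simple_graph V E \<and>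
     product_topology (\<lambda>_. euclidean) V interior_of
       {p \<in> placements V. globally_rigid_framework V E (p :: 'v \<Rightarrow> 'a)} \<noteq> {}"

end

theory Submission
  imports Defs "HOL-Complex_Analysis.Complex_Analysis"
begin

text \<open>
  Fix the vertex \<open>v\<^sub>3\<close> at the origin and let \<open>z\<close> be the position
  of \<open>v\<^sub>4\<close>. It suffices to find one placement that is globally rigid and
  infinitesimally rigid: by compactness all placements near it are then globally rigid
  (\<open>fibre_stability\<close>, \<open>infinitesimally_rigid_imp_locally_injective\<close>).

  Apart from differentiability, analyticity enters only through restrictions of the norm to lines.
  It gives strict convexity (\<open>strict_convex\<close>), and it shows that two lines on which
  the norm agrees along an interval of parameters correspond under a linear isometry
  (\<open>isometry_of_equal_norms_on_lines\<close>).

  The first \<open>K\<^sub>4\<close> is chosen such that \<open>z\<close> has only finitely many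
  positions \<open>z'\<close> in realisations with the same lengths. By Sard's theorem almost all
  values of the length map are regular, and the fibre over a regular value is finite
  (\<open>regular_K4\<close>). What makes the image of the length map large is that
  infinitesimally rigid placements are dense (\<open>K4_rigid_dense\<close>): if there were none,
  the motion that turns \<open>z\<close> would carry along a whole region by infinitesimal
  isometries, and only a Euclidean norm has non-zero infinitesimal linear isometries
  (\<open>killing_field_imp_euclidean\<close>). The first \<open>K\<^sub>4\<close> is moreover
  unique for given \<open>z\<close> (\<open>K4_unique_over_base\<close>).

  In the second \<open>K\<^sub>4\<close> the vertex \<open>v\<^sub>5\<close> is placed on the
  segment from \<open>v\<^sub>3\<close> to \<open>v\<^sub>4\<close>, at \<open>s z\<close>. Strict
  convexity forces \<open>v\<^sub>5\<close> to \<open>s z'\<close> in any equivalent realisation,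
  so if \<open>v\<^sub>6\<close> moves from \<open>y\<close> to \<open>y'\<close> then \<open>N (s
  z - y) = N (s z' - y')\<close>. For each of the finitely many pairs \<open>(z', y')\<close> that
  are not isometric to \<open>(z, y)\<close> this fails for most \<open>s\<close>, and one
  \<open>s\<close> serves for all of them (\<open>H_globally_rigid_open\<close>).
\<close>

section \<open>Real analytic functions on a line\<close>

text \<open>Formal power series with positive radius of convergence come with closure properties
  under sums, products and derivatives; being expandable into one at each point is real
  analyticity.\<close>

definition line_analytic :: "(real \<Rightarrow> real) \<Rightarrow> bool" where
  "line_analytic f \<longleftrightarrow> (\<forall>t. \<exists>F. (\<lambda>s. f (t + s)) has_fps_expansion F)"

lemma fps_expansion_zero_or_isolated:
  fixes f :: "real \<Rightarrow> real"
  assumes "f has_fps_expansion F"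
  shows "eventually (\<lambda>s. f s = 0) (nhds 0) \<or> eventually (\<lambda>s. f s \<noteq> 0) (at 0)"
proof (cases "f 0 = 0")
  case False
  have "isCont f 0"
    using has_fps_expansion_imp_continuous[OF assms] .
  then have "eventually (\<lambda>s. f s \<noteq> 0) (at 0)"
    using False unfolding isCont_def by (rule tendsto_imp_eventually_ne)
  then show ?thesis ..
next
  case True
  have "fps_conv_radius F > 0"
    using assms by (auto simp: has_fps_expansion_def)
  then have "eventually (\<lambda>z. z \<in> eball 0 (fps_conv_radius F)) (nhds (0::real))"
    by (intro eventually_nhds_in_open) (auto simp: zero_ereal_def)
  moreover have "eventually (\<lambda>z. eval_fps F z = f z) (nhds 0)"
    using assms by (auto simp: has_fps_expansion_def)
  ultimately have "eventually (\<lambda>z. (\<lambda>n. fps_nth F n * z ^ n) sums f z) (nhds 0)"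
  proof eventually_elim
    case (elim z)
    then have "summable (\<lambda>n. fps_nth F n * z ^ n)"
      by (intro summable_fps) (auto simp: in_eball_iff)
    then have "(\<lambda>n. fps_nth F n * z ^ n) sums eval_fps F z"
      unfolding eval_fps_def by (rule summable_sums)
    with elim show ?case by simp
  qed
  then obtain r where r: "r > 0" and sm: "\<And>z. norm (z - 0) < r \<Longrightarrow> (\<lambda>n. fps_nth F n * (z - 0) ^ n) sums f z"
    by (auto simp: eventually_nhds_metric dist_real_def)
  show ?thesis
  proof (cases "F = 0")
    case True
    with assms have "eventually (\<lambda>s. f s = 0) (nhds 0)"
      by (auto simp: has_fps_expansion_def elim: eventually_mono)
    then show ?thesis ..
  next
    case False
    then obtain m where m: "fps_nth F m \<noteq> 0"
      by (auto simp: fps_eq_iff)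
    have "(\<lambda>n. fps_nth F n * 0 ^ n) sums f 0"
      using sm[of 0] r by simp
    then have "fps_nth F 0 = 0"
      using True by (metis powser_sums_zero sums_unique2)
    with m have "m > 0" by (metis gr0I)
    obtain s where "0 < s" "\<And>z. z \<in> cball 0 s - {0} \<Longrightarrow> f z \<noteq> 0"
      using powser_0_nonzero[OF r sm True m \<open>m > 0\<close>] by metis
    then have "eventually (\<lambda>s. f s \<noteq> 0) (at 0)"
      unfolding eventually_at by (intro exI[of _ s]) (auto simp: dist_real_def)
    then show ?thesis ..
  qed
qed

text \<open>The points near which \<open>f\<close> vanishes form an open set. It is also closed:
  at a limit point \<open>x\<close> of it, the alternative that \<open>f\<close> has no zeros near
  \<open>x\<close>, except perhaps \<open>x\<close>, is excluded.\<close>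

lemma line_analytic_identity:
  assumes an: "line_analytic f" and ab: "a < b" and zero: "\<And>t. a < t \<Longrightarrow> t < b \<Longrightarrow> f t = 0"
  shows "f t = 0"
proof -
  define S where "S = {t. eventually (\<lambda>s. f s = 0) (nhds t)}"
  have "open S"
  proof (subst open_subopen, intro ballI)
    fix x assume "x \<in> S"
    then obtain T where T: "open T" "x \<in> T" "\<forall>y\<in>T. f y = 0"
      by (auto simp: S_def eventually_nhds)
    then show "\<exists>T. open T \<and> x \<in> T \<and> T \<subseteq> S"
      by (intro exI[of _ T]) (auto simp: S_def eventually_nhds)
  qed
  moreover have "closed S"
    unfolding closed_limpt
  proof (intro allI impI)
    fix x assume x: "x islimpt S"
    obtain F where "(\<lambda>s. f (x + s)) has_fps_expansion F"
      using an by (auto simp: line_analytic_def)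
    from fps_expansion_zero_or_isolated[OF this]
    show "x \<in> S"
    proof
      assume "\<forall>\<^sub>F s in nhds 0. f (x + s) = 0"
      then have "\<forall>\<^sub>F s in nhds x. f s = 0"
        by (subst nhds_to_0) (simp add: eventually_filtermap add.commute)
      then show "x \<in> S" by (simp add: S_def)
    next
      assume "\<forall>\<^sub>F s in at 0. f (x + s) \<noteq> 0"
      then have "\<forall>\<^sub>F s in at x. f s \<noteq> 0"
        by (subst at_to_0) (simp add: eventually_filtermap add.commute)
      moreover have "frequently (\<lambda>y. y \<in> S) (at x)"
        using x by (simp add: islimpt_conv_frequently_at)
      ultimately have "frequently (\<lambda>y. y \<in> S \<and> f y \<noteq> 0) (at x)"
        by (rule frequently_eventually_frequently[rotated])
      from frequently_ex[OF this] obtain y where "y \<in> S" "f y \<noteq> 0"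
        by blast
      then show "x \<in> S"
        by (auto simp: S_def dest: eventually_nhds_x_imp_x)
    qed
  qed
  moreover have "(a + b) / 2 \<in> S"
  proof -
    have "eventually (\<lambda>s. s \<in> {a<..<b}) (nhds ((a + b) / 2))"
      using ab by (intro eventually_nhds_in_open) auto
    then show ?thesis
      unfolding S_def using zero by (auto elim: eventually_mono)
  qed
  ultimately have "S = UNIV"
    using clopen[of S] by auto
  then show ?thesis
    by (auto simp: S_def dest: eventually_nhds_x_imp_x)
qed

lemma line_analytic_const: "line_analytic (\<lambda>_. c)"
  by (auto simp: line_analytic_def intro!: exI[of _ "fps_const c"])

lemma line_analytic_ident: "line_analytic (\<lambda>t. t)"
  unfolding line_analytic_def
proof
  fix t :: real
  have "(\<lambda>s. t + s) has_fps_expansion (fps_const t + fps_X)"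
    by (intro has_fps_expansion_add fps_expansion_intros)
  then show "\<exists>F. (\<lambda>s. t + s) has_fps_expansion F" ..
qed

lemma line_analytic_add: "line_analytic f \<Longrightarrow> line_analytic g \<Longrightarrow> line_analytic (\<lambda>t. f t + g t)"
  unfolding line_analytic_def using has_fps_expansion_add by blast

lemma line_analytic_diff: "line_analytic f \<Longrightarrow> line_analytic g \<Longrightarrow> line_analytic (\<lambda>t. f t - g t)"
  unfolding line_analytic_def using has_fps_expansion_diff by blast

lemma line_analytic_mult: "line_analytic f \<Longrightarrow> line_analytic g \<Longrightarrow> line_analytic (\<lambda>t. f t * g t)"
  unfolding line_analytic_def using has_fps_expansion_mult by blast

lemma line_analytic_deriv:
  assumes "line_analytic f" shows "line_analytic (deriv f)"
  unfolding line_analytic_def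
proof
  fix t
  obtain F where F: "(\<lambda>s. f (t + s)) has_fps_expansion F"
    using assms by (auto simp: line_analytic_def)
  have "deriv (\<lambda>s. f (t + s)) = (\<lambda>s. deriv f (t + s))"
    using DERIV_shift[of f _ _ t] by (intro ext) (simp add: deriv_def add.commute)
  with has_fps_expansion_deriv[OF F]
  show "\<exists>F. (\<lambda>s. deriv f (t + s)) has_fps_expansion F" by auto
qed

text \<open>Along a line, collect the finitely many terms of each total degree of the double
  series.\<close>

lemma real_analytic2_at_line:
  assumes "real_analytic2_at f a b"
  shows "\<exists>F. (\<lambda>s. f (a + \<alpha> * s) (b + \<beta> * s)) has_fps_expansion F"
proof -
  obtain c r where r: "r > 0" and
    sm: "\<And>s t. \<bar>s\<bar> < r \<Longrightarrow> \<bar>t\<bar> < r \<Longrightarrow>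
        ((\<lambda>(i, j). c i j * s ^ i * t ^ j) has_sum f (a + s) (b + t)) UNIV"
    using assms unfolding real_analytic2_at_def by blast
  define d where "d n = (\<Sum>i\<le>n. c i (n - i) * \<alpha> ^ i * \<beta> ^ (n - i))" for n
  define \<rho> where "\<rho> = r / (1 + \<bar>\<alpha>\<bar> + \<bar>\<beta>\<bar>)"
  have \<rho>: "\<rho> > 0" using r by (simp add: \<rho>_def)
  have sums: "(\<lambda>n. d n * s ^ n) sums f (a + \<alpha> * s) (b + \<beta> * s)" if s: "\<bar>s\<bar> < \<rho>" for s
  proof -
    have "\<bar>s\<bar> * (1 + \<bar>\<alpha>\<bar> + \<bar>\<beta>\<bar>) < r"
      using s unfolding \<rho>_def by (subst (asm) pos_less_divide_eq) auto
    moreover have "\<bar>\<alpha> * s\<bar> \<le> \<bar>s\<bar> * (1 + \<bar>\<alpha>\<bar> + \<bar>\<beta>\<bar>)" "\<bar>\<beta> * s\<bar> \<le> \<bar>s\<bar> * (1 + \<bar>\<alpha>\<bar> + \<bar>\<beta>\<bar>)"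
      by (simp_all add: abs_mult distrib_left mult.commute[of "\<bar>s\<bar>"])
    ultimately have "((\<lambda>(i, j). c i j * (\<alpha> * s) ^ i * (\<beta> * s) ^ j)
        has_sum f (a + \<alpha> * s) (b + \<beta> * s)) UNIV"
      by (intro sm) linarith+
    moreover have bij: "bij_betw (\<lambda>(n, i). (i, n - i)) (SIGMA n:UNIV. {..n::nat}) (UNIV :: (nat \<times> nat) set)"
      by (rule bij_betwI[where g = "\<lambda>(i, j). (i + j, i)"]) auto
    ultimately have "((\<lambda>(n, i). c i (n - i) * (\<alpha> * s) ^ i * (\<beta> * s) ^ (n - i))
        has_sum f (a + \<alpha> * s) (b + \<beta> * s)) (SIGMA n:UNIV. {..n})"
      by (subst (asm) has_sum_reindex_bij_betw[OF bij, symmetric]) (simp add: case_prod_unfold)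
    then have "((\<lambda>n. \<Sum>i\<le>n. c i (n - i) * (\<alpha> * s) ^ i * (\<beta> * s) ^ (n - i))
        has_sum f (a + \<alpha> * s) (b + \<beta> * s)) UNIV"
      by (rule has_sum_SigmaD) (simp add: has_sum_finite)
    moreover have "(\<Sum>i\<le>n. c i (n - i) * (\<alpha> * s) ^ i * (\<beta> * s) ^ (n - i)) = d n * s ^ n" for n
      unfolding d_def sum_distrib_right
      by (rule sum.cong) (auto simp: power_mult_distrib power_add[symmetric] mult.assoc mult.left_commute)
    ultimately show ?thesis by (simp add: has_sum_imp_sums)
  qed
  have "fps_conv_radius (Abs_fps d) > 0"
  proof -
    have "0 < ereal (norm (\<rho> / 2))" using \<rho> by simp
    also have "\<dots> \<le> conv_radius d"
      by (rule conv_radius_geI, rule sums_summable[OF sums]) (use \<rho> in auto)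
    also have "conv_radius d = fps_conv_radius (Abs_fps d)"
      by (simp add: fps_conv_radius_def)
    finally show ?thesis .
  qed
  moreover have "eventually (\<lambda>s. eval_fps (Abs_fps d) s = f (a + \<alpha> * s) (b + \<beta> * s)) (nhds 0)"
  proof -
    have "eventually (\<lambda>s. s \<in> ball 0 \<rho>) (nhds (0::real))"
      by (intro eventually_nhds_in_open) (use \<rho> in auto)
    then show ?thesis
      by eventually_elim (auto simp: eval_fps_def intro!: sums_unique[symmetric] sums)
  qed
  ultimately have "(\<lambda>s. f (a + \<alpha> * s) (b + \<beta> * s)) has_fps_expansion Abs_fps d"
    by (simp add: has_fps_expansion_def)
  then show ?thesis ..
qed

text \<open>Beyond the constant and linear terms, every term of the double series has total degree
  at least two, so their sum is \<open>O(m\<^sup>2)\<close> on the square of half-width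
  \<open>m\<close>.\<close>

lemma real_analytic2_at_differentiable:
  assumes "real_analytic2_at f a b"
  shows "\<exists>g h. ((\<lambda>z. f (Re z) (Im z)) has_derivative (\<lambda>z. g * Re z + h * Im z)) (at (Complex a b))"
proof -
  obtain c r where r: "r > 0" and
    sm: "\<And>s t. \<bar>s\<bar> < r \<Longrightarrow> \<bar>t\<bar> < r \<Longrightarrow>
        ((\<lambda>(i, j). c i j * s ^ i * t ^ j) has_sum f (a + s) (b + t)) UNIV"
    using assms unfolding real_analytic2_at_def by blast
  define \<rho> where "\<rho> = r / 2"
  have \<rho>: "\<rho> > 0" "\<rho> < r" using r by (auto simp: \<rho>_def)
  define g h where "g = c 1 0" and "h = c 0 1"
  have "(\<lambda>(i, j). c i j * \<rho> ^ i * \<rho> ^ j) summable_on UNIV"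
    using sm[of \<rho> \<rho>] \<rho> by (auto intro: has_sum_imp_summable)
  then have abs: "(\<lambda>p. norm (case p of (i, j) \<Rightarrow> c i j * \<rho> ^ i * \<rho> ^ j)) summable_on UNIV"
    by (subst (asm) summable_on_iff_abs_summable_on_real) (simp add: o_def)
  define K where "K = infsum (\<lambda>p. norm (case p of (i, j) \<Rightarrow> c i j * \<rho> ^ i * \<rho> ^ j)) UNIV"
  have K0: "K \<ge> 0" unfolding K_def by (rule infsum_nonneg) auto
  define D where "D = {(0,0),(1,0),(0::nat,1::nat)}"
  have bound: "\<bar>f (a + s) (b + t) - f a b - (g * s + h * t)\<bar> \<le> K * (m / \<rho>)\<^sup>2"
    if m: "\<bar>s\<bar> \<le> m" "\<bar>t\<bar> \<le> m" "m \<le> \<rho>" for s t m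
  proof -
    let ?F = "\<lambda>(i, j). c i j * s ^ i * t ^ j"
    have S: "(?F has_sum f (a + s) (b + t)) UNIV"
      by (intro sm) (use m \<rho> in auto)
    have "(?F has_sum (sum ?F D)) D" by (rule has_sum_finite) (simp add: D_def)
    with S have "(?F has_sum (f (a + s) (b + t) - sum ?F D)) (UNIV - D)"
      by (rule has_sum_Diff) auto
    moreover have "sum ?F D = f a b + (g * s + h * t)"
    proof -
      have "((\<lambda>(i, j). c i j * 0 ^ i * 0 ^ j) has_sum f (a + 0) (b + 0)) UNIV"
        by (intro sm) (use r in auto)
      moreover have "((\<lambda>(i, j). c i j * 0 ^ i * 0 ^ j) has_sum c 0 0) UNIV"
        by (rule has_sum_finiteI[THEN has_sum_cong_neutral[THEN iffD1, rotated -1], of "{(0,0)}" _ "\<lambda>(i, j). c i j * 0 ^ i * 0 ^ j"])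
           (auto simp: power_0_left split: if_splits)
      ultimately have "f a b = c 0 0" by (simp add: has_sum_unique)
      then show ?thesis by (simp add: D_def g_def h_def)
    qed
    ultimately have T: "(?F has_sum (f (a + s) (b + t) - f a b - (g * s + h * t))) (UNIV - D)"
      by (simp add: algebra_simps)
    have term_le: "norm (?F p) \<le> (m / \<rho>)\<^sup>2 * norm (case p of (i, j) \<Rightarrow> c i j * \<rho> ^ i * \<rho> ^ j)"
      if "p \<in> UNIV - D" for p
    proof -
      obtain i j where p: "p = (i, j)" by force
      with that have ij: "i + j \<ge> 2"
        by (cases i; cases j) (auto simp: D_def)
      have m0: "0 \<le> m" using m by linarith
      have "\<bar>s\<bar> ^ i * \<bar>t\<bar> ^ j \<le> m ^ i * m ^ j"
        by (intro mult_mono power_mono) (use m in auto)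
      also have "\<dots> = (m / \<rho>) ^ (i + j) * (\<rho> ^ i * \<rho> ^ j)"
        using \<rho> by (simp add: power_add power_divide)
      also have "\<dots> \<le> (m / \<rho>)\<^sup>2 * (\<rho> ^ i * \<rho> ^ j)"
        by (intro mult_right_mono power_decreasing) (use ij m m0 \<rho> in auto)
      finally have "\<bar>c i j\<bar> * (\<bar>s\<bar> ^ i * \<bar>t\<bar> ^ j) \<le> \<bar>c i j\<bar> * ((m / \<rho>)\<^sup>2 * (\<rho> ^ i * \<rho> ^ j))"
        by (rule mult_left_mono) simp
      then show ?thesis
        using \<rho> by (simp add: p abs_mult power_abs mult_ac)
    qed
    have sub: "(\<lambda>p. norm (case p of (i, j) \<Rightarrow> c i j * \<rho> ^ i * \<rho> ^ j)) summable_on (UNIV - D)"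
      by (rule summable_on_subset_banach[OF abs]) auto
    have "norm (f (a + s) (b + t) - f a b - (g * s + h * t))
        \<le> infsum (\<lambda>p. (m / \<rho>)\<^sup>2 * norm (case p of (i, j) \<Rightarrow> c i j * \<rho> ^ i * \<rho> ^ j)) (UNIV - D)"
      by (rule norm_infsum_le[OF T _ term_le], rule has_sum_infsum, rule summable_on_cmult_right, rule sub)
    also have "\<dots> = (m / \<rho>)\<^sup>2 * infsum (\<lambda>p. norm (case p of (i, j) \<Rightarrow> c i j * \<rho> ^ i * \<rho> ^ j)) (UNIV - D)"
      by (rule infsum_cmult_right) (rule sub)
    also have "\<dots> \<le> (m / \<rho>)\<^sup>2 * K"
      unfolding K_def
      by (intro mult_left_mono infsum_mono_neutral sub abs) auto
    finally show ?thesis by (simp add: mult.commute)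
  qed
  have "((\<lambda>z. f (Re z) (Im z)) has_derivative (\<lambda>z. g * Re z + h * Im z)) (at (Complex a b))"
    unfolding has_derivative_at'
  proof (intro conjI allI impI)
    show "bounded_linear (\<lambda>z. g * Re z + h * Im z)"
      by (intro bounded_linear_add bounded_linear_const_mult bounded_linear_Re bounded_linear_Im)
    fix e :: real assume e: "e > 0"
    define \<delta> where "\<delta> = min \<rho> (e * \<rho>\<^sup>2 / (K + 1))"
    have "\<delta> > 0" unfolding \<delta>_def using \<rho> e K0 by auto
    moreover have "norm (f (Re x') (Im x') - f (Re (Complex a b)) (Im (Complex a b))
          - (g * Re (x' - Complex a b) + h * Im (x' - Complex a b))) / norm (x' - Complex a b) < e"
      if x': "0 < norm (x' - Complex a b) \<and> norm (x' - Complex a b) < \<delta>" for x'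
    proof -
      define m where "m = norm (x' - Complex a b)"
      have m: "0 < m" "m < \<delta>" using x' by (auto simp: m_def)
      have "\<bar>Re (x' - Complex a b)\<bar> \<le> m" "\<bar>Im (x' - Complex a b)\<bar> \<le> m"
        unfolding m_def using abs_Re_le_cmod abs_Im_le_cmod by blast+
      from bound[OF this] m have "\<bar>f (Re x') (Im x') - f a b
          - (g * Re (x' - Complex a b) + h * Im (x' - Complex a b))\<bar> \<le> K * (m / \<rho>)\<^sup>2"
        by (simp add: \<delta>_def)
      also have "\<dots> < e * m"
      proof -
        have "m < e * \<rho>\<^sup>2 / (K + 1)" using m by (simp add: \<delta>_def)
        then have "m * (K + 1) < e * \<rho>\<^sup>2"
          using K0 by (simp add: pos_less_divide_eq)
        then have "m * K < e * \<rho>\<^sup>2" using m by (simp add: distrib_left)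
        then have "m * (m * K) < m * (e * \<rho>\<^sup>2)" using m by (intro mult_strict_left_mono)
        then show ?thesis using \<rho>
          by (simp add: power_divide pos_divide_less_eq power2_eq_square mult_ac)
      qed
      finally show ?thesis using m
        by (simp add: m_def[symmetric] pos_divide_less_eq)
    qed
    ultimately show "\<exists>d>0. \<forall>x'. 0 < norm (x' - Complex a b) \<and> norm (x' - Complex a b) < d \<longrightarrow>
        norm (f (Re x') (Im x') - f (Re (Complex a b)) (Im (Complex a b))
          - (g * Re (x' - Complex a b) + h * Im (x' - Complex a b))) / norm (x' - Complex a b) < e"
      by blast
  qed
  then show ?thesis by blast
qed

section \<open>Linear algebra in the plane\<close>

text \<open>The determinant of two plane vectors; \<open>cross a b \<noteq> 0\<close> expresses
  linear independence.\<close>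

definition cross :: "complex \<Rightarrow> complex \<Rightarrow> real" where
  "cross a b = Re a * Im b - Im a * Re b"

lemma cross_algebra:
  "cross (a + b) c = cross a c + cross b c" "cross c (a + b) = cross c a + cross c b"
  "cross (a - b) c = cross a c - cross b c" "cross c (a - b) = cross c a - cross c b"
  "cross (- a) c = - cross a c" "cross c (- a) = - cross c a"
  "cross (r *\<^sub>R a) c = r * cross a c" "cross c (r *\<^sub>R a) = r * cross c a"
  "cross a a = 0" "cross 0 a = 0" "cross a 0 = 0"
  by (auto simp: cross_def algebra_simps)

lemma cross_commute: "cross a b = - cross b a"
  by (simp add: cross_def)

lemma cross_eq_0_imp_scale:
  assumes "cross a b = 0" "a \<noteq> 0"
  obtains c where "b = c *\<^sub>R a"
proof -
  have "b = ((a \<bullet> b) / (a \<bullet> a)) *\<^sub>R a"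
  proof -
    have "(a \<bullet> a) *\<^sub>R b = (a \<bullet> b) *\<^sub>R a"
    proof (rule complex_eqI)
      have "Re a * Im b = Im a * Re b" using assms by (simp add: cross_def)
      then show "Re ((a \<bullet> a) *\<^sub>R b) = Re ((a \<bullet> b) *\<^sub>R a)"
        "Im ((a \<bullet> a) *\<^sub>R b) = Im ((a \<bullet> b) *\<^sub>R a)"
        by (simp_all add: inner_complex_def) (algebra+)
    qed
    then show ?thesis using assms(2)
      by (metis divideR_right inner_eq_zero_iff scaleR_scaleR inverse_eq_divide
          times_divide_eq_left mult_1)
  qed
  then show ?thesis by (rule that)
qed

lemma orthogonal_to_two:
  assumes "cross g h \<noteq> 0" "g \<bullet> d = 0" "h \<bullet> d = 0"
  shows "d = 0"
proof -
  have "cross g h * Re d = Im h * (g \<bullet> d) - Im g * (h \<bullet> d)"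
    "cross g h * Im d = Re g * (h \<bullet> d) - Re h * (g \<bullet> d)"
    by (auto simp: cross_def inner_complex_def algebra_simps)
  with assms show ?thesis by (auto simp: complex_eq_iff)
qed

lemma basis_expansion:
  assumes "cross u v \<noteq> 0"
  shows "w = (cross w v / cross u v) *\<^sub>R u + (cross u w / cross u v) *\<^sub>R v"
proof -
  have "cross u v *\<^sub>R w = cross w v *\<^sub>R u + cross u w *\<^sub>R v"
    by (auto simp: cross_def complex_eq_iff algebra_simps)
  then have "w = (1 / cross u v) *\<^sub>R (cross w v *\<^sub>R u + cross u w *\<^sub>R v)"
    using assms by (metis divideR_right inverse_eq_divide)
  then show ?thesis by (simp add: scaleR_add_right)
qed

lemma continuous_on_cross [continuous_intros]:
  "continuous_on S f \<Longrightarrow> continuous_on S g \<Longrightarrow> continuous_on S (\<lambda>x. cross (f x) (g x))"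
  unfolding cross_def by (intro continuous_intros)

lemma tendsto_cross [tendsto_intros]:
  "(f \<longlongrightarrow> a) F \<Longrightarrow> (g \<longlongrightarrow> b) F \<Longrightarrow> ((\<lambda>x. cross (f x) (g x)) \<longlongrightarrow> cross a b) F"
  unfolding cross_def by (intro tendsto_intros)

lemma dist_Pair_le: "dist (x, y) (x', y') \<le> dist x x' + dist y y'"
  by (simp add: dist_Pair_Pair sqrt_sum_squares_le_sum)

lemma linear_compose_fst: "linear l \<Longrightarrow> linear (\<lambda>P. l (fst P))"
  using linear_compose[OF linear_fst] by (simp add: o_def)

lemma linear_compose_snd: "linear l \<Longrightarrow> linear (\<lambda>P. l (snd P))"
  using linear_compose[OF linear_snd] by (simp add: o_def)

lemma compact_locally_unique_imp_finite:
  fixes S :: "'a::metric_space set"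
  assumes "compact S" "\<And>x. x \<in> S \<Longrightarrow> \<exists>e>0. \<forall>y\<in>S. dist y x < e \<longrightarrow> y = x"
  shows "finite S"
proof (rule ccontr)
  assume "infinite S"
  with assms(1) obtain x where x: "x \<in> S" "x islimpt S"
    by (metis compact_eq_Bolzano_Weierstrass order_refl)
  with assms(2) show False
    unfolding islimpt_approachable by blast
qed

section \<open>Analytic norms on the plane\<close>

text \<open>The plane is modelled by \<open>complex\<close>, which supplies compactness,
  differentiation and rotation by a right angle; the norm under study is an unrelated function
  \<open>N\<close>.\<close>

locale norm_plane =
  fixes N :: "complex \<Rightarrow> real"
  assumes N_eq_0 [simp]: "N x = 0 \<longleftrightarrow> x = 0"
    and N_scale: "N (r *\<^sub>R x) = \<bar>r\<bar> * N x"
    and N_triangle: "N (x + y) \<le> N x + N y"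
    and N_analytic: "(a, b) \<noteq> (0, 0) \<Longrightarrow> real_analytic2_at (\<lambda>s t. N (Complex s t)) a b"
begin

lemma N_minus [simp]: "N (- x) = N x"
  using N_scale[of "-1" x] by simp

lemma N_commute: "N (x - y) = N (y - x)"
  using N_minus[of "x - y"] by simp

lemma N_zero [simp]: "N 0 = 0"
  by simp

lemma N_nonneg [simp]: "0 \<le> N x"
  using N_triangle[of x "- x"] by simp

lemma N_pos: "x \<noteq> 0 \<Longrightarrow> 0 < N x"
  using N_nonneg[of x] N_eq_0[of x] by linarith

lemma N_triangle_diff: "\<bar>N x - N y\<bar> \<le> N (x - y)"
  using N_triangle[of "x - y" y] N_triangle[of "y - x" x] N_commute[of x y] by auto

lemma N_upper: "\<exists>C>0. \<forall>x. N x \<le> C * norm x"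
proof (intro exI[of _ "N 1 + N \<i>"] conjI allI)
  show "0 < N 1 + N \<i>" using N_pos[of 1] N_pos[of \<i>] by simp
  fix x
  have "x = Re x *\<^sub>R 1 + Im x *\<^sub>R \<i>" by (simp add: complex_eq_iff)
  then have "N x \<le> \<bar>Re x\<bar> * N 1 + \<bar>Im x\<bar> * N \<i>"
    using N_triangle[of "Re x *\<^sub>R 1" "Im x *\<^sub>R \<i>"] by (simp only: N_scale)
  also have "\<dots> \<le> norm x * N 1 + norm x * N \<i>"
    by (intro add_mono mult_right_mono abs_Re_le_cmod abs_Im_le_cmod) auto
  finally show "N x \<le> (N 1 + N \<i>) * norm x" by (simp add: algebra_simps)
qed

lemma continuous_on_N: "continuous_on S N"
proof -
  obtain C where C: "C > 0" "\<And>x. N x \<le> C * norm x" using N_upper by auto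
  have "C-lipschitz_on S N"
    by (rule lipschitz_onI) (use C N_triangle_diff in \<open>auto simp: dist_norm intro: order_trans\<close>)
  then show ?thesis by (rule lipschitz_on_continuous_on)
qed

lemma isCont_N [continuous_intros]: "isCont f x \<Longrightarrow> isCont (\<lambda>y. N (f y)) x"
  by (rule isCont_o2) (use continuous_on_N[of UNIV] in \<open>simp_all add: continuous_on_eq_continuous_at\<close>)

lemma continuous_on_N' [continuous_intros]: "continuous_on S f \<Longrightarrow> continuous_on S (\<lambda>y. N (f y))"
  using continuous_on_compose2[OF continuous_on_N[of UNIV]] by auto

lemma tendsto_N [tendsto_intros]: "(f \<longlongrightarrow> a) F \<Longrightarrow> ((\<lambda>y. N (f y)) \<longlongrightarrow> N a) F"
  using isCont_tendsto_compose[OF isCont_N[OF continuous_ident]] .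

lemma N_lower: "\<exists>c>0. \<forall>x. c * norm x \<le> N x"
proof -
  have "\<exists>x\<in>sphere 0 1. \<forall>y\<in>sphere 0 1. N x \<le> N (y::complex)"
  proof (rule continuous_attains_inf)
    show "sphere (0::complex) 1 \<noteq> {}" using norm_one by (auto intro!: exI[of _ 1])
  qed (auto intro: continuous_on_N)
  then obtain x where x: "norm x = 1" "\<And>y. norm y = 1 \<Longrightarrow> N x \<le> N y" by auto
  show ?thesis
  proof (intro exI[of _ "N x"] conjI allI)
    show "0 < N x" using x by (intro N_pos) auto
    fix y
    show "N x * norm y \<le> N y"
    proof (cases "y = 0")
      case False
      then have "N x \<le> N ((1 / norm y) *\<^sub>R y)" by (intro x) simp
      with False show ?thesis by (simp add: N_scale field_simps)
    qed simp
  qed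
qed

text \<open>The gradient of \<open>N\<close>, as a vector for the Euclidean inner product; its
  value at \<open>0\<close> is arbitrary.\<close>

definition nu :: "complex \<Rightarrow> complex" where
  "nu x = (SOME g. (N has_derivative (\<lambda>h. g \<bullet> h)) (at x))"

lemma has_derivative_N:
  assumes "x \<noteq> 0"
  shows "(N has_derivative (\<lambda>h. nu x \<bullet> h)) (at x)"
proof -
  have "(Re x, Im x) \<noteq> (0, 0)" using assms by (auto simp: complex_eq_iff)
  from real_analytic2_at_differentiable[OF N_analytic[OF this]]
  obtain g h where "(N has_derivative (\<lambda>z. g * Re z + h * Im z)) (at x)" by auto
  moreover have "(\<lambda>z. g * Re z + h * Im z) = (\<lambda>z. Complex g h \<bullet> z)"
    by (simp add: inner_complex_def)
  ultimately have "(N has_derivative (\<lambda>z. Complex g h \<bullet> z)) (at x)" by simp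
  then show ?thesis unfolding nu_def by (rule someI)
qed

lemma has_real_derivative_N_line:
  assumes "a + t *\<^sub>R b \<noteq> 0"
  shows "((\<lambda>t. N (a + t *\<^sub>R b)) has_real_derivative (nu (a + t *\<^sub>R b) \<bullet> b)) (at t)"
proof -
  have "((\<lambda>t. a + t *\<^sub>R b) has_derivative (\<lambda>h. h *\<^sub>R b)) (at t)"
    by (auto intro!: derivative_eq_intros)
  from has_derivative_compose[OF this has_derivative_N[OF assms]]
  show ?thesis
    by (simp add: has_field_derivative_def mult.commute mult_commute_abs)
qed

lemma nu_le: "x \<noteq> 0 \<Longrightarrow> nu x \<bullet> y \<le> N y"
proof -
  assume x: "x \<noteq> 0"
  have "((\<lambda>t. N (x + t *\<^sub>R y)) has_real_derivative (nu x \<bullet> y)) (at 0)"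
    using has_real_derivative_N_line[of x 0 y] x by simp
  then have "((\<lambda>t. (N (x + t *\<^sub>R y) - N x) / t) \<longlongrightarrow> nu x \<bullet> y) (at 0)"
    by (simp add: DERIV_def)
  then have "((\<lambda>t. (N (x + t *\<^sub>R y) - N x) / t) \<longlongrightarrow> nu x \<bullet> y) (at_right 0)"
    by (rule filterlim_mono) (auto simp: at_le)
  moreover have "eventually (\<lambda>t. (N (x + t *\<^sub>R y) - N x) / t \<le> N y) (at_right 0)"
  proof (rule eventually_at_rightI[of 0 1])
    fix t :: real assume "t \<in> {0<..<1}"
    then show "(N (x + t *\<^sub>R y) - N x) / t \<le> N y"
      using N_triangle[of x "t *\<^sub>R y"] by (simp add: N_scale field_simps)
  qed simp
  ultimately show ?thesis
    by (rule tendsto_upperbound) simp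
qed

lemma nu_self: "x \<noteq> 0 \<Longrightarrow> nu x \<bullet> x = N x"
proof -
  assume x: "x \<noteq> 0"
  have "((\<lambda>t. N (x + t *\<^sub>R x)) has_real_derivative (nu x \<bullet> x)) (at 0)"
    using has_real_derivative_N_line[of x 0 x] x by simp
  moreover have "((\<lambda>t. N (x + t *\<^sub>R x)) has_real_derivative N x) (at 0)"
  proof (rule has_field_derivative_transform_within_open[of "\<lambda>t. (1 + t) * N x" _ _ "{-1<..}"])
    show "((\<lambda>t. (1 + t) * N x) has_real_derivative N x) (at 0)"
      by (auto intro!: derivative_eq_intros)
    fix t :: real assume "t \<in> {-1<..}"
    then show "(1 + t) * N x = N (x + t *\<^sub>R x)"
      using N_scale[of "1 + t" x] by (simp add: scaleR_left_distrib)
  qed auto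
  ultimately show ?thesis by (rule DERIV_unique)
qed

lemma abs_nu_le: "x \<noteq> 0 \<Longrightarrow> \<bar>nu x \<bullet> y\<bar> \<le> N y"
  using nu_le[of x y] nu_le[of x "- y"] by auto

lemma nu_nonzero: "x \<noteq> 0 \<Longrightarrow> nu x \<noteq> 0"
  using nu_self[of x] N_pos[of x] by auto

text \<open>The function \<open>N - g\<close> has a minimum at \<open>u\<close>, so its derivative
  vanishes there.\<close>

lemma subgradient_unique:
  assumes u: "u \<noteq> 0" and le: "\<And>w. g \<bullet> w \<le> N w" and eq: "g \<bullet> u = N u"
  shows "g = nu u"
proof -
  have "((\<lambda>w. N w - g \<bullet> w) has_derivative (\<lambda>h. nu u \<bullet> h - g \<bullet> h)) (at u)"
    by (intro has_derivative_diff has_derivative_N u)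
       (auto intro!: derivative_eq_intros)
  then have "(\<lambda>h. nu u \<bullet> h - g \<bullet> h) = (\<lambda>h. 0)"
    by (rule has_derivative_local_min) (use le eq in auto)
  then have "nu u \<bullet> (nu u - g) - g \<bullet> (nu u - g) = 0" by metis
  then have "(nu u - g) \<bullet> (nu u - g) = 0" by (simp add: inner_diff_left)
  then show ?thesis by simp
qed

lemma nu_scale: "u \<noteq> 0 \<Longrightarrow> 0 < t \<Longrightarrow> nu (t *\<^sub>R u) = nu u"
  by (rule subgradient_unique[symmetric]) (auto simp: nu_le nu_self N_scale)

lemma nu_bounded: "\<exists>C>0. \<forall>u. u \<noteq> 0 \<longrightarrow> norm (nu u) \<le> C"
proof -
  obtain C where C: "C > 0" "\<And>x. N x \<le> C * norm x" using N_upper by auto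
  have "norm (nu u) \<le> C" if "u \<noteq> 0" for u
  proof -
    have "norm (nu u) * norm (nu u) = nu u \<bullet> nu u" by (simp add: norm_eq_square power2_norm_eq_inner[symmetric] power2_eq_square)
    also have "\<dots> \<le> N (nu u)" by (rule nu_le[OF that])
    also have "\<dots> \<le> C * norm (nu u)" by (rule C)
    finally show ?thesis using nu_nonzero[OF that] by simp
  qed
  with C show ?thesis by auto
qed

text \<open>A limit of subgradients is a subgradient, and a differentiable norm has only one.\<close>

lemma isCont_nu:
  assumes u: "u \<noteq> 0"
  shows "isCont nu u"
proof (rule ccontr)
  assume "\<not> isCont nu u"
  then obtain e where e: "e > 0" "\<And>d. d > 0 \<Longrightarrow> \<exists>x. dist x u < d \<and> dist (nu x) (nu u) \<ge> e"
    unfolding continuous_at_eps_delta by (metis not_less)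
  define d where "d n = min (norm u / 2) (inverse (real (Suc n)))" for n
  have d: "d n > 0" for n using u by (simp add: d_def)
  have "\<forall>n. \<exists>x. dist x u < d n \<and> dist (nu x) (nu u) \<ge> e" using e(2) d by blast
  then obtain X where X: "\<And>n. dist (X n) u < d n" "\<And>n. dist (nu (X n)) (nu u) \<ge> e" by metis
  have X0: "X n \<noteq> 0" for n using X(1)[of n] u by (auto simp: d_def)
  have lim: "X \<longlonglongrightarrow> u"
  proof (rule tendstoI)
    fix \<epsilon> :: real assume "\<epsilon> > 0"
    then have "eventually (\<lambda>n. inverse (real (Suc n)) < \<epsilon>) sequentially"
      using LIMSEQ_inverse_real_of_nat by (rule order_tendstoD(2)[rotated])
    then show "eventually (\<lambda>n. dist (X n) u < \<epsilon>) sequentially"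
      by eventually_elim (use X(1) in \<open>force simp: d_def intro: less_trans\<close>)
  qed
  obtain C where "\<And>u. u \<noteq> 0 \<Longrightarrow> norm (nu u) \<le> C" using nu_bounded by auto
  with X0 have "bounded (range (\<lambda>n. nu (X n)))" by (auto simp: bounded_iff)
  then obtain g r where r: "strict_mono r" and g: "((\<lambda>n. nu (X n)) \<circ> r) \<longlonglongrightarrow> g"
    using bounded_imp_convergent_subsequence by blast
  have Xr: "(\<lambda>n. X (r n)) \<longlonglongrightarrow> u" using LIMSEQ_subseq_LIMSEQ[OF lim r] by (simp add: o_def)
  from g have g: "(\<lambda>n. nu (X (r n))) \<longlonglongrightarrow> g" by (simp add: o_def)
  have "g = nu u"
  proof (rule subgradient_unique[OF u])
    fix w
    have "(\<lambda>n. nu (X (r n)) \<bullet> w) \<longlonglongrightarrow> g \<bullet> w" by (intro tendsto_intros g)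
    then show "g \<bullet> w \<le> N w"
      by (rule LIMSEQ_le_const2) (use nu_le X0 in auto)
  next
    have "(\<lambda>n. nu (X (r n)) \<bullet> X (r n)) \<longlonglongrightarrow> g \<bullet> u" by (intro tendsto_intros g Xr)
    moreover have "(\<lambda>n. nu (X (r n)) \<bullet> X (r n)) \<longlonglongrightarrow> N u"
      using tendsto_N[OF Xr] X0 by (simp add: nu_self)
    ultimately show "g \<bullet> u = N u" by (rule LIMSEQ_unique)
  qed
  with g have "(\<lambda>n. dist (nu (X (r n))) (nu u)) \<longlonglongrightarrow> dist (nu u) (nu u)" by (intro tendsto_intros) auto
  then have "e \<le> dist (nu u) (nu u)"
    by (rule LIMSEQ_le_const) (use X(2) in auto)
  with e show False by simp
qed

lemma tendsto_nu [tendsto_intros]: "(f \<longlongrightarrow> a) F \<Longrightarrow> a \<noteq> 0 \<Longrightarrow> ((\<lambda>y. nu (f y)) \<longlongrightarrow> nu a) F"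
  using isCont_tendsto_compose[OF isCont_nu] .

lemma continuous_on_nu [continuous_intros]:
  "continuous_on S f \<Longrightarrow> (\<And>x. x \<in> S \<Longrightarrow> f x \<noteq> 0) \<Longrightarrow> continuous_on S (\<lambda>y. nu (f y))"
  unfolding continuous_on_def by (auto intro: tendsto_nu)

lemma line_analytic_N:
  assumes "\<And>t. a + t *\<^sub>R b \<noteq> 0"
  shows "line_analytic (\<lambda>t. N (a + t *\<^sub>R b))"
  unfolding line_analytic_def
proof
  fix t
  let ?p = "a + t *\<^sub>R b"
  have "(Re ?p, Im ?p) \<noteq> (0, 0)" using assms[of t] by (auto simp: complex_eq_iff)
  from real_analytic2_at_line[OF N_analytic[OF this], of "Re b" "Im b"]
  have "\<exists>F. (\<lambda>s. N (Complex (Re ?p + Re b * s) (Im ?p + Im b * s))) has_fps_expansion F" .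
  moreover have "Complex (Re ?p + Re b * s) (Im ?p + Im b * s) = a + (t + s) *\<^sub>R b" for s
    by (simp add: complex_eq_iff algebra_simps)
  ultimately show "\<exists>F. (\<lambda>s. N (a + (t + s) *\<^sub>R b)) has_fps_expansion F" by simp
qed

lemma cross_line_nonzero: "cross a b \<noteq> 0 \<Longrightarrow> a + t *\<^sub>R b \<noteq> 0"
proof
  assume "cross a b \<noteq> 0" "a + t *\<^sub>R b = 0"
  moreover have "cross (a + t *\<^sub>R b) b = cross a b" by (simp add: cross_algebra)
  ultimately show False by (simp add: cross_algebra)
qed

text \<open>Equality in the triangle inequality puts a segment on the unit sphere. By analyticity
  the norm is then \<open>1\<close> on the whole line through the segment, which is
  unbounded.\<close>

lemma strict_convex:
  assumes xy: "cross x y \<noteq> 0"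
  shows "N (x + y) < N x + N y"
proof (rule ccontr)
  assume "\<not> ?thesis"
  then have eq: "N (x + y) = N x + N y" using N_triangle[of x y] by linarith
  have x: "x \<noteq> 0" and y: "y \<noteq> 0" using xy by (auto simp: cross_algebra)
  have xy0: "x + y \<noteq> 0" using cross_line_nonzero[OF xy, of 1] by simp
  define u w where "u = (1 / N x) *\<^sub>R x" and "w = (1 / N y) *\<^sub>R y"
  have px: "N x > 0" "N y > 0" using N_pos x y by auto
  have N1: "N u = 1" "N w = 1" using px by (auto simp: u_def w_def N_scale)
  let ?g = "nu (x + y)"
  have "?g \<bullet> x + ?g \<bullet> y = N x + N y" using nu_self[OF xy0] eq by (simp add: inner_add_right)
  with nu_le[OF xy0, of x] nu_le[OF xy0, of y] have "?g \<bullet> x = N x" "?g \<bullet> y = N y" by auto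
  then have g: "?g \<bullet> u = 1" "?g \<bullet> w = 1" using px by (auto simp: u_def w_def)
  have uw: "cross u (w - u) \<noteq> 0" using xy x y by (simp add: u_def w_def cross_algebra)
  have "N (u + t *\<^sub>R (w - u)) - 1 = 0" for t
  proof (rule line_analytic_identity[of "\<lambda>t. N (u + t *\<^sub>R (w - u)) - 1" 0 1])
    show "line_analytic (\<lambda>t. N (u + t *\<^sub>R (w - u)) - 1)"
      by (intro line_analytic_diff line_analytic_const line_analytic_N cross_line_nonzero uw)
    fix t :: real assume t: "0 < t" "t < 1"
    have *: "u + t *\<^sub>R (w - u) = (1 - t) *\<^sub>R u + t *\<^sub>R w" by (simp add: algebra_simps)
    have "N (u + t *\<^sub>R (w - u)) \<le> 1"
      using N_triangle[of "(1 - t) *\<^sub>R u" "t *\<^sub>R w"] t N1 by (simp add: * N_scale)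
    moreover have "N (u + t *\<^sub>R (w - u)) \<ge> 1"
      using nu_le[OF xy0, of "u + t *\<^sub>R (w - u)"] g by (simp add: inner_add_right inner_diff_right)
    ultimately show "N (u + t *\<^sub>R (w - u)) - 1 = 0" by simp
  qed simp
  then have one: "N (u + t *\<^sub>R (w - u)) = 1" for t by simp
  have wu: "w - u \<noteq> 0" using uw by (auto simp: cross_algebra)
  (* With this t the point u + t (w - u) has norm at least 3 - N u = 2. *)
  define t where "t = 3 / N (w - u)"
  have "N (t *\<^sub>R (w - u)) = 3" using N_pos[OF wu] wu by (simp add: t_def N_scale)
  moreover have "N (t *\<^sub>R (w - u)) \<le> N (u + t *\<^sub>R (w - u)) + N u"
    using N_triangle[of "u + t *\<^sub>R (w - u)" "- u"] by simp
  ultimately show False using one[of t] N1 by simp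
qed

lemma triangle_equality_imp_parallel: "N (x + y) = N x + N y \<Longrightarrow> cross x y = 0"
  using strict_convex by force

text \<open>If two gradients are proportional then they agree up to sign, since both have dual
  norm \<open>1\<close>. A common gradient norms both vectors, hence also their sum, against
  strict convexity.\<close>

lemma cross_nu_nonzero:
  assumes uw: "cross u w \<noteq> 0"
  shows "cross (nu u) (nu w) \<noteq> 0"
proof
  assume c0: "cross (nu u) (nu w) = 0"
  have u: "u \<noteq> 0" and w: "w \<noteq> 0" using uw by (auto simp: cross_algebra)
  from c0 nu_nonzero[OF u] obtain c where c: "nu w = c *\<^sub>R nu u" by (rule cross_eq_0_imp_scale)
  have pos: "N u > 0" "N w > 0" using N_pos u w by auto
  have w1: "c * (nu u \<bullet> w) = N w" using nu_self[OF w] c by simp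
  have u1: "nu w \<bullet> u = c * N u" using nu_self[OF u] c by simp
  have "\<bar>c\<bar> * N u \<le> N u" using abs_nu_le[OF w, of u] u1 pos by (simp add: abs_mult)
  then have "\<bar>c\<bar> \<le> 1" using pos by simp
  moreover have "N w \<le> \<bar>c\<bar> * N w"
  proof -
    have "N w = \<bar>c\<bar> * \<bar>nu u \<bullet> w\<bar>" using w1 pos by (metis abs_mult abs_of_pos)
    then show ?thesis using abs_nu_le[OF u, of w] by (simp add: mult_left_mono)
  qed
  then have "\<bar>c\<bar> \<ge> 1" using pos by simp
  ultimately consider "c = 1" | "c = -1" by linarith
  then show False
  proof cases
    case 1
    have "N u + N w = nu u \<bullet> (u + w)" using w1 1 nu_self[OF u] by (simp add: inner_add_right)
    also have "\<dots> \<le> N (u + w)" by (rule nu_le[OF u])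
    finally show False using strict_convex[OF uw] by simp
  next
    case 2
    have "N u + N w = nu u \<bullet> (u + (- w))" using w1 2 nu_self[OF u] by (simp add: inner_diff_right)
    also have "\<dots> \<le> N (u + (- w))" by (rule nu_le[OF u])
    finally show False using strict_convex[of u "- w"] uw by (simp add: cross_algebra)
  qed
qed

text \<open>Convexity gives \<open>nu a \<bullet> (b - a) \<le> 0 \<le> nu b \<bullet> (b - a)\<close> whenever \<open>N a = N b\<close>; both
  bounds converge to the same value.\<close>

lemma equal_norm_limit_direction:
  assumes a: "a \<longlonglongrightarrow> p" and b: "b \<longlonglongrightarrow> p" and p: "p \<noteq> 0"
    and eq: "\<And>n. N (a n) = N (b n)" and t: "\<And>n. 0 < t n"
    and d: "(\<lambda>n. (1 / t n) *\<^sub>R (b n - a n)) \<longlonglongrightarrow> d"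
  shows "nu p \<bullet> d = 0"
proof (rule antisym)
  have nz: "eventually (\<lambda>n. a n \<noteq> 0) sequentially" "eventually (\<lambda>n. b n \<noteq> 0) sequentially"
    using tendsto_imp_eventually_ne[OF a p] tendsto_imp_eventually_ne[OF b p] by auto
  have "(\<lambda>n. nu (a n) \<bullet> ((1 / t n) *\<^sub>R (b n - a n))) \<longlonglongrightarrow> nu p \<bullet> d"
    by (intro tendsto_intros a p d)
  moreover have "eventually (\<lambda>n. nu (a n) \<bullet> ((1 / t n) *\<^sub>R (b n - a n)) \<le> 0) sequentially"
    using nz(1)
  proof eventually_elim
    case (elim n)
    have "nu (a n) \<bullet> (b n - a n) \<le> 0"
      using nu_le[OF elim, of "b n"] nu_self[OF elim] eq[of n] by (simp add: inner_diff_right)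
    then show ?case using t[of n] by (simp add: divide_nonpos_pos)
  qed
  ultimately show "nu p \<bullet> d \<le> 0" by (rule tendsto_upperbound) simp
  have "(\<lambda>n. nu (b n) \<bullet> ((1 / t n) *\<^sub>R (b n - a n))) \<longlonglongrightarrow> nu p \<bullet> d"
    by (intro tendsto_intros b p d)
  moreover have "eventually (\<lambda>n. 0 \<le> nu (b n) \<bullet> ((1 / t n) *\<^sub>R (b n - a n))) sequentially"
    using nz(2)
  proof eventually_elim
    case (elim n)
    have "0 \<le> nu (b n) \<bullet> (b n - a n)"
      using nu_le[OF elim, of "a n"] nu_self[OF elim] eq[of n] by (simp add: inner_diff_right)
    then show ?case using t[of n] by simp
  qed
  ultimately show "0 \<le> nu p \<bullet> d" by (rule tendsto_lowerbound) simp
qed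

text \<open>Configurations are points of a Euclidean space, the edges of a framework are linear
  maps \<open>l\<close> to the plane, and \<open>k\<close> collects coordinates that are held
  fixed. If there were pairs of different configurations with equal lengths arbitrarily close to
  \<open>P0\<close>, then the normalised differences would have a limit of length
  \<open>1\<close>, and this limit would be an infinitesimal flex of \<open>P0\<close>.\<close>

lemma infinitesimally_rigid_imp_locally_injective:
  fixes P0 :: "'p::euclidean_space" and k :: "'p \<Rightarrow> 'q::real_normed_vector"
  assumes lin: "\<And>l. l \<in> I \<Longrightarrow> linear l" and k: "linear k"
    and nz: "\<And>l. l \<in> I \<Longrightarrow> l P0 \<noteq> 0"
    and rigid: "\<And>v. k v = 0 \<Longrightarrow> \<forall>l\<in>I. nu (l P0) \<bullet> l v = 0 \<Longrightarrow> v = 0"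
  shows "\<exists>e>0. \<forall>P Q. dist P P0 < e \<longrightarrow> dist Q P0 < e \<longrightarrow> k P = k Q \<longrightarrow>
       (\<forall>l\<in>I. N (l P) = N (l Q)) \<longrightarrow> P = Q"
proof (rule ccontr)
  assume "\<not> ?thesis"
  then have "\<exists>P Q. dist P P0 < e \<and> dist Q P0 < e \<and> k P = k Q \<and> (\<forall>l\<in>I. N (l P) = N (l Q)) \<and> P \<noteq> Q"
    if "e > 0" for e using that by blast
  then have "\<forall>n. \<exists>P Q. dist P P0 < inverse (real (Suc n)) \<and> dist Q P0 < inverse (real (Suc n)) \<and> k P = k Q \<and>
      (\<forall>l\<in>I. N (l P) = N (l Q)) \<and> P \<noteq> Q" by simp
  then obtain P Q where PQ: "\<And>n. dist (P n) P0 < inverse (real (Suc n))" "\<And>n. dist (Q n) P0 < inverse (real (Suc n))"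
    "\<And>n. k (P n) = k (Q n)" "\<And>n l. l \<in> I \<Longrightarrow> N (l (P n)) = N (l (Q n))" "\<And>n. P n \<noteq> Q n"
    by metis
  have lim: "X \<longlonglongrightarrow> P0" if "\<And>n. dist (X n) P0 < inverse (real (Suc n))" for X
  proof -
    have "(\<lambda>n. dist (X n) P0) \<longlonglongrightarrow> 0"
      by (rule tendsto_sandwich[OF _ _ tendsto_const LIMSEQ_inverse_real_of_nat])
         (use that in \<open>auto intro!: always_eventually less_imp_le\<close>)
    then show ?thesis by (rule tendsto_dist_iff[THEN iffD2])
  qed
  define t where "t n = norm (Q n - P n)" for n
  have t: "t n > 0" for n using PQ(5)[of n] by (simp add: t_def)
  define v where "v n = (1 / t n) *\<^sub>R (Q n - P n)" for n
  have nv: "norm (v n) = 1" for n using t[of n] by (simp add: v_def t_def)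
  then have "bounded (range v)" by (auto simp: bounded_iff)
  then obtain w r where r: "strict_mono r" and w: "(v \<circ> r) \<longlonglongrightarrow> w"
    using bounded_imp_convergent_subsequence by blast
  from w have w: "(\<lambda>n. v (r n)) \<longlonglongrightarrow> w" by (simp add: o_def)
  have Pr: "(\<lambda>n. P (r n)) \<longlonglongrightarrow> P0" and Qr: "(\<lambda>n. Q (r n)) \<longlonglongrightarrow> P0"
    using LIMSEQ_subseq_LIMSEQ[OF lim r] PQ(1,2) by (auto simp: o_def)
  have "(\<lambda>n. norm (v (r n))) \<longlonglongrightarrow> norm w" by (intro tendsto_intros w)
  then have "norm w = 1" by (simp add: nv LIMSEQ_const_iff)
  moreover have "w = 0"
  proof (rule rigid)
    interpret k: bounded_linear k using k by (simp add: linear_conv_bounded_linear)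
    have "(\<lambda>n. k (v (r n))) \<longlonglongrightarrow> k w" by (rule k.tendsto[OF w])
    moreover have "k (v n) = 0" for n using PQ(3)[of n] by (simp add: v_def k.scaleR k.diff)
    ultimately show "k w = 0" by (simp add: LIMSEQ_const_iff)
  next
    show "\<forall>l\<in>I. nu (l P0) \<bullet> l w = 0"
    proof
      fix l assume l: "l \<in> I"
      interpret l: bounded_linear l using lin[OF l] by (simp add: linear_conv_bounded_linear)
      show "nu (l P0) \<bullet> l w = 0"
      proof (rule equal_norm_limit_direction)
        show "(\<lambda>n. l (P (r n))) \<longlonglongrightarrow> l P0" "(\<lambda>n. l (Q (r n))) \<longlonglongrightarrow> l P0" by (intro l.tendsto Pr Qr)+
        have "(\<lambda>n. l (v (r n))) \<longlonglongrightarrow> l w" by (rule l.tendsto[OF w])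
        then show "(\<lambda>n. (1 / t (r n)) *\<^sub>R (l (Q (r n)) - l (P (r n)))) \<longlonglongrightarrow> l w"
          by (simp add: v_def l.scaleR l.diff)
      qed (use l nz t PQ(4) in auto)
    qed
  qed
  ultimately show False by simp
qed

lemma two_distances_infinitesimally_rigid:
  assumes "cross z y \<noteq> 0" "nu y \<bullet> v = 0" "nu (y - z) \<bullet> v = 0"
  shows "v = 0"
proof (rule orthogonal_to_two[OF cross_nu_nonzero])
  show "cross y (y - z) \<noteq> 0" using assms(1) by (simp add: cross_algebra cross_commute[of y])
qed (use assms in auto)

lemma two_distances_locally_injective:
  assumes zy: "cross z y0 \<noteq> 0"
  shows "\<exists>e>0. \<forall>y y'. dist y y0 < e \<longrightarrow> dist y' y0 < e \<longrightarrow> N y = N y' \<longrightarrow> N (y - z) = N (y' - z) \<longrightarrow> y = y'"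
proof -
  \<comment> \<open>The base \<open>z\<close> is a coordinate of the configuration, so that both edges are linear in it.\<close>
  have nz: "y0 \<noteq> 0" "y0 - z \<noteq> 0" using zy by (auto simp: cross_algebra)
  have "\<exists>e>0. \<forall>P Q. dist P (z, y0) < e \<longrightarrow> dist Q (z, y0) < e \<longrightarrow> fst P = fst Q \<longrightarrow>
      (\<forall>l\<in>{snd, \<lambda>P. snd P - fst P}. N (l P) = N (l Q)) \<longrightarrow> P = Q"
  proof (rule infinitesimally_rigid_imp_locally_injective)
    show "linear l" if "l \<in> {snd, \<lambda>P. snd P - fst P}" for l :: "complex \<times> complex \<Rightarrow> complex"
      using that by (auto intro!: linear_compose_sub linear_fst linear_snd)
    show "v = 0" if "fst v = 0" "\<forall>l\<in>{snd, \<lambda>P. snd P - fst P}. nu (l (z, y0)) \<bullet> l v = 0"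
      for v :: "complex \<times> complex"
      using that two_distances_infinitesimally_rigid[OF zy, of "snd v"] by (simp add: prod_eq_iff)
  qed (use nz in \<open>auto intro: linear_fst\<close>)
  then obtain e where e: "e > 0" and inj: "\<And>P Q. dist P (z, y0) < e \<Longrightarrow> dist Q (z, y0) < e \<Longrightarrow> fst P = fst Q \<Longrightarrow>
      (\<forall>l\<in>{snd, \<lambda>P. snd P - fst P}. N (l P) = N (l Q)) \<Longrightarrow> P = Q" by blast
  show ?thesis
  proof (intro exI[of _ e] conjI allI impI e)
    fix y y' assume "dist y y0 < e" "dist y' y0 < e" "N y = N y'" "N (y - z) = N (y' - z)"
    then have "(z, y) = (z, y')" by (intro inj) (auto simp: dist_Pair_Pair)
    then show "y = y'" by simp
  qed
qed

text \<open>By strict convexity a triangle is degenerate exactly if one of its sides is as long as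
  the other two together, so degeneracy can be read off from the lengths.\<close>

lemma congruent_triangle_nondegenerate:
  assumes zx: "cross z x \<noteq> 0" and eq: "N z' = N z" "N x' = N x" "N (x' - z') = N (x - z)"
  shows "cross z' x' \<noteq> 0"
proof
  assume c0: "cross z' x' = 0"
  have "z \<noteq> 0" using zx by (auto simp: cross_algebra)
  then have z': "z' \<noteq> 0" using eq(1) by (metis N_eq_0)
  with c0 obtain c where c: "x' = c *\<^sub>R z'" by (rule cross_eq_0_imp_scale)
  have "x' - z' = (c - 1) *\<^sub>R z'" by (simp add: c algebra_simps)
  then have e: "N x = \<bar>c\<bar> * N z" "N (x - z) = \<bar>c - 1\<bar> * N z"
    using eq c by (auto simp: N_scale)
  have p: "N z > 0" using N_pos \<open>z \<noteq> 0\<close> by simp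
  have s1: "N z < N x + N (x - z)"
    using strict_convex[of x "z - x"] zx N_commute[of x z] by (simp add: cross_algebra cross_commute[of x])
  have s2: "N x < N z + N (x - z)"
    using strict_convex[of z "x - z"] zx by (simp add: cross_algebra)
  have s3: "N (x - z) < N x + N z"
    using strict_convex[of x "- z"] zx by (simp add: cross_algebra cross_commute[of x])
  consider "c \<le> 0" | "0 \<le> c" "c \<le> 1" | "c \<ge> 1" by linarith
  then show False
  proof cases
    case 1
    then have "N (x - z) = N x + N z" using e by (simp add: algebra_simps)
    with s3 show False by simp
  next
    case 2
    then have "N z = N x + N (x - z)" using e by (simp add: algebra_simps)
    with s1 show False by simp
  next
    case 3
    then have "N x = N z + N (x - z)" using e by (simp add: algebra_simps)
    with s2 show False by simp
  qed
qed

lemma finite_triangle_apexes: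
  assumes zx: "cross z x \<noteq> 0" and z': "N z' = N z"
  shows "finite {x'. N x' = N x \<and> N (x' - z') = N (x - z)}" (is "finite ?S")
proof (rule compact_locally_unique_imp_finite)
  obtain c where c: "c > 0" "\<And>x. c * norm x \<le> N x" using N_lower by auto
  have "norm x' \<le> N x / c" if "x' \<in> ?S" for x'
    using that c(2)[of x'] c(1) by (simp add: pos_le_divide_eq mult.commute)
  then have "bounded ?S" by (auto simp: bounded_iff)
  moreover have "closed ?S"
    by (intro closed_Collect_conj closed_Collect_eq continuous_intros)
  ultimately show "compact ?S" by (simp add: compact_eq_bounded_closed)
next
  fix x' assume x': "x' \<in> ?S"
  then have "cross z' x' \<noteq> 0"
    using congruent_triangle_nondegenerate[OF zx z'] by auto
  from two_distances_locally_injective[OF this] obtain e where e: "e > 0"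
    "\<And>y y'. dist y x' < e \<Longrightarrow> dist y' x' < e \<Longrightarrow> N y = N y' \<Longrightarrow> N (y - z') = N (y' - z') \<Longrightarrow> y = y'"
    by metis
  show "\<exists>e>0. \<forall>y\<in>?S. dist y x' < e \<longrightarrow> y = x'"
  proof (intro exI[of _ e] conjI ballI impI)
    fix y assume "y \<in> ?S" "dist y x' < e"
    then show "y = x'" using x' e(1) by (intro e(2)) auto
  qed (rule e(1))
qed

text \<open>Strict convexity makes a point that divides a segment rigid, although it is collinear
  with the ends.\<close>

lemma collinear_point_unique:
  assumes s: "0 \<le> s" "s \<le> 1" and eq: "N x = s * N z" "N (x - z) = (1 - s) * N z"
  shows "x = s *\<^sub>R z"
proof (cases "z = 0")
  case False
  have "N (x + (z - x)) = N x + N (z - x)" using eq N_commute[of x z] by (simp add: algebra_simps)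
  then have "cross x (z - x) = 0" by (rule triangle_equality_imp_parallel)
  then have "cross z x = 0" by (simp add: cross_algebra cross_commute[of x])
  then obtain c where c: "x = c *\<^sub>R z" using False by (rule cross_eq_0_imp_scale)
  have "x - z = (c - 1) *\<^sub>R z" by (simp add: c algebra_simps)
  then have "\<bar>c\<bar> = s" "\<bar>c - 1\<bar> = 1 - s" using eq c N_pos[OF False] by (auto simp: N_scale)
  then have "c = s" using s by auto
  with c show ?thesis by simp
qed (use eq in simp)

end

lemma inner_rotate: "(\<i> * a) \<bullet> b = cross a b"
  by (simp add: inner_complex_def cross_def)

lemma cross_rotate: "cross a (\<i> * a) = (norm a)\<^sup>2"
  by (simp only: cmod_power2) (simp add: cross_def power2_eq_square)

section \<open>Infinitesimal isometries\<close>

text \<open>After subtraction of a linear function, \<open>g\<close> vanishes at \<open>d\<close>.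
  Its maximum, attained at \<open>m\<close> say, is then at most \<open>0\<close>, because
  additivity doubles it at \<open>2 m\<close> or at \<open>2 m - d\<close>. The same applies to
  the minimum.\<close>

lemma additive_continuous_real:
  fixes g :: "real \<Rightarrow> real"
  assumes d: "d > 0" and cont: "continuous_on {0..d} g"
    and add: "\<And>s t. 0 \<le> s \<Longrightarrow> 0 \<le> t \<Longrightarrow> s + t \<le> d \<Longrightarrow> g (s + t) = g s + g t"
    and s: "0 \<le> s" "s \<le> d"
  shows "g s = s * (g d / d)"
proof -
  have nonpos: "L s \<le> 0" if L: "continuous_on {0..d} L" "L d = 0"
    and ladd: "\<And>s t. 0 \<le> s \<Longrightarrow> 0 \<le> t \<Longrightarrow> s + t \<le> d \<Longrightarrow> L (s + t) = L s + L t" for L :: "real \<Rightarrow> real"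
  proof -
    have "\<exists>x\<in>{0..d}. \<forall>y\<in>{0..d}. L y \<le> L x"
      by (rule continuous_attains_sup) (use d L in auto)
    then obtain m where m: "0 \<le> m" "m \<le> d" "\<And>y. 0 \<le> y \<Longrightarrow> y \<le> d \<Longrightarrow> L y \<le> L m" by auto
    have "L m \<le> 0"
    proof (cases "2 * m \<le> d")
      case True
      with ladd[of m m] m(1) m(3)[of "2 * m"] show ?thesis by simp
    next
      case False
      have "L (m + (d - m)) = L m + L (d - m)" by (rule ladd) (use m in auto)
      moreover have "L ((2 * m - d) + (d - m)) = L (2 * m - d) + L (d - m)"
        by (rule ladd) (use m False in auto)
      moreover have "L (2 * m - d) \<le> L m" by (rule m(3)) (use m False in auto)
      ultimately show ?thesis using L(2) by simp
    qed
    with m(3)[of s] s show ?thesis by linarith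
  qed
  have "g s - s * (g d / d) \<le> 0"
    by (rule nonpos[of "\<lambda>s. g s - s * (g d / d)"])
       (use d add in \<open>auto intro!: continuous_intros cont simp: algebra_simps add_divide_distrib\<close>)
  moreover have "s * (g d / d) - g s \<le> 0"
    by (rule nonpos[of "\<lambda>s. s * (g d / d) - g s"])
       (use d add in \<open>auto intro!: continuous_intros cont simp: algebra_simps add_divide_distrib\<close>)
  ultimately show ?thesis by linarith
qed

lemma additive_continuous_complex:
  fixes g :: "real \<Rightarrow> complex"
  assumes d: "d > 0" and cont: "continuous_on {0..d} g"
    and add: "\<And>s t. 0 \<le> s \<Longrightarrow> 0 \<le> t \<Longrightarrow> s + t \<le> d \<Longrightarrow> g (s + t) = g s + g t"
    and s: "0 \<le> s" "s \<le> d"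
  shows "g s = s *\<^sub>R ((1 / d) *\<^sub>R g d)"
proof (rule complex_eqI)
  have "Re (g s) = s * (Re (g d) / d)"
    by (rule additive_continuous_real[OF d _ _ s, of "\<lambda>s. Re (g s)"])
       (auto intro!: continuous_intros cont simp: add)
  then show "Re (g s) = Re (s *\<^sub>R ((1 / d) *\<^sub>R g d))" by simp
  have "Im (g s) = s * (Im (g d) / d)"
    by (rule additive_continuous_real[OF d _ _ s, of "\<lambda>s. Im (g s)"])
       (auto intro!: continuous_intros cont simp: add)
  then show "Im (g s) = Im (s *\<^sub>R ((1 / d) *\<^sub>R g d))" by simp
qed

context norm_plane
begin

text \<open>The condition says that the vector field \<open>A\<close> is tangent to the spheres of
  \<open>N\<close>. Along the line from a point \<open>a\<close> of \<open>\<Omega>\<close> to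
  \<open>w\<close> the defect is an analytic function: resolving \<open>A\<close> of a point of
  the line into a radial part and a part along the line expresses it by the norm, its derivative
  and polynomials.\<close>

lemma killing_field_globalizes:
  assumes A: "linear A" and "open \<Omega>" "p \<in> \<Omega>"
    and kill: "\<And>u. u \<in> \<Omega> \<Longrightarrow> u \<noteq> 0 \<Longrightarrow> nu u \<bullet> A u = 0"
    and w: "w \<noteq> 0"
  shows "nu w \<bullet> A w = 0"
proof -
  obtain a where a: "a \<in> \<Omega>" "cross a w \<noteq> 0"
  proof -
    obtain e where e: "e > 0" "ball p e \<subseteq> \<Omega>" using assms(2,3) openE by blast
    show ?thesis
    proof (cases "cross p w = 0")
      case False
      with assms(3) show ?thesis by (rule that)
    next
      case True
      define q where "q = p + (e / (2 * norm w)) *\<^sub>R (\<i> * w)"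
      have "norm (q - p) < e" using e w by (simp add: q_def norm_mult)
      then have "q \<in> \<Omega>" using e by (auto simp: dist_norm norm_minus_commute)
      moreover have "cross (\<i> * w) w \<noteq> 0"
        using w cross_rotate[of w] by (simp add: cross_commute[of "\<i> * w"])
      then have "cross q w \<noteq> 0" using True e w by (simp add: q_def cross_algebra)
      ultimately show ?thesis by (rule that)
    qed
  qed
  (* The line a + t b passes through w at t = 1 and stays in the open set for small t. *)
  define b where "b = w - a"
  have ab: "cross a b \<noteq> 0" using a by (simp add: b_def cross_algebra)
  interpret A: linear A by (rule A)
  obtain \<alpha> \<alpha>' where Aa: "A a = \<alpha> *\<^sub>R a + \<alpha>' *\<^sub>R b" using basis_expansion[OF ab] by metis
  obtain \<beta> \<beta>' where Ab: "A b = \<beta> *\<^sub>R a + \<beta>' *\<^sub>R b" using basis_expansion[OF ab] by metis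
  note nz = cross_line_nonzero[OF ab]
  define G where "G t = N (a + t *\<^sub>R b)" for t
  have dG: "deriv G t = nu (a + t *\<^sub>R b) \<bullet> b" for t
    unfolding G_def by (rule DERIV_imp_deriv, rule has_real_derivative_N_line, rule nz)
  define f where "f t = (\<alpha> + t * \<beta>) * G t + (\<alpha>' + t * \<beta>' - t * (\<alpha> + t * \<beta>)) * deriv G t" for t
  have f: "f t = nu (a + t *\<^sub>R b) \<bullet> A (a + t *\<^sub>R b)" for t
  proof -
    have "A (a + t *\<^sub>R b) = (\<alpha> + t * \<beta>) *\<^sub>R (a + t *\<^sub>R b) + (\<alpha>' + t * \<beta>' - t * (\<alpha> + t * \<beta>)) *\<^sub>R b"
      by (simp add: A.add A.scaleR Aa Ab algebra_simps)
    moreover have "nu w \<bullet> (p *\<^sub>R w + q *\<^sub>R b) = p * N w + q * (nu w \<bullet> b)" if "w \<noteq> 0" for p q w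
      using nu_self[OF that] by (simp add: inner_add_right)
    ultimately show ?thesis using nz by (simp add: f_def G_def dG)
  qed
  have an: "line_analytic f"
  proof -
    have "line_analytic G" unfolding G_def by (rule line_analytic_N[OF nz])
    then show ?thesis
      unfolding f_def
      by (intro line_analytic_add line_analytic_mult line_analytic_diff line_analytic_const
          line_analytic_ident line_analytic_deriv)
  qed
  have "isCont (\<lambda>t. a + t *\<^sub>R b) 0" by (intro continuous_intros)
  then have "((\<lambda>t. a + t *\<^sub>R b) \<longlongrightarrow> a) (at 0)" by (simp add: isCont_def)
  then have "eventually (\<lambda>t. a + t *\<^sub>R b \<in> \<Omega>) (at 0)"
    using assms(2) a(1) by (rule topological_tendstoD)
  then obtain d where d: "d > 0" "\<And>t. t \<noteq> 0 \<Longrightarrow> \<bar>t\<bar> < d \<Longrightarrow> a + t *\<^sub>R b \<in> \<Omega>"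
    by (auto simp: eventually_at dist_real_def)
  have "f 1 = 0"
  proof (rule line_analytic_identity[OF an d(1)])
    fix t assume "0 < t" "t < d"
    then show "f t = 0" using d(2)[of t] kill nz by (simp add: f)
  qed
  then show ?thesis by (simp add: f b_def)
qed

text \<open>The eigenvalue of \<open>u\<close> is zero, since \<open>nu u \<bullet> u\<close> is
  not. Hence \<open>A v = A (u + v)\<close> for every \<open>v\<close>, and this vector is
  orthogonal to the gradients at both \<open>v\<close> and \<open>u + v\<close>.\<close>

lemma killing_eigenvector_imp_zero:
  assumes A: "linear A" and kill: "\<And>u. u \<noteq> 0 \<Longrightarrow> nu u \<bullet> A u = 0"
    and u: "u \<noteq> 0" "cross u (A u) = 0"
  shows "A w = 0"
proof -
  interpret A: linear A by (rule A)
  obtain c where c: "A u = c *\<^sub>R u" using u(2,1) by (rule cross_eq_0_imp_scale)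
  then have "c * N u = 0" using kill[OF u(1)] nu_self[OF u(1)] by simp
  then have Au: "A u = 0" using c u by simp
  have Av: "A v = 0" if v: "cross u v \<noteq> 0" for v
  proof (rule orthogonal_to_two[of "nu v" "nu (u + v)"])
    have vuv: "cross v (u + v) \<noteq> 0" using v by (simp add: cross_algebra cross_commute[of v])
    then show "cross (nu v) (nu (u + v)) \<noteq> 0" by (rule cross_nu_nonzero)
    have "v \<noteq> 0" "u + v \<noteq> 0" using vuv cross_algebra(10,11) by metis+
    then show "nu v \<bullet> A v = 0" "nu (u + v) \<bullet> A v = 0"
      using kill[of v] kill[of "u + v"] Au by (auto simp: A.add)
  qed
  show ?thesis
  proof (cases "cross u w = 0")
    case True
    then obtain c where "w = c *\<^sub>R u" using u(1) by (rule cross_eq_0_imp_scale)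
    then show ?thesis using Au by (simp add: A.scaleR)
  qed (rule Av)
qed

text \<open>Without real eigenvectors, \<open>A\<close> is in a suitable basis \<open>u, e\<close>
  a multiple of the identity plus a rotation generator. The norm therefore varies exponentially
  along the ellipse \<open>cos \<theta> u + sin \<theta> e\<close>, and being periodic it is
  constant, so that the ellipse is a sphere of \<open>N\<close>.\<close>

lemma killing_field_imp_euclidean:
  assumes A: "linear A" and kill: "\<And>u. u \<noteq> 0 \<Longrightarrow> nu u \<bullet> A u = 0" and nz: "A w \<noteq> 0"
  obtains u v where "cross u v \<noteq> 0" "\<And>\<alpha> \<beta>. N (\<alpha> *\<^sub>R u + \<beta> *\<^sub>R v) = sqrt (\<alpha>\<^sup>2 + \<beta>\<^sup>2) * N u"
proof -
  interpret A: linear A by (rule A)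
  have noeig: "cross p (A p) \<noteq> 0" if "p \<noteq> 0" for p
    using killing_eigenvector_imp_zero[OF A kill that] nz by blast
  define u :: complex where "u = 1"
  define v where "v = A u"
  have u0: "u \<noteq> 0" by (simp add: u_def)
  have uv: "cross u v \<noteq> 0" unfolding v_def by (rule noeig[OF u0])
  obtain d t where Av: "A v = d *\<^sub>R u + t *\<^sub>R v" using basis_expansion[OF uv] by metis
  have disc: "t\<^sup>2 / 4 + d < 0"
  proof (rule ccontr)
    assume "\<not> ?thesis"
    then have ge: "t\<^sup>2 / 4 + d \<ge> 0" by simp
    (* l is a real root of the characteristic polynomial and p an eigenvector. *)
    define l where "l = t / 2 + sqrt (t\<^sup>2 / 4 + d)"
    have l: "l * l = t * l + d"
      using real_sqrt_pow2[OF ge] by (simp add: l_def power2_eq_square field_simps) 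
    define p where "p = v - (t - l) *\<^sub>R u"
    have "cross u p \<noteq> 0" using uv by (simp add: p_def cross_algebra)
    then have "p \<noteq> 0" by (auto simp: cross_algebra)
    have "A p = A v - (t - l) *\<^sub>R A u" by (simp only: p_def A.diff A.scaleR)
    also have "\<dots> = l *\<^sub>R v + d *\<^sub>R u" by (simp add: Av v_def[symmetric] algebra_simps)
    also have "\<dots> = l *\<^sub>R p"
    proof -
      have d: "d = l * l - t * l" using l by simp
      show ?thesis unfolding p_def d by (simp add: complex_eq_iff algebra_simps)
    qed
    finally have "cross p (A p) = 0" by (simp add: cross_algebra)
    with noeig[OF \<open>p \<noteq> 0\<close>] show False by simp
  qed
  define \<omega> where "\<omega> = sqrt (- (t\<^sup>2 / 4 + d))"
  have \<omega>: "\<omega> > 0" "\<omega> * \<omega> = - (t\<^sup>2 / 4 + d)" using disc by (auto simp: \<omega>_def)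
  define e where "e = (1 / \<omega>) *\<^sub>R (v - (t / 2) *\<^sub>R u)"
  have ve: "v = (t / 2) *\<^sub>R u + \<omega> *\<^sub>R e" using \<omega> by (simp add: e_def)
  have ue: "cross u e \<noteq> 0" using uv \<omega> by (simp add: e_def cross_algebra)
  have Ae: "A e = (t / 2) *\<^sub>R e - \<omega> *\<^sub>R u"
  proof -
    have "\<omega> *\<^sub>R A e = A v - (t / 2) *\<^sub>R v"
      using ve by (metis A.add A.scaleR add_diff_cancel_left' v_def)
    also have "\<dots> = d *\<^sub>R u + (t / 2) *\<^sub>R v" by (simp add: Av complex_eq_iff field_simps)
    also have "\<dots> = (\<omega> * (t / 2)) *\<^sub>R e - (\<omega> * \<omega>) *\<^sub>R u"
      unfolding \<omega>(2) by (subst ve) (simp add: complex_eq_iff field_simps power2_eq_square)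
    also have "\<dots> = \<omega> *\<^sub>R ((t / 2) *\<^sub>R e - \<omega> *\<^sub>R u)" by (simp add: scaleR_diff_right)
    finally show ?thesis using \<omega>(1) by simp
  qed
  define c where "c \<theta> = cos \<theta> *\<^sub>R u + sin \<theta> *\<^sub>R e" for \<theta>
  define c' where "c' \<theta> = cos \<theta> *\<^sub>R e - sin \<theta> *\<^sub>R u" for \<theta>
  have cross_c: "cross (c \<theta>) (c' \<theta>) = cross u e" for \<theta>
  proof -
    have "cross (c \<theta>) (c' \<theta>) = cos \<theta> * (cos \<theta> * cross u e) + sin \<theta> * (sin \<theta> * cross u e)"
      by (simp add: c_def c'_def cross_algebra cross_commute[of e u])
    also have "\<dots> = ((cos \<theta>)\<^sup>2 + (sin \<theta>)\<^sup>2) * cross u e"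
      by (simp only: power2_eq_square distrib_right mult.assoc)
    finally show ?thesis by simp
  qed
  have c0: "c \<theta> \<noteq> 0" for \<theta> using cross_c[of \<theta>] ue by (auto simp: cross_algebra)
  define k where "k = - (t / 2) / \<omega>"
  have dN: "((\<lambda>\<theta>. N (c \<theta>)) has_real_derivative k * N (c \<theta>)) (at \<theta>)" for \<theta>
  proof -
    have "(c has_derivative (\<lambda>h. h *\<^sub>R c' \<theta>)) (at \<theta>)"
      unfolding c_def c'_def
      by (auto intro!: derivative_eq_intros simp: algebra_simps)
    from has_derivative_compose[OF this has_derivative_N[OF c0]]
    have "((\<lambda>\<theta>. N (c \<theta>)) has_real_derivative nu (c \<theta>) \<bullet> c' \<theta>) (at \<theta>)"
      by (simp add: has_field_derivative_def mult_commute_abs)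
    moreover have "nu (c \<theta>) \<bullet> c' \<theta> = k * N (c \<theta>)"
    proof -
      have "A (c \<theta>) = (t / 2) *\<^sub>R c \<theta> + \<omega> *\<^sub>R c' \<theta>"
        using ve by (simp add: c_def c'_def A.add A.scaleR Ae v_def[symmetric] algebra_simps)
      with kill[OF c0] have "0 = (t / 2) * N (c \<theta>) + \<omega> * (nu (c \<theta>) \<bullet> c' \<theta>)"
        by (metis inner_add_right inner_scaleR_right nu_self[OF c0])
      then show ?thesis using \<omega>(1) by (simp add: k_def field_simps)
    qed
    ultimately show ?thesis by simp
  qed
  have "((\<lambda>\<theta>. N (c \<theta>) * exp (- k * \<theta>)) has_real_derivative 0) (at \<theta>)" for \<theta>
    by (rule derivative_eq_intros dN refl)+ (simp add: algebra_simps)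
  then have const: "N (c \<theta>) * exp (- k * \<theta>) = N (c 0) * exp (- k * 0)" for \<theta>
    by (intro DERIV_isconst_all) auto
  have "c (2 * pi) = c 0" by (simp add: c_def)
  with const[of "2 * pi"] c0[of 0] have "k = 0" by simp
  then have circ: "N (c \<theta>) = N u" for \<theta> using const[of \<theta>] by (simp add: c_def)
  have "N (\<alpha> *\<^sub>R u + \<beta> *\<^sub>R e) = sqrt (\<alpha>\<^sup>2 + \<beta>\<^sup>2) * N u" for \<alpha> \<beta>
  proof -
    define z where "z = Complex \<alpha> \<beta>"
    have "\<alpha> = norm z * cos (Arg z)" "\<beta> = norm z * sin (Arg z)"
      using rcis_cmod_Arg[of z] by (metis Re_rcis z_def complex.sel(1), metis Im_rcis rcis_cmod_Arg z_def complex.sel(2))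
    then have "\<alpha> *\<^sub>R u + \<beta> *\<^sub>R e = norm z *\<^sub>R c (Arg z)"
      by (simp add: c_def scaleR_add_right)
    then have "N (\<alpha> *\<^sub>R u + \<beta> *\<^sub>R e) = norm z * N u"
      by (simp add: N_scale circ)
    then show ?thesis by (simp add: z_def complex_norm)
  qed
  with ue show ?thesis by (rule that)
qed

section \<open>Infinitesimally rigid complete graphs on four vertices\<close>

text \<open>The velocity of the apex \<open>x\<close> of the triangle \<open>0, z, x\<close> when
  \<open>0\<close> is fixed, \<open>z\<close> moves with the velocity \<open>\<i> * nu z\<close>
  tangent to the sphere, and the sides keep their lengths to first order.\<close>

definition flex :: "complex \<Rightarrow> complex \<Rightarrow> complex" where
  "flex z x = (cross (nu z) (nu (x - z)) / cross (nu x) (nu (x - z))) *\<^sub>R (\<i> * nu x)"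

lemma triangle_cross_nu:
  assumes "cross z x \<noteq> 0"
  shows "x \<noteq> 0" "z \<noteq> 0" "x - z \<noteq> 0" "cross (nu x) (nu (x - z)) \<noteq> 0" "cross (nu z) (nu (x - z)) \<noteq> 0"
proof -
  have "cross x (x - z) \<noteq> 0" "cross z (x - z) \<noteq> 0"
    using assms by (auto simp: cross_algebra cross_commute[of x z])
  then show "cross (nu x) (nu (x - z)) \<noteq> 0" "cross (nu z) (nu (x - z)) \<noteq> 0"
    "x \<noteq> 0" "z \<noteq> 0" "x - z \<noteq> 0"
    using cross_nu_nonzero by (auto simp: cross_algebra)
qed

lemma flex_inner:
  assumes "cross z x \<noteq> 0"
  shows "nu x \<bullet> flex z x = 0" "nu (x - z) \<bullet> flex z x = cross (nu z) (nu (x - z))"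
  using triangle_cross_nu[OF assms]
  by (simp_all add: flex_def inner_commute[of _ "\<i> * _"] inner_rotate cross_algebra)

lemma flex_unique:
  assumes zx: "cross z x \<noteq> 0" and "nu x \<bullet> d = 0" "nu (x - z) \<bullet> (d - \<kappa> *\<^sub>R (\<i> * nu z)) = 0"
  shows "d = \<kappa> *\<^sub>R flex z x"
proof -
  have "d - \<kappa> *\<^sub>R flex z x = 0"
  proof (rule orthogonal_to_two)
    show "cross (nu x) (nu (x - z)) \<noteq> 0" by (rule triangle_cross_nu[OF zx])
    show "nu x \<bullet> (d - \<kappa> *\<^sub>R flex z x) = 0" "nu (x - z) \<bullet> (d - \<kappa> *\<^sub>R flex z x) = 0"
      using assms flex_inner[OF zx]
      by (simp_all add: inner_diff_right inner_commute[of _ "\<i> * _"] inner_rotate)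
  qed
  then show ?thesis by simp
qed

lemma continuous_on_flex: "continuous_on {x. cross z x \<noteq> 0} (flex z)"
  unfolding flex_def by (intro continuous_intros) (auto simp: triangle_cross_nu cross_algebra(9))

text \<open>Infinitesimal rigidity of the complete graph on \<open>0, z, x, y\<close>, modulo
  translations.\<close>

definition K4_rigid :: "complex \<Rightarrow> complex \<Rightarrow> complex \<Rightarrow> bool" where
  "K4_rigid z x y \<longleftrightarrow> (\<forall>z' x' y'. nu z \<bullet> z' = 0 \<and> nu x \<bullet> x' = 0 \<and> nu (x - z) \<bullet> (x' - z') = 0 \<and>
     nu y \<bullet> y' = 0 \<and> nu (y - z) \<bullet> (y' - z') = 0 \<and> nu (x - y) \<bullet> (x' - y') = 0 \<longrightarrow>
     z' = 0 \<and> x' = 0 \<and> y' = 0)"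

lemma not_K4_rigid_imp_flex:
  assumes zx: "cross z x \<noteq> 0" and zy: "cross z y \<noteq> 0" and nr: "\<not> K4_rigid z x y"
  shows "nu (x - y) \<bullet> (flex z x - flex z y) = 0"
proof -
  obtain z' x' y' where h: "nu z \<bullet> z' = 0" "nu x \<bullet> x' = 0" "nu (x - z) \<bullet> (x' - z') = 0"
    "nu y \<bullet> y' = 0" "nu (y - z) \<bullet> (y' - z') = 0" "nu (x - y) \<bullet> (x' - y') = 0"
    and nz: "\<not> (z' = 0 \<and> x' = 0 \<and> y' = 0)"
    using nr unfolding K4_rigid_def by blast
  have z: "nu z \<noteq> 0" using nu_nonzero triangle_cross_nu[OF zx] by blast
  have "cross (\<i> * nu z) z' = 0" using h(1) by (simp add: cross_def inner_complex_def)
  then obtain \<kappa> where \<kappa>: "z' = \<kappa> *\<^sub>R (\<i> * nu z)" using z by (auto elim: cross_eq_0_imp_scale)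
  have x': "x' = \<kappa> *\<^sub>R flex z x" using flex_unique[OF zx h(2)] h(3) \<kappa> by simp
  have y': "y' = \<kappa> *\<^sub>R flex z y" using flex_unique[OF zy h(4)] h(5) \<kappa> by simp
  have "\<kappa> \<noteq> 0" using nz \<kappa> x' y' by auto
  moreover have "\<kappa> * (nu (x - y) \<bullet> (flex z x - flex z y)) = 0"
    using h(6) by (simp add: x' y' inner_diff_right algebra_simps)
  ultimately show ?thesis by simp
qed

text \<open>The velocity field \<open>f\<close> preserves to first order the lengths of short
  segments with direction near \<open>D\<close>. For a parallelogram with such sides this forces
  the sum of the velocities of opposite vertices to agree, since the difference of the two sums is
  annihilated by two independent gradients. So \<open>f\<close> is additive along two directions,
  hence affine on the open set that these directions reach.\<close>

lemma cone_killing_affine: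
  assumes \<epsilon>: "\<epsilon> > 0" "\<epsilon> < norm D" and cont: "continuous_on (ball y0 \<epsilon>) f"
    and kill: "\<And>y w r. y \<in> ball y0 \<epsilon> \<Longrightarrow> w \<in> ball D \<epsilon> \<Longrightarrow> 0 < r \<Longrightarrow> r < 1 \<Longrightarrow> y + r *\<^sub>R w \<in> ball y0 \<epsilon> \<Longrightarrow>
        nu w \<bullet> (f (y + r *\<^sub>R w) - f y) = 0"
  obtains A y1 \<delta> where "linear A" "\<delta> > 0" "ball y1 \<delta> \<subseteq> ball y0 \<epsilon>"
    "\<And>h. norm h < \<delta> \<Longrightarrow> f (y1 + h) = f y1 + A h"
proof -
  define K where "K = norm D + \<epsilon>"
  have K: "K > 0" using \<epsilon> by (simp add: K_def)
  have normw: "norm w \<le> K" if "w \<in> ball D \<epsilon>" for w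
    using that norm_triangle_ineq[of D "w - D"] by (simp add: K_def dist_norm norm_minus_commute)
  (* Steps of length up to 2 r1 in the directions near D, and sums of two of them, stay in the ball. *)
  define r1 where "r1 = min (1/4) (\<epsilon> / (8 * K))"
  have r1: "r1 > 0" "r1 < 1" "r1 * K \<le> \<epsilon> / 8"
  proof -
    show "r1 > 0" "r1 < 1" using \<epsilon> K by (auto simp: r1_def)
    have "r1 \<le> (\<epsilon> / 8) / K" by (simp add: r1_def)
    then show "r1 * K \<le> \<epsilon> / 8" using K by (simp only: pos_le_divide_eq)
  qed
  have small: "norm (s *\<^sub>R u) \<le> \<epsilon> / 4" if "u \<in> ball D \<epsilon>" "0 \<le> s" "s \<le> 2 * r1" for s u
  proof -
    have "norm (s *\<^sub>R u) \<le> (2 * r1) * K"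
      using that normw[OF that(1)] by (auto intro: mult_mono)
    then show ?thesis using r1(3) by simp
  qed
  have par: "f (y0 + s *\<^sub>R u + t *\<^sub>R v) = f (y0 + s *\<^sub>R u) + f (y0 + t *\<^sub>R v) - f y0"
    if u: "u \<in> ball D \<epsilon>" and v: "v \<in> ball D \<epsilon>" and uv: "cross u v \<noteq> 0"
      and s: "0 \<le> s" "s \<le> 2 * r1" and t: "0 \<le> t" "t \<le> 2 * r1" for s t u v
  proof (cases "s = 0 \<or> t = 0")
    case True then show ?thesis by auto
  next
    case False
    then have st: "0 < s" "0 < t" "s < 1" "t < 1" using s t by (auto simp: r1_def)
    have n: "norm (s *\<^sub>R u) \<le> \<epsilon> / 4" "norm (t *\<^sub>R v) \<le> \<epsilon> / 4" using small u v s t by auto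
    have "norm (s *\<^sub>R u + t *\<^sub>R v) \<le> \<epsilon> / 2" using norm_triangle_ineq[of "s *\<^sub>R u" "t *\<^sub>R v"] n by linarith
    then have "norm (s *\<^sub>R u + t *\<^sub>R v) < \<epsilon>" "norm (s *\<^sub>R u) < \<epsilon>" "norm (t *\<^sub>R v) < \<epsilon>" using n \<epsilon> by linarith+
    then have b: "y0 \<in> ball y0 \<epsilon>" "y0 + s *\<^sub>R u \<in> ball y0 \<epsilon>" "y0 + t *\<^sub>R v \<in> ball y0 \<epsilon>"
      "y0 + s *\<^sub>R u + t *\<^sub>R v \<in> ball y0 \<epsilon>" "y0 + t *\<^sub>R v + s *\<^sub>R u \<in> ball y0 \<epsilon>"
      using \<epsilon> by (auto simp: dist_norm norm_minus_commute add.assoc algebra_simps)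
    let ?E = "f (y0 + s *\<^sub>R u + t *\<^sub>R v) - f (y0 + s *\<^sub>R u) - f (y0 + t *\<^sub>R v) + f y0"
    have "?E = 0"
    proof (rule orthogonal_to_two[OF cross_nu_nonzero[OF uv]])
      show "nu u \<bullet> ?E = 0"
        using kill[OF b(1) u st(1,3) b(2)] kill[OF b(3) u st(1,3) b(5)]
        by (simp add: inner_diff_right inner_add_right algebra_simps)
      show "nu v \<bullet> ?E = 0"
        using kill[OF b(1) v st(2,4) b(3)] kill[OF b(2) v st(2,4) b(4)]
        by (simp add: inner_diff_right inner_add_right algebra_simps)
    qed
    then show ?thesis by (simp add: algebra_simps)
  qed
  have lin: "f (y0 + s *\<^sub>R u) - f y0 = s *\<^sub>R ((1 / r1) *\<^sub>R (f (y0 + r1 *\<^sub>R u) - f y0))"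
    if u: "u \<in> ball D \<epsilon>" and s: "0 \<le> s" "s \<le> r1" for s u
  proof (rule additive_continuous_complex[OF r1(1) _ _ s, of "\<lambda>s. f (y0 + s *\<^sub>R u) - f y0"])
    have in_ball: "y0 + s *\<^sub>R u \<in> ball y0 \<epsilon>" if "0 \<le> s" "s \<le> 2 * r1" for s
      using small[OF u that] \<epsilon> by (simp add: dist_norm)
    show "continuous_on {0..r1} (\<lambda>s. f (y0 + s *\<^sub>R u) - f y0)"
      by (intro continuous_intros continuous_on_compose2[OF cont])
         (use in_ball r1 in auto)
    fix s t :: real assume st: "0 \<le> s" "0 \<le> t" "s + t \<le> r1"
    have u0: "u \<noteq> 0" using u \<epsilon> by (auto simp: dist_norm)
    have lim: "(\<lambda>n. u + inverse (real (Suc n)) *\<^sub>R (\<i> * u)) \<longlonglongrightarrow> u + 0 *\<^sub>R (\<i> * u)"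
      by (intro tendsto_intros LIMSEQ_inverse_real_of_nat)
    define v where "v n = u + inverse (real (Suc n)) *\<^sub>R (\<i> * u)" for n
    have v: "v \<longlonglongrightarrow> u" using lim by (simp add: v_def[abs_def])
    (* The parallelogram identity needs independent sides, so one side is tilted; the tilt tends to 0. *)
    have cuv: "cross u (v n) \<noteq> 0" for n using u0 by (simp add: v_def cross_algebra cross_rotate)
    have ev: "eventually (\<lambda>n. v n \<in> ball D \<epsilon>) sequentially"
      using v u by (intro topological_tendstoD) auto
    have eq: "eventually (\<lambda>n. f (y0 + s *\<^sub>R u + t *\<^sub>R v n) = f (y0 + s *\<^sub>R u) + f (y0 + t *\<^sub>R v n) - f y0) sequentially"
      using ev by eventually_elim (rule par, use u cuv st r1 in auto)
    have cf: "isCont f y" if "y \<in> ball y0 \<epsilon>" for y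
      using cont that by (simp add: continuous_on_eq_continuous_at)
    have lim1: "(\<lambda>n. f (y0 + s *\<^sub>R u + t *\<^sub>R v n)) \<longlonglongrightarrow> f (y0 + (s + t) *\<^sub>R u)"
    proof (rule isCont_tendsto_compose[OF cf])
      show "y0 + (s + t) *\<^sub>R u \<in> ball y0 \<epsilon>" using in_ball[of "s + t"] st r1 by auto
      have "(\<lambda>n. y0 + s *\<^sub>R u + t *\<^sub>R v n) \<longlonglongrightarrow> y0 + s *\<^sub>R u + t *\<^sub>R u" by (intro tendsto_intros v)
      then show "(\<lambda>n. y0 + s *\<^sub>R u + t *\<^sub>R v n) \<longlonglongrightarrow> y0 + (s + t) *\<^sub>R u" by (simp add: algebra_simps)
    qed
    have lim2: "(\<lambda>n. f (y0 + s *\<^sub>R u) + f (y0 + t *\<^sub>R v n) - f y0) \<longlonglongrightarrow> f (y0 + s *\<^sub>R u) + f (y0 + t *\<^sub>R u) - f y0"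
      by (intro tendsto_intros v isCont_tendsto_compose[OF cf] in_ball) (use st r1 in auto)
    from Lim_transform_eventually[OF lim1 eq] lim2
    have "f (y0 + (s + t) *\<^sub>R u) = f (y0 + s *\<^sub>R u) + f (y0 + t *\<^sub>R u) - f y0"
      by (rule LIMSEQ_unique)
    then show "f (y0 + (s + t) *\<^sub>R u) - f y0 = f (y0 + s *\<^sub>R u) - f y0 + (f (y0 + t *\<^sub>R u) - f y0)"
      by simp
  qed
  define u v where "u = D" and "v = D + (\<epsilon> / (2 * norm D)) *\<^sub>R (\<i> * D)"
  have D0: "norm D > 0" using \<epsilon> by linarith
  have ub: "u \<in> ball D \<epsilon>" and vb: "v \<in> ball D \<epsilon>"
    using \<epsilon> D0 by (auto simp: u_def v_def dist_norm norm_mult)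
  have uv: "cross u v \<noteq> 0" using D0 \<epsilon> by (auto simp: u_def v_def cross_algebra cross_rotate)
  define a b where "a = (1 / r1) *\<^sub>R (f (y0 + r1 *\<^sub>R u) - f y0)" and "b = (1 / r1) *\<^sub>R (f (y0 + r1 *\<^sub>R v) - f y0)"
  have aff: "f (y0 + s *\<^sub>R u + t *\<^sub>R v) = f y0 + s *\<^sub>R a + t *\<^sub>R b"
    if "0 \<le> s" "s \<le> r1" "0 \<le> t" "t \<le> r1" for s t
  proof -
    have "f (y0 + s *\<^sub>R u) - f y0 = s *\<^sub>R a" "f (y0 + t *\<^sub>R v) - f y0 = t *\<^sub>R b"
      using lin[OF ub, of s] lin[OF vb, of t] that by (auto simp: a_def b_def)
    moreover have "f (y0 + s *\<^sub>R u + t *\<^sub>R v) = f (y0 + s *\<^sub>R u) + f (y0 + t *\<^sub>R v) - f y0"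
      by (rule par[OF ub vb uv]) (use that r1 in auto)
    ultimately show ?thesis by (simp add: algebra_simps)
  qed
  (* The centre of the parallelogram on which f is known to be affine. *)
  define y1 where "y1 = y0 + (r1 / 2) *\<^sub>R u + (r1 / 2) *\<^sub>R v"
  define A where "A h = (cross h v / cross u v) *\<^sub>R a + (cross u h / cross u v) *\<^sub>R b" for h
  have "linear A"
    by (rule linearI) (simp_all add: A_def cross_algebra add_divide_distrib scaleR_left_distrib scaleR_add_right)
  have l1: "((\<lambda>h. cross h v / cross u v) \<longlongrightarrow> cross 0 v / cross u v) (nhds 0)"
    by (intro tendsto_intros filterlim_ident uv)
  then have e1: "eventually (\<lambda>h. \<bar>cross h v / cross u v\<bar> < r1 / 2) (nhds 0)"
    using r1 tendstoD[OF l1, of "r1 / 2"] by (simp add: cross_algebra dist_real_def)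
  have l2: "((\<lambda>h. cross u h / cross u v) \<longlongrightarrow> cross u 0 / cross u v) (nhds 0)"
    by (intro tendsto_intros filterlim_ident uv)
  then have e2: "eventually (\<lambda>h. \<bar>cross u h / cross u v\<bar> < r1 / 2) (nhds 0)"
    using r1 tendstoD[OF l2, of "r1 / 2"] by (simp add: cross_algebra dist_real_def)
  from eventually_conj[OF e1 e2] obtain \<delta>' where \<delta>': "\<delta>' > 0"
    "\<And>h. norm h < \<delta>' \<Longrightarrow> \<bar>cross h v / cross u v\<bar> < r1 / 2 \<and> \<bar>cross u h / cross u v\<bar> < r1 / 2"
    by (auto simp: eventually_nhds_metric)
  have affine: "f (y1 + h) = f y1 + A h" if "norm h < \<delta>'" for h
  proof -
    let ?s = "cross h v / cross u v" and ?t = "cross u h / cross u v"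
    have st: "\<bar>?s\<bar> < r1 / 2" "\<bar>?t\<bar> < r1 / 2" using \<delta>'(2)[OF that] by auto
    have "y1 + h = y0 + (r1 / 2 + ?s) *\<^sub>R u + (r1 / 2 + ?t) *\<^sub>R v"
      by (subst basis_expansion[OF uv, of h]) (simp add: y1_def scaleR_left_distrib)
    then have "f (y1 + h) = f y0 + (r1 / 2 + ?s) *\<^sub>R a + (r1 / 2 + ?t) *\<^sub>R b"
      using st by (simp only:) (rule aff; linarith)
    moreover have "f y1 = f y0 + (r1 / 2) *\<^sub>R a + (r1 / 2) *\<^sub>R b"
      unfolding y1_def by (rule aff) (use r1 in auto)
    ultimately show ?thesis by (simp add: A_def scaleR_left_distrib)
  qed
  have "norm (y1 - y0) \<le> \<epsilon> / 4 + \<epsilon> / 4"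
    using norm_triangle_ineq[of "(r1 / 2) *\<^sub>R u" "(r1 / 2) *\<^sub>R v"] small[OF ub, of "r1 / 2"] small[OF vb, of "r1 / 2"] r1
    by (simp add: y1_def)
  then have "ball y1 (min \<delta>' (\<epsilon> / 2)) \<subseteq> ball y0 \<epsilon>"
    using \<epsilon> by (subst ball_subset_ball_iff) (auto simp: dist_norm)
  then show ?thesis
    by (intro that[OF \<open>linear A\<close>, of "min \<delta>' (\<epsilon> / 2)" y1]) (use \<delta>' \<epsilon> affine in auto)
qed

end

text \<open>The equation that is excluded says that \<open>N\<close> is the norm of an inner
  product for which \<open>u\<close> and \<open>v\<close> are orthogonal and of equal
  length.\<close>

locale noneuclidean_norm_plane = norm_plane +
  assumes noneuclidean: "cross u v \<noteq> 0 \<Longrightarrow> \<exists>\<alpha> \<beta>. N (\<alpha> *\<^sub>R u + \<beta> *\<^sub>R v) \<noteq> sqrt (\<alpha>\<^sup>2 + \<beta>\<^sup>2) * N u"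
begin

lemma killing_field_zero:
  assumes "linear A" "open \<Omega>" "p \<in> \<Omega>" "\<And>u. u \<in> \<Omega> \<Longrightarrow> u \<noteq> 0 \<Longrightarrow> nu u \<bullet> A u = 0"
  shows "A w = 0"
proof (rule ccontr)
  assume "A w \<noteq> 0"
  have "nu u \<bullet> A u = 0" if "u \<noteq> 0" for u by (rule killing_field_globalizes[OF assms that])
  from killing_field_imp_euclidean[OF assms(1) this \<open>A w \<noteq> 0\<close>] noneuclidean show False by metis
qed

text \<open>If no choice of \<open>x\<close> near \<open>x0\<close> and \<open>y\<close> near
  \<open>y0\<close> is rigid, then the velocities of \<open>flex\<close> preserve to first order
  the distance of every such \<open>x\<close> from every such \<open>y\<close>. Of two points near
  \<open>y0\<close> on a line through a point near \<open>x0\<close>, the mutual distance is then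
  preserved too. By \<open>cone_killing_affine\<close> the field is affine somewhere near
  \<open>y0\<close>, with a linear part tangent to the spheres; the norm being non-Euclidean, this
  part vanishes and the field is constant. A constant velocity orthogonal to varying gradients is
  zero, although \<open>z\<close> moves.\<close>

lemma K4_rigid_dense:
  assumes V: "open V1" "open V2" "x0 \<in> V1" "y0 \<in> V2" and xy: "x0 \<noteq> y0"
    and zx: "cross z x0 \<noteq> 0" and zy: "cross z y0 \<noteq> 0"
  shows "\<exists>x\<in>V1. \<exists>y\<in>V2. K4_rigid z x y"
proof (rule ccontr)
  assume nr: "\<not> ?thesis"
  have op: "open {x. cross z x \<noteq> 0}"
    by (intro open_Collect_neq continuous_intros)
  have "open (V1 \<inter> {x. cross z x \<noteq> 0})" "x0 \<in> V1 \<inter> {x. cross z x \<noteq> 0}" using V zx op by auto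
  then obtain e1 where e1: "e1 > 0" "ball x0 e1 \<subseteq> V1 \<inter> {x. cross z x \<noteq> 0}" by (meson openE)
  have "open (V2 \<inter> {x. cross z x \<noteq> 0})" "y0 \<in> V2 \<inter> {x. cross z x \<noteq> 0}" using V zy op by auto
  then obtain e2 where e2: "e2 > 0" "ball y0 e2 \<subseteq> V2 \<inter> {x. cross z x \<noteq> 0}" by (meson openE)
  define \<epsilon> where "\<epsilon> = Min {e1 / 2, e2, norm (x0 - y0) / 2}"
  have \<epsilon>: "\<epsilon> > 0" "\<epsilon> \<le> e1 / 2" "\<epsilon> \<le> e2" "\<epsilon> < norm (x0 - y0)"
  proof -
    show "\<epsilon> > 0" "\<epsilon> \<le> e1 / 2" "\<epsilon> \<le> e2" using e1 e2 xy by (auto simp: \<epsilon>_def)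
    have "\<epsilon> \<le> norm (x0 - y0) / 2" by (simp add: \<epsilon>_def)
    also have "\<dots> < norm (x0 - y0)" using xy by simp
    finally show "\<epsilon> < norm (x0 - y0)" .
  qed
  let ?D = "x0 - y0" and ?f = "flex z"
  have Y: "y \<in> V2" "cross z y \<noteq> 0" if "y \<in> ball y0 \<epsilon>" for y
  proof -
    have "y \<in> ball y0 e2" using that \<epsilon> by simp
    with e2(2) show "y \<in> V2" "cross z y \<noteq> 0" by auto
  qed
  have flexed: "nu (x - y) \<bullet> (?f x - ?f y) = 0" if "x \<in> ball x0 e1" "y \<in> ball y0 \<epsilon>" for x y
  proof (rule not_K4_rigid_imp_flex)
    have "x \<in> V1" using e1 that(1) by auto
    then show "\<not> K4_rigid z x y" using nr Y(1)[OF that(2)] by blast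
    show "cross z x \<noteq> 0" using e1(2) that(1) by auto
  qed (rule Y(2)[OF that(2)])
  have kill: "nu w \<bullet> (?f (y + r *\<^sub>R w) - ?f y) = 0"
    if y: "y \<in> ball y0 \<epsilon>" and w: "w \<in> ball ?D \<epsilon>" and r: "0 < r" "r < 1" and yr: "y + r *\<^sub>R w \<in> ball y0 \<epsilon>" for y w r
  proof -
    (* The point x lies near x0, on the line through y and y + r w; both distances to it are preserved. *)
    define x where "x = y + w"
    have "dist x0 x \<le> dist y0 y + dist ?D w"
      using norm_triangle_ineq[of "y0 - y" "?D - w"] by (simp add: x_def dist_norm algebra_simps)
    then have x: "x \<in> ball x0 e1" using y w \<epsilon> by simp
    have w0: "w \<noteq> 0" using w \<epsilon> by (auto simp: dist_norm)
    have "x - y = w" "x - (y + r *\<^sub>R w) = (1 - r) *\<^sub>R w" by (auto simp: x_def algebra_simps)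
    with flexed[OF x y] flexed[OF x yr] nu_scale[OF w0, of "1 - r"] r
    show ?thesis by (simp add: inner_diff_right)
  qed
  have contf: "continuous_on (ball y0 \<epsilon>) ?f"
    by (rule continuous_on_subset[OF continuous_on_flex]) (use Y in auto)
  obtain A y1 \<delta> where A: "linear A" "\<delta> > 0" "ball y1 \<delta> \<subseteq> ball y0 \<epsilon>"
    "\<And>h. norm h < \<delta> \<Longrightarrow> ?f (y1 + h) = ?f y1 + A h"
    by (rule cone_killing_affine[OF \<epsilon>(1,4) contf], erule (4) kill, blast)
  interpret A: linear A by (rule A(1))
  have y1: "y1 \<in> ball y0 \<epsilon>" using A(2,3) centre_in_ball by blast
  have "A w = 0" for w
  proof (rule killing_field_zero[OF A(1) open_ball, of "?D" ?D \<epsilon>])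
    fix u assume u: "u \<in> ball ?D \<epsilon>" "u \<noteq> 0"
    define r where "r = min (1/2) (\<delta> / (2 * norm u))"
    have r: "0 < r" "r < 1" using u A(2) by (auto simp: r_def)
    have "r \<le> \<delta> / (2 * norm u)" by (simp add: r_def)
    then have "r * norm u \<le> \<delta> / (2 * norm u) * norm u" by (rule mult_right_mono) simp
    then have "norm (r *\<^sub>R u) \<le> \<delta> / (2 * norm u) * norm u" using r by simp
    then have ru: "norm (r *\<^sub>R u) < \<delta>" using u A(2) by simp
    then have "y1 + r *\<^sub>R u \<in> ball y1 \<delta>" by (simp add: dist_norm)
    then have "y1 + r *\<^sub>R u \<in> ball y0 \<epsilon>" using A(3) by blast
    from kill[OF y1 u(1) r this] A(4)[OF ru] r
    show "nu u \<bullet> A u = 0" by (simp add: A.scaleR)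
  qed (use \<epsilon> in auto)
  then have const: "?f (y1 + h) = ?f y1" if "norm h < \<delta>" for h using A(4)[OF that] by simp
  have zy1: "cross z y1 \<noteq> 0" by (rule Y[OF y1])
  have y10: "y1 \<noteq> 0" using zy1 by (auto simp: cross_algebra)
  define y2 where "y2 = y1 + (\<delta> / (2 * norm y1)) *\<^sub>R (\<i> * y1)"
  have n2: "norm ((\<delta> / (2 * norm y1)) *\<^sub>R (\<i> * y1)) < \<delta>" using A(2) y10 by (simp add: norm_mult)
  then have "y2 \<in> ball y1 \<delta>" by (simp add: y2_def dist_norm)
  then have y2: "y2 \<in> ball y0 \<epsilon>" using A(3) by blast
  have "cross y1 y2 \<noteq> 0" using A(2) y10 by (simp add: y2_def cross_algebra cross_rotate)
  then have "?f y1 = 0"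
  proof (rule orthogonal_to_two[OF cross_nu_nonzero])
    show "nu y1 \<bullet> ?f y1 = 0" by (rule flex_inner[OF zy1])
    show "nu y2 \<bullet> ?f y1 = 0"
      using flex_inner(1)[OF Y(2)[OF y2]] const[OF n2] by (simp add: y2_def)
  qed
  then show False using flex_inner(2)[OF zy1] triangle_cross_nu[OF zy1] by simp
qed

end

section \<open>From local to global uniqueness\<close>

text \<open>Sard's theorem in the form of existence of regular values, for arbitrary Euclidean
  spaces of the same dimension.\<close>

lemma regular_value_in_open:
  fixes f :: "'a::euclidean_space \<Rightarrow> 'b::euclidean_space"
  assumes dim: "DIM('a) = CARD('n::{finite,wellorder})" "DIM('b) = CARD('n)"
    and der: "\<And>x. x \<in> S \<Longrightarrow> (f has_derivative f' x) (at x)"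
    and sing: "\<And>x. x \<in> S \<Longrightarrow> \<not> inj (f' x)"
    and W: "open W" "W \<noteq> {}"
  shows "\<exists>c\<in>W. c \<notin> f ` S"
proof (rule ccontr)
  assume "\<not> ?thesis"
  then have sub: "W \<subseteq> f ` S" by blast
  have d: "DIM((real, 'n) vec) = DIM('a)" "DIM('b) = DIM((real, 'n) vec)" using dim by simp_all
  obtain g :: "(real, 'n) vec \<Rightarrow> 'a" and g' where g: "linear g" "linear g'" "\<And>x. g' (g x) = x" "\<And>y. g (g' y) = y"
    using isomorphisms_UNIV_UNIV[OF d(1)] by metis
  obtain h :: "'b \<Rightarrow> (real, 'n) vec" and h' where h: "linear h" "linear h'" "\<And>x. h' (h x) = x" "\<And>y. h (h' y) = y"
    using isomorphisms_UNIV_UNIV[OF d(2)] by metis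
  let ?F = "\<lambda>x. h (f (g x))" and ?F' = "\<lambda>x v. h (f' (g x) (g v))"
  have "negligible (?F ` (g' ` S))"
  proof (rule baby_Sard[where f' = ?F'])
    fix x assume "x \<in> g' ` S"
    then have x: "g x \<in> S" using g by auto
    have gd: "(g has_derivative g) (at x)" using g(1) by (simp add: linear_imp_has_derivative)
    have hd: "(h has_derivative h) (at y)" for y using h(1) by (simp add: linear_imp_has_derivative)
    have d: "(?F has_derivative ?F' x) (at x)"
      using has_derivative_compose[OF has_derivative_compose[OF gd der[OF x]] hd] .
    then show "(?F has_derivative ?F' x) (at x within g' ` S)" by (rule has_derivative_at_withinI)
    have lin: "linear (?F' x)" using d by (rule has_derivative_linear)
    obtain u v where uv: "f' (g x) u = f' (g x) v" "u \<noteq> v" using sing[OF x] by (auto simp: inj_def)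
    then have "?F' x (g' u) = ?F' x (g' v)" "g' u \<noteq> g' v" using g by (auto, metis)
    then have "\<not> inj (?F' x)" by (auto simp: inj_def)
    then show "rank (matrix (?F' x)) < CARD('n)"
      using lin by (simp add: less_rank_noninjective matrix_vector_mul(2)[OF lin] inj_def matrix_works)
  qed simp
  moreover have "h ` W \<subseteq> ?F ` (g' ` S)"
    using sub g by (auto simp: image_iff) blast
  ultimately have "negligible (h ` W)" by (rule negligible_subset)
  moreover have "open (h ` W)"
    using W(1) h by (intro open_surjective_linear_image) (auto simp: surj_def, metis)
  ultimately show False using open_not_negligible[of "h ` W"] W(2) by auto
qed

text \<open>A point of the interval outside one of the sets has a whole neighbourhood outside it,
  and in this smaller interval the other sets are avoided in turn.\<close>

lemma avoid_finitely_many_closed: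
  fixes B :: "'j \<Rightarrow> real set"
  assumes "finite J" and cl: "\<And>j. j \<in> J \<Longrightarrow> closed (B j)"
    and ni: "\<And>j a b. j \<in> J \<Longrightarrow> a < b \<Longrightarrow> \<exists>s. a < s \<and> s < b \<and> s \<notin> B j"
  shows "a < b \<Longrightarrow> \<exists>s. a < s \<and> s < b \<and> (\<forall>j\<in>J. s \<notin> B j)"
  using assms
proof (induction J arbitrary: a b rule: finite_induct)
  case empty
  then show ?case using dense by auto
next
  case (insert i J)
  obtain s where s: "a < s" "s < b" "s \<notin> B i" using insert.prems(3)[of i a b] insert.prems(1) by auto
  have "open (- B i \<inter> {a<..<b})" "s \<in> - B i \<inter> {a<..<b}" using insert.prems(2) s by (auto simp: closed_def)
  then obtain e where e: "e > 0" "ball s e \<subseteq> - B i \<inter> {a<..<b}" by (meson openE)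
  have "\<exists>t. s < t \<and> t < s + e \<and> (\<forall>j\<in>J. t \<notin> B j)"
    by (rule insert.IH) (use e insert.prems in auto)
  then obtain t where t: "s < t" "t < s + e" "\<forall>j\<in>J. t \<notin> B j" by auto
  then have "t \<in> ball s e" by (simp add: dist_real_def)
  then have "t \<notin> B i" "a < t" "t < b" using e(2) by auto
  with t show ?case by auto
qed

lemma linear_eq_id_on_basis:
  assumes "linear L" "cross u v \<noteq> 0" "L u = u" "L v = v"
  shows "L w = w"
proof -
  interpret linear L by fact
  have "L (\<alpha> *\<^sub>R u + \<beta> *\<^sub>R v) = \<alpha> *\<^sub>R u + \<beta> *\<^sub>R v" for \<alpha> \<beta>
    by (simp add: add scaleR assms)
  from this[of "cross w v / cross u v" "cross u w / cross u v"]
  show ?thesis unfolding basis_expansion[OF assms(2), of w, symmetric] .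
qed

context norm_plane
begin

definition linear_isometry :: "(complex \<Rightarrow> complex) \<Rightarrow> bool" where
  "linear_isometry L \<longleftrightarrow> linear L \<and> (\<forall>x. N (L x) = N x)"

lemma linear_isometry_inverse:
  assumes L: "linear_isometry L"
  obtains L' where "linear_isometry L'" "\<And>x. L' (L x) = x" "\<And>x. L (L' x) = x"
proof -
  interpret linear L using L by (simp add: linear_isometry_def)
  have "inj L"
  proof (rule injI)
    fix x y assume "L x = L y"
    then have "L (x - y) = 0" by (simp add: diff)
    moreover have "N (L (x - y)) = N (x - y)" using L by (simp add: linear_isometry_def)
    ultimately show "x = y" by simp
  qed
  then obtain L' where L': "linear L'" "\<And>x. L' (L x) = x" "\<And>x. L (L' x) = x"
    using linear_injective_isomorphism[of L] L by (auto simp: linear_isometry_def)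
  moreover have "N (L' x) = N x" for x using L L'(3)[of x] by (metis linear_isometry_def)
  ultimately show ?thesis by (intro that[of L']) (auto simp: linear_isometry_def)
qed

text \<open>Two lines that avoid the origin and carry the same norm on an interval of parameters
  correspond under a linear isometry, because the norms agree along the whole lines.\<close>

lemma isometry_of_equal_norms_on_lines:
  assumes ab: "cross a b \<noteq> 0" and ab': "cross a' b' \<noteq> 0" and cd: "c < d"
    and eq: "\<And>s. c < s \<Longrightarrow> s < d \<Longrightarrow> N (a + s *\<^sub>R b) = N (a' + s *\<^sub>R b')"
  obtains L where "linear_isometry L" "L a = a'" "L b = b'"
proof -
  have "N (a + s *\<^sub>R b) - N (a' + s *\<^sub>R b') = 0" for s
    by (rule line_analytic_identity[OF line_analytic_diff[OF line_analytic_N line_analytic_N] cd])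
       (use eq cross_line_nonzero ab ab' in auto)
  then have all: "N (a + s *\<^sub>R b) = N (a' + s *\<^sub>R b')" for s by simp
  define L where "L w = (cross w b / cross a b) *\<^sub>R a' + (cross a w / cross a b) *\<^sub>R b'" for w
  have lin: "linear L"
    by (rule linearI) (simp_all add: L_def cross_algebra add_divide_distrib scaleR_left_distrib scaleR_add_right)
  have nz: "N (\<alpha> *\<^sub>R a + \<beta> *\<^sub>R b) = N (\<alpha> *\<^sub>R a' + \<beta> *\<^sub>R b')" if "\<alpha> \<noteq> 0" for \<alpha> \<beta>
  proof -
    have "\<alpha> *\<^sub>R a + \<beta> *\<^sub>R b = \<alpha> *\<^sub>R (a + (\<beta> / \<alpha>) *\<^sub>R b)" "\<alpha> *\<^sub>R a' + \<beta> *\<^sub>R b' = \<alpha> *\<^sub>R (a' + (\<beta> / \<alpha>) *\<^sub>R b')"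
      using that by (simp_all add: scaleR_add_right)
    then show ?thesis using all[of "\<beta> / \<alpha>"] by (simp only: N_scale)
  qed
  have "N (\<alpha> *\<^sub>R a + \<beta> *\<^sub>R b) = N (\<alpha> *\<^sub>R a' + \<beta> *\<^sub>R b')" for \<alpha> \<beta>
  proof (cases "\<alpha> = 0")
    case True
    let ?i = "\<lambda>n. inverse (real (Suc n))"
    have "(\<lambda>n. N (?i n *\<^sub>R a + \<beta> *\<^sub>R b)) \<longlonglongrightarrow> N (0 *\<^sub>R a + \<beta> *\<^sub>R b)"
      "(\<lambda>n. N (?i n *\<^sub>R a' + \<beta> *\<^sub>R b')) \<longlonglongrightarrow> N (0 *\<^sub>R a' + \<beta> *\<^sub>R b')"
      by (intro tendsto_intros LIMSEQ_inverse_real_of_nat)+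
    moreover have "N (?i n *\<^sub>R a + \<beta> *\<^sub>R b) = N (?i n *\<^sub>R a' + \<beta> *\<^sub>R b')" for n
      by (rule nz) simp
    ultimately show ?thesis using True LIMSEQ_unique by auto
  qed (rule nz)
  then have "N (L w) = N w" for w
    unfolding L_def by (subst (3) basis_expansion[OF ab, of w]) simp
  with lin show ?thesis
    by (intro that[of L]) (use ab in \<open>auto simp: linear_isometry_def L_def cross_algebra\<close>)
qed

text \<open>An isometry that fixes \<open>z\<close> preserves the gradient there, hence the
  tangent direction of the sphere, on which it can act only by a sign.\<close>

lemma isometry_fixing_is_reflection:
  assumes L: "linear_isometry L" and z: "z \<noteq> 0" "L z = z" and w0: "L w0 \<noteq> w0"
  shows "L w = (2 * (nu z \<bullet> w) / N z) *\<^sub>R z - w"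
proof -
  interpret linear L using L by (simp add: linear_isometry_def)
  have adj: "adjoint L (nu z) \<bullet> w = nu z \<bullet> L w" for w
    using adjoint_works[OF linear_axioms, of w "nu z"] by (simp add: inner_commute)
  have "adjoint L (nu z) = nu z"
  proof (rule subgradient_unique[OF z(1)])
    show "adjoint L (nu z) \<bullet> w \<le> N w" for w
      using nu_le[OF z(1), of "L w"] L by (simp add: adj linear_isometry_def)
    show "adjoint L (nu z) \<bullet> z = N z" by (simp add: adj z nu_self)
  qed
  with adj have inv: "nu z \<bullet> L w = nu z \<bullet> w" for w by simp
  define h where "h = \<i> * nu z"
  have h0: "h \<noteq> 0" using nu_nonzero[OF z(1)] by (simp add: h_def)
  have crossh: "cross h w = - (nu z \<bullet> w)" for w by (simp add: h_def cross_def inner_complex_def)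
  have "nu z \<bullet> h = 0" by (simp add: h_def inner_complex_def)
  then have "cross h (L h) = 0" by (simp add: crossh inv)
  then obtain m where m: "L h = m *\<^sub>R h" using h0 by (rule cross_eq_0_imp_scale)
  have "N (L h) = N h" using L by (simp add: linear_isometry_def)
  then have "\<bar>m\<bar> = 1" using h0 m by (simp add: N_scale)
  moreover have "m \<noteq> 1"
  proof
    assume "m = 1"
    then have "L h = h" using m by simp
    moreover have "cross h z \<noteq> 0" using nu_self[OF z(1)] z(1) by (simp add: crossh)
    ultimately show False using linear_eq_id_on_basis[OF linear_axioms, of h z w0] z(2) w0 by simp
  qed
  ultimately have m1: "m = -1" by auto
  (* Decompose w along z and the tangent h; L changes the sign of h. *)
  define p where "p = (nu z \<bullet> w / N z)"
  have "cross h (w - p *\<^sub>R z) = 0"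
    using z(1) by (simp add: crossh inner_diff_right p_def nu_self)
  then obtain b where "w - p *\<^sub>R z = b *\<^sub>R h" using h0 by (rule cross_eq_0_imp_scale)
  then have w: "w = p *\<^sub>R z + b *\<^sub>R h" by (simp add: algebra_simps)
  then have "L w = p *\<^sub>R z - b *\<^sub>R h" using z m m1 by (metis add scaleR scaleR_minus_left scaleR_one scaleR_minus_right uminus_add_conv_diff add.commute)
  also have "\<dots> = (2 * p) *\<^sub>R z - w" by (subst w) (simp add: algebra_simps scaleR_2[symmetric])
  finally show ?thesis by (simp add: p_def)
qed

text \<open>Suppose that \<open>Q n\<close> is equivalent to \<open>P n\<close>, where \<open>P
  n\<close> tends to \<open>P0\<close>. A limit point of \<open>Q n\<close> is equivalent to
  \<open>P0\<close>, so it is \<open>L P0\<close> with \<open>L\<close> in \<open>G\<close>;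
  undoing \<open>L\<close> brings \<open>Q n\<close> close to \<open>P0\<close>, where local
  injectivity identifies it with \<open>P n\<close>.\<close>

lemma fibre_stability:
  fixes P0 :: "'p::euclidean_space" and k :: "'p \<Rightarrow> 'q::real_normed_vector"
  assumes lin: "\<And>l. l \<in> I \<Longrightarrow> linear l" and k: "linear k"
    and bound: "\<And>P Q. k P = k Q \<Longrightarrow> \<forall>l\<in>I. N (l P) = N (l Q) \<Longrightarrow> norm Q \<le> h P"
    and h: "isCont h P0"
    and fibre: "\<And>Q. k P0 = k Q \<Longrightarrow> \<forall>l\<in>I. N (l P0) = N (l Q) \<Longrightarrow> \<exists>L\<in>G. Q = L P0"
    and G: "\<And>L. L \<in> G \<Longrightarrow> \<exists>L'. linear L' \<and> (\<forall>P. L' (L P) = P \<and> L (L' P) = P \<and> k (L' P) = k P \<and> (\<forall>l\<in>I. N (l (L' P)) = N (l P)))"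
    and inj: "\<exists>e>0. \<forall>P Q. dist P P0 < e \<longrightarrow> dist Q P0 < e \<longrightarrow> k P = k Q \<longrightarrow>
       (\<forall>l\<in>I. N (l P) = N (l Q)) \<longrightarrow> P = Q"
  shows "\<exists>e>0. \<forall>P Q. dist P P0 < e \<longrightarrow> k P = k Q \<longrightarrow> (\<forall>l\<in>I. N (l P) = N (l Q)) \<longrightarrow> (\<exists>L\<in>G. Q = L P)"
proof (rule ccontr)
  assume "\<not> ?thesis"
  then have "\<exists>P Q. dist P P0 < e \<and> k P = k Q \<and> (\<forall>l\<in>I. N (l P) = N (l Q)) \<and> \<not> (\<exists>L\<in>G. Q = L P)"
    if "e > 0" for e using that by blast
  then have "\<forall>n. \<exists>P Q. dist P P0 < inverse (real (Suc n)) \<and> k P = k Q \<and>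
      (\<forall>l\<in>I. N (l P) = N (l Q)) \<and> \<not> (\<exists>L\<in>G. Q = L P)" by simp
  then obtain P Q where PQ: "\<And>n. dist (P n) P0 < inverse (real (Suc n))"
    "\<And>n. k (P n) = k (Q n)" "\<And>n l. l \<in> I \<Longrightarrow> N (l (P n)) = N (l (Q n))" "\<And>n L. L \<in> G \<Longrightarrow> Q n \<noteq> L (P n)"
    by metis
  have P: "P \<longlonglongrightarrow> P0"
  proof -
    have "(\<lambda>n. dist (P n) P0) \<longlonglongrightarrow> 0"
      by (rule tendsto_sandwich[OF _ _ tendsto_const LIMSEQ_inverse_real_of_nat])
         (use PQ(1) in \<open>auto intro!: always_eventually less_imp_le\<close>)
    then show ?thesis by (rule tendsto_dist_iff[THEN iffD2])
  qed
  have "(\<lambda>n. h (P n)) \<longlonglongrightarrow> h P0" by (rule isCont_tendsto_compose[OF h P])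
  then have "bounded (range (\<lambda>n. h (P n)))" by (rule convergent_imp_bounded)
  then obtain C where C: "\<And>n. norm (h (P n)) \<le> C" by (auto simp: bounded_iff)
  have "norm (Q n) \<le> C" for n using bound[of "P n" "Q n"] PQ(2,3) C[of n] by fastforce
  then have "bounded (range Q)" by (auto simp: bounded_iff)
  then obtain Q0 r where r: "strict_mono r" and "(Q \<circ> r) \<longlonglongrightarrow> Q0"
    using bounded_imp_convergent_subsequence by blast
  then have Q: "(\<lambda>n. Q (r n)) \<longlonglongrightarrow> Q0" by (simp add: o_def)
  have Pr: "(\<lambda>n. P (r n)) \<longlonglongrightarrow> P0" using LIMSEQ_subseq_LIMSEQ[OF P r] by (simp add: o_def)
  have tl: "(\<lambda>n. l (X n)) \<longlonglongrightarrow> l x" if "linear l" "X \<longlonglongrightarrow> x" for l :: "'p \<Rightarrow> 'x::real_normed_vector" and X x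
    by (rule bounded_linear.tendsto[OF linear_conv_bounded_linear[THEN iffD1, OF that(1)] that(2)])
  have "\<exists>L\<in>G. Q0 = L P0"
  proof (rule fibre)
    show "k P0 = k Q0" using tl[OF k Pr] tl[OF k Q] PQ(2) LIMSEQ_unique by fastforce
    show "\<forall>l\<in>I. N (l P0) = N (l Q0)"
    proof
      fix l assume l: "l \<in> I"
      show "N (l P0) = N (l Q0)"
        using tendsto_N[OF tl[OF lin[OF l] Pr]] tendsto_N[OF tl[OF lin[OF l] Q]] PQ(3)[OF l] LIMSEQ_unique by fastforce
    qed
  qed
  then obtain L where L: "L \<in> G" "Q0 = L P0" by blast
  from G[OF L(1)] obtain L' where L': "linear L'" "\<And>P. L' (L P) = P" "\<And>P. L (L' P) = P" "\<And>P. k (L' P) = k P"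
    "\<And>P l. l \<in> I \<Longrightarrow> N (l (L' P)) = N (l P)" by blast
  obtain e0 where e0: "e0 > 0" and inj0: "\<And>P Q. dist P P0 < e0 \<Longrightarrow> dist Q P0 < e0 \<Longrightarrow> k P = k Q \<Longrightarrow>
       \<forall>l\<in>I. N (l P) = N (l Q) \<Longrightarrow> P = Q" using inj by blast
  have "(\<lambda>n. L' (Q (r n))) \<longlonglongrightarrow> P0" using tl[OF L'(1) Q] L L'(2) by simp
  from tendstoD[OF this e0] tendstoD[OF Pr e0]
  have "eventually (\<lambda>n. dist (L' (Q (r n))) P0 < e0 \<and> dist (P (r n)) P0 < e0) sequentially"
    by (rule eventually_conj)
  then obtain n where n: "dist (L' (Q (r n))) P0 < e0" "dist (P (r n)) P0 < e0"
    by (auto simp: eventually_sequentially)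
  have "P (r n) = L' (Q (r n))"
    by (rule inj0) (use n PQ L' in auto)
  then have "Q (r n) = L (P (r n))" using L'(3) by simp
  with PQ(4)[OF L(1)] show False by blast
qed

text \<open>A placement of the complete graph on four vertices, up to translation, is a triple
  \<open>(z, x, y)\<close>: one vertex is at \<open>0\<close>.\<close>

definition K4_edges :: "(complex \<times> complex \<times> complex \<Rightarrow> complex) set" where
  "K4_edges = {fst, \<lambda>P. fst (snd P), \<lambda>P. fst (snd P) - fst P, \<lambda>P. snd (snd P), \<lambda>P. snd (snd P) - fst P,
     \<lambda>P. fst (snd P) - snd (snd P)}"

definition K4_lengths :: "complex \<times> complex \<times> complex \<Rightarrow> real \<times> real \<times> real \<times> real \<times> real \<times> real" where
  "K4_lengths P = (N (fst P), N (fst (snd P)), N (fst (snd P) - fst P), N (snd (snd P)), N (snd (snd P) - fst P),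
     N (fst (snd P) - snd (snd P)))"

lemma K4_lengths_eq_iff: "K4_lengths P = K4_lengths Q \<longleftrightarrow> (\<forall>l\<in>K4_edges. N (l P) = N (l Q))"
  by (simp add: K4_lengths_def K4_edges_def)

lemma linear_K4_edges: "l \<in> K4_edges \<Longrightarrow> linear l"
  unfolding K4_edges_def
  by (auto intro!: linear_compose_sub linear_fst linear_snd linear_compose_snd)

lemma K4_edges_iff_rigid:
  "(\<forall>v. (\<forall>l\<in>K4_edges. nu (l (z, x, y)) \<bullet> l v = 0) \<longrightarrow> v = 0) \<longleftrightarrow> K4_rigid z x y"
  by (auto simp: K4_edges_def K4_rigid_def prod_eq_iff split_paired_all)

lemma K4_edges_nonzero:
  assumes "cross z x \<noteq> 0" "cross z y \<noteq> 0" "x \<noteq> y" "l \<in> K4_edges"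
  shows "l (z, x, y) \<noteq> 0"
  using assms triangle_cross_nu[OF assms(1)] triangle_cross_nu[OF assms(2)] by (auto simp: K4_edges_def)

lemma K4_rigid_imp_locally_injective:
  assumes "cross z x \<noteq> 0" "cross z y \<noteq> 0" "x \<noteq> y" and r: "K4_rigid z x y"
  shows "\<exists>e>0. \<forall>P Q. dist P (z, x, y) < e \<longrightarrow> dist Q (z, x, y) < e \<longrightarrow> K4_lengths P = K4_lengths Q \<longrightarrow> P = Q"
proof -
  have "\<exists>e>0. \<forall>P Q. dist P (z, x, y) < e \<longrightarrow> dist Q (z, x, y) < e \<longrightarrow> (0::real) = 0 \<longrightarrow>
      (\<forall>l\<in>K4_edges. N (l P) = N (l Q)) \<longrightarrow> P = Q"
    using r[folded K4_edges_iff_rigid]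
    by (intro infinitesimally_rigid_imp_locally_injective linear_K4_edges linear_zero K4_edges_nonzero[OF assms(1-3)]) blast+
  then show ?thesis by (simp add: K4_lengths_eq_iff)
qed

lemma continuous_on_K4_lengths: "continuous_on S K4_lengths"
  unfolding K4_lengths_def by (intro continuous_intros)

lemma K4_norm_bound:
  obtains c where "c > 0" "\<And>P :: complex \<times> complex \<times> complex. norm P \<le> c * (N (fst P) + N (fst (snd P)) + N (snd (snd P)))"
proof -
  obtain c where c: "c > 0" "\<And>x. c * norm x \<le> N x" using N_lower by auto
  show ?thesis
  proof (rule that[of "1 / c"])
    fix P :: "complex \<times> complex \<times> complex"
    obtain z x y where P: "P = (z, x, y)" by (cases P) auto
    have "norm P \<le> norm z + (norm x + norm y)"
      using norm_Pair_le[of z "(x, y)"] norm_Pair_le[of x y] P by simp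
    then have "c * norm P \<le> c * (norm z + (norm x + norm y))" using c(1) by (intro mult_left_mono) auto
    also have "\<dots> \<le> N z + N x + N y" using c(2)[of z] c(2)[of x] c(2)[of y] by (simp add: distrib_left)
    finally show "norm P \<le> 1 / c * (N (fst P) + N (fst (snd P)) + N (snd (snd P)))"
      using c(1) P by (simp add: pos_le_divide_eq mult.commute)
  qed (use c in simp)
qed

definition K4_derivative :: "complex \<times> complex \<times> complex \<Rightarrow> complex \<times> complex \<times> complex \<Rightarrow>
    real \<times> real \<times> real \<times> real \<times> real \<times> real" where
  "K4_derivative P v = (nu (fst P) \<bullet> fst v, nu (fst (snd P)) \<bullet> fst (snd v),
     nu (fst (snd P) - fst P) \<bullet> (fst (snd v) - fst v), nu (snd (snd P)) \<bullet> snd (snd v),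
     nu (snd (snd P) - fst P) \<bullet> (snd (snd v) - fst v),
     nu (fst (snd P) - snd (snd P)) \<bullet> (fst (snd v) - snd (snd v)))"

lemma has_derivative_K4_lengths:
  assumes "\<And>l. l \<in> K4_edges \<Longrightarrow> l P \<noteq> 0"
  shows "(K4_lengths has_derivative K4_derivative P) (at P)"
proof -
  have d: "((\<lambda>P. N (l P)) has_derivative (\<lambda>v. nu (l P) \<bullet> l v)) (at P)" if "l \<in> K4_edges" for l
  proof -
    have "(l has_derivative l) (at P)" using linear_K4_edges[OF that] by (simp add: linear_imp_has_derivative)
    from has_derivative_compose[OF this has_derivative_N[OF assms[OF that]]] show ?thesis .
  qed
  show ?thesis unfolding K4_lengths_def K4_derivative_def[abs_def]
    using d[unfolded K4_edges_def] by (intro has_derivative_Pair) auto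
qed

lemma finite_K4_fibre:
  assumes "\<And>Q. K4_lengths Q = c \<Longrightarrow> \<exists>e>0. \<forall>P. dist P Q < e \<longrightarrow> K4_lengths P = c \<longrightarrow> P = Q"
  shows "finite {Q. K4_lengths Q = c}"
proof (rule compact_locally_unique_imp_finite)
  obtain C where C: "C > 0" "\<And>P :: complex \<times> complex \<times> complex. norm P \<le> C * (N (fst P) + N (fst (snd P)) + N (snd (snd P)))"
    using K4_norm_bound by blast
  obtain c1 c2 c3 c4 c5 c6 where c: "c = (c1, c2, c3, c4, c5, c6)" by (metis surj_pair)
  have "norm Q \<le> C * (c1 + c2 + c4)" if "K4_lengths Q = c" for Q
    using C(2)[of Q] that by (simp add: c K4_lengths_def)
  then have "bounded {Q. K4_lengths Q = c}" by (auto simp: bounded_iff)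
  moreover have "closed {Q. K4_lengths Q = c}"
    by (intro closed_Collect_eq continuous_on_K4_lengths continuous_on_const)
  ultimately show "compact {Q. K4_lengths Q = c}" by (simp add: compact_eq_bounded_closed)
next
  fix Q assume "Q \<in> {Q. K4_lengths Q = c}"
  then show "\<exists>e>0. \<forall>P\<in>{Q. K4_lengths Q = c}. dist P Q < e \<longrightarrow> P = Q" using assms[of Q] by blast
qed

end

context norm_plane
begin

lemma K4_lengths_isometry:
  assumes "linear_isometry L"
  shows "K4_lengths (map_prod L (map_prod L L) P) = K4_lengths P"
proof -
  interpret linear L using assms by (simp add: linear_isometry_def)
  have "N (L a - L b) = N (a - b)" for a b
    using assms by (simp add: linear_isometry_def diff[symmetric])
  then show ?thesis using assms by (simp add: K4_lengths_def linear_isometry_def)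
qed

end

context noneuclidean_norm_plane
begin

lemma K4_rigid_dense_nondegenerate:
  assumes V: "open V1" "open V2" "x0 \<in> V1" "y0 \<in> V2" and xy: "x0 \<noteq> y0"
    and zx: "cross z x0 \<noteq> 0" and zy: "cross z y0 \<noteq> 0"
  obtains x y where "x \<in> V1" "y \<in> V2" "K4_rigid z x y" "cross z x \<noteq> 0" "cross z y \<noteq> 0" "x \<noteq> y"
proof -
  obtain S T where ST: "open S" "open T" "x0 \<in> S" "y0 \<in> T" "S \<inter> T = {}"
    using hausdorff[OF xy] by blast
  have op: "open {x. cross z x \<noteq> 0}" by (intro open_Collect_neq continuous_intros)
  have "\<exists>x\<in>V1 \<inter> S \<inter> {x. cross z x \<noteq> 0}. \<exists>y\<in>V2 \<inter> T \<inter> {x. cross z x \<noteq> 0}. K4_rigid z x y"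
    by (rule K4_rigid_dense[OF _ _ _ _ xy zx zy]) (use V ST op zx zy in auto)
  then show ?thesis using ST(5) that by auto
qed

section \<open>The two halves of the graph\<close>

text \<open>Otherwise every direction would be the axis of an isometric reflection, and products
  of two such reflections would be non-trivial isometries arbitrarily close to the identity,
  against the local injectivity at a rigid \<open>K\<^sub>4\<close>.\<close>

lemma exists_non_axis:
  "\<exists>z. z \<noteq> 0 \<and> (\<forall>L w. linear_isometry L \<longrightarrow> L z = z \<longrightarrow> L w = w)"
proof (rule ccontr)
  assume "\<not> ?thesis"
  then have "\<forall>z. \<exists>L. z \<noteq> 0 \<longrightarrow> linear_isometry L \<and> L z = z \<and> (\<exists>w. L w \<noteq> w)" by blast
  then obtain M where M: "\<And>z. z \<noteq> 0 \<Longrightarrow> linear_isometry (M z)" "\<And>z. z \<noteq> 0 \<Longrightarrow> M z z = z"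
    "\<And>z. z \<noteq> 0 \<Longrightarrow> \<exists>w. M z w \<noteq> w" by metis
  have form: "M z w = (2 * (nu z \<bullet> w) / N z) *\<^sub>R z - w" if "z \<noteq> 0" for z w
    using M(3)[OF that] isometry_fixing_is_reflection[OF M(1)[OF that] that M(2)[OF that]] by blast
  have invol: "M z (M z w) = w" if "z \<noteq> 0" for z w
  proof -
    have "nu z \<bullet> M z w = nu z \<bullet> w"
      using that by (simp add: form inner_diff_right nu_self)
    then show ?thesis using form[OF that, of "M z w"] form[OF that, of w] by simp
  qed
  (* A rigid K4 whose placement is moved slightly by the product of the reflections at 1 and at Z n. *)
  obtain x y where xy: "K4_rigid 1 x y" "cross 1 x \<noteq> 0" "cross 1 y \<noteq> 0" "x \<noteq> y"
    by (rule K4_rigid_dense_nondegenerate[of UNIV UNIV "\<i>" "2 * \<i>" 1]) (auto simp: cross_def)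
  obtain e where e: "e > 0" and inj: "\<And>P Q. dist P (1, x, y) < e \<Longrightarrow> dist Q (1, x, y) < e \<Longrightarrow>
      K4_lengths P = K4_lengths Q \<Longrightarrow> P = Q"
    using K4_rigid_imp_locally_injective[OF xy(2,3,4,1)] by blast
  define Z where "Z n = 1 + inverse (real (Suc n)) *\<^sub>R \<i>" for n
  have Z0: "Z n \<noteq> 0" for n by (simp add: Z_def complex_eq_iff)
  have "(\<lambda>n. 1 + inverse (real (Suc n)) *\<^sub>R \<i>) \<longlonglongrightarrow> 1 + 0 *\<^sub>R \<i>"
    by (intro tendsto_intros LIMSEQ_inverse_real_of_nat)
  then have Z: "Z \<longlonglongrightarrow> 1" by (simp add: Z_def[abs_def])
  define T where "T n w = M (Z n) (M 1 w)" for n w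
  have T: "(\<lambda>n. T n w) \<longlonglongrightarrow> w" for w
  proof -
    have "(\<lambda>n. (2 * (nu (Z n) \<bullet> M 1 w) / N (Z n)) *\<^sub>R Z n - M 1 w) \<longlonglongrightarrow> (2 * (nu 1 \<bullet> M 1 w) / N 1) *\<^sub>R 1 - M 1 w"
      by (intro tendsto_intros Z) auto
    then have "(\<lambda>n. T n w) \<longlonglongrightarrow> M 1 (M 1 w)" by (simp add: T_def form[OF Z0] form[of 1, symmetric])
    then show ?thesis by (simp add: invol)
  qed
  have "(\<lambda>n. (T n 1, T n x, T n y)) \<longlonglongrightarrow> (1, x, y)" by (intro tendsto_Pair T)
  from tendstoD[OF this e] obtain n where n: "dist (T n 1, T n x, T n y) (1, x, y) < e"
    by (auto simp: eventually_sequentially)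
  have M1: "linear_isometry (M 1)" "linear_isometry (M (Z n))" using M(1) Z0 by auto
  have iso: "linear_isometry (T n)"
    using M1 linear_compose[of "M 1" "M (Z n)"] by (auto simp: linear_isometry_def T_def[abs_def] o_def)
  have "(T n 1, T n x, T n y) = (1, x, y)"
    by (rule inj[OF n]) (use e K4_lengths_isometry[OF iso, of "(1, x, y)"] in auto)
  then have "T n w = w" for w
    using linear_eq_id_on_basis[of "T n" 1 x w] iso xy(2) by (simp add: linear_isometry_def)
  then have "M (Z n) u = M 1 u" for u
    using invol[of 1 u] by (metis T_def zero_neq_one)
  then have "M 1 (Z n) = Z n" using M(2)[OF Z0] by metis
  moreover have "cross 1 (Z n) \<noteq> 0" by (simp add: Z_def cross_def)
  ultimately have "M 1 w = w" for w
    using linear_eq_id_on_basis[of "M 1" 1 "Z n" w] M1(1) M(2)[of 1] by (simp add: linear_isometry_def)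
  then show False using M(3)[of 1] by simp
qed

text \<open>Here \<open>z\<close> is not an axis and the fourth vertex \<open>y = s x\<close> lies
  on a side of the triangle \<open>0, z, x\<close>. In an equivalent realisation with the same
  \<open>z\<close> it is again on that side, at \<open>s x'\<close>. For each of the finitely many
  other positions \<open>x'\<close> of the apex, the distances of \<open>s x\<close> and \<open>s
  x'\<close> from \<open>z\<close> differ for some \<open>s\<close> in every interval: otherwise
  \<open>z \<mapsto> z\<close>, \<open>x \<mapsto> x'\<close> would define an isometry. A good
  \<open>s\<close> gives uniqueness, which persists nearby by
  \<open>fibre_stability\<close>.\<close>

lemma K4_unique_over_base:
  "\<exists>z x y e. cross z x \<noteq> 0 \<and> cross z y \<noteq> 0 \<and> x \<noteq> y \<and> e > 0 \<and>
    (\<forall>P Q. dist P (z, x, y) < e \<longrightarrow> fst P = fst Q \<longrightarrow> K4_lengths P = K4_lengths Q \<longrightarrow> Q = P)"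
proof -
  obtain z where z: "z \<noteq> 0" "\<And>L w. linear_isometry L \<Longrightarrow> L z = z \<Longrightarrow> L w = w"
    using exists_non_axis by blast
  define x where "x = \<i> * z"
  have zx: "cross z x \<noteq> 0" using z by (simp add: x_def cross_rotate)
  define F where "F = {x'. N x' = N x \<and> N (x' - z) = N (x - z)} - {x}"
  have fin: "finite F" unfolding F_def using finite_triangle_apexes[OF zx refl] by simp
  define B where "B x' = {s. N (- z + s *\<^sub>R x') = N (- z + s *\<^sub>R x)}" for x'
  have "\<exists>s. (0::real) < s \<and> s < 1 \<and> (\<forall>x'\<in>F. s \<notin> B x')"
  proof (rule avoid_finitely_many_closed[OF fin])
    show "closed (B x')" for x' unfolding B_def by (intro closed_Collect_eq continuous_intros)
    fix x' and a b :: real assume x': "x' \<in> F" and ab: "a < b"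
    show "\<exists>s. a < s \<and> s < b \<and> s \<notin> B x'"
    proof (rule ccontr)
      assume "\<not> ?thesis"
      then have eq: "N (- z + s *\<^sub>R x) = N (- z + s *\<^sub>R x')" if "a < s" "s < b" for s
        using that by (auto simp: B_def)
      have "cross z x' \<noteq> 0"
        using congruent_triangle_nondegenerate[OF zx refl, of x'] x' by (simp add: F_def)
      then obtain L where L: "linear_isometry L" "L (- z) = - z" "L x = x'"
        using isometry_of_equal_norms_on_lines[of "- z" x "- z" x', OF _ _ ab eq] zx
        by (auto simp: cross_algebra)
      interpret linear L using L by (simp add: linear_isometry_def)
      have "L z = z" using L(2) neg[of z] by simp
      then have "x' = x" using z(2)[OF L(1)] L(3) by simp
      with x' show False by (simp add: F_def)
    qed
  qed simp
  then obtain s where s: "0 < s" "s < 1" "\<And>x'. x' \<in> F \<Longrightarrow> s \<notin> B x'" by blast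
  define y where "y = s *\<^sub>R x"
  have zy: "cross z y \<noteq> 0" using zx s by (simp add: y_def cross_algebra)
  have x0: "x \<noteq> 0" using zx by (auto simp: cross_algebra)
  have xy: "x \<noteq> y"
  proof
    assume "x = y"
    then have "(1 - s) *\<^sub>R x = 0" by (simp add: y_def algebra_simps)
    with x0 s show False by simp
  qed
  let ?P0 = "(z, x, y)"
  have inj: "\<exists>e>0. \<forall>P Q. dist P ?P0 < e \<longrightarrow> dist Q ?P0 < e \<longrightarrow> fst P = fst Q \<longrightarrow>
      (\<forall>l\<in>K4_edges. N (l P) = N (l Q)) \<longrightarrow> P = Q"
  proof (rule infinitesimally_rigid_imp_locally_injective[OF linear_K4_edges linear_fst K4_edges_nonzero[OF zx zy xy]])
    fix v :: "complex \<times> complex \<times> complex"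
    assume v: "fst v = 0" "\<forall>l\<in>K4_edges. nu (l ?P0) \<bullet> l v = 0"
    have "fst (snd v) = 0" by (rule two_distances_infinitesimally_rigid[OF zx])
       (use v in \<open>auto simp: K4_edges_def\<close>)
    moreover have "snd (snd v) = 0" by (rule two_distances_infinitesimally_rigid[OF zy])
       (use v in \<open>auto simp: K4_edges_def\<close>)
    ultimately show "v = 0" using v(1) by (simp add: prod_eq_iff)
  qed
  obtain C where C: "C > 0" "\<And>P :: complex \<times> complex \<times> complex. norm P \<le> C * (N (fst P) + N (fst (snd P)) + N (snd (snd P)))"
    using K4_norm_bound by blast
  have "\<exists>e>0. \<forall>P Q. dist P ?P0 < e \<longrightarrow> fst P = fst Q \<longrightarrow>
      (\<forall>l\<in>K4_edges. N (l P) = N (l Q)) \<longrightarrow> (\<exists>L\<in>{id}. Q = L P)"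
  proof (rule fibre_stability[OF linear_K4_edges linear_fst _ _ _ _ inj,
        where h = "\<lambda>P. C * (N (fst P) + N (fst (snd P)) + N (snd (snd P)))" and G = "{id}"])
    fix P Q :: "complex \<times> complex \<times> complex"
    assume "\<forall>l\<in>K4_edges. N (l P) = N (l Q)"
    then have "K4_lengths P = K4_lengths Q" by (simp add: K4_lengths_eq_iff)
    then show "norm Q \<le> C * (N (fst P) + N (fst (snd P)) + N (snd (snd P)))"
      using C(2)[of Q] by (simp add: K4_lengths_def)
  next
    show "isCont (\<lambda>P. C * (N (fst P) + N (fst (snd P)) + N (snd (snd P)))) (z, x, y)"
      by (intro continuous_intros)
  next
    fix Q assume k: "fst ?P0 = fst Q" and "\<forall>l\<in>K4_edges. N (l ?P0) = N (l Q)"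
    then have len: "K4_lengths ?P0 = K4_lengths Q" by (simp add: K4_lengths_eq_iff)
    obtain x' y' where Q: "Q = (z, x', y')" using k by (cases Q) auto
    have eqs: "N x' = N x" "N (x' - z) = N (x - z)" "N y' = N y" "N (y' - z) = N (y - z)" "N (x' - y') = N (x - y)"
      using len by (auto simp: Q K4_lengths_def)
    have xs: "x - y = (1 - s) *\<^sub>R x" by (simp add: y_def algebra_simps)
    have y': "y' = s *\<^sub>R x'"
    proof (rule collinear_point_unique)
      show "N y' = s * N x'" using eqs s by (simp add: y_def N_scale)
      show "N (y' - x') = (1 - s) * N x'" using eqs(1,5) s N_commute[of y' x'] by (simp add: xs N_scale)
    qed (use s in auto)
    have "N (- z + s *\<^sub>R x') = N (- z + s *\<^sub>R x)" using eqs(4) by (simp add: y' y_def)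
    then have "s \<in> B x'" by (simp add: B_def)
    then have "x' = x" using s(3)[of x'] eqs(1,2) by (auto simp: F_def)
    then show "\<exists>L\<in>{id}. Q = L ?P0" by (simp add: Q y' y_def)
  next
    fix L :: "complex \<times> complex \<times> complex \<Rightarrow> complex \<times> complex \<times> complex" assume "L \<in> {id}"
    then show "\<exists>L'. linear L' \<and> (\<forall>P. L' (L P) = P \<and> L (L' P) = P \<and> fst (L' P) = fst P \<and> (\<forall>l\<in>K4_edges. N (l (L' P)) = N (l P)))"
      by (intro exI[of _ id]) (auto simp: linear_id)
  qed
  then have "\<exists>e>0. \<forall>P Q. dist P ?P0 < e \<longrightarrow> fst P = fst Q \<longrightarrow> K4_lengths P = K4_lengths Q \<longrightarrow> Q = P"
    by (simp add: K4_lengths_eq_iff)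
  with zx zy xy show ?thesis by blast
qed

text \<open>Near a rigid placement inside the region of \<open>K4_unique_over_base\<close> the
  lengths fill an open set, which contains a regular value of the length map. Regularity makes all
  realisations with these lengths isolated, and by compactness there are finitely many.\<close>

lemma regular_K4:
  "\<exists>z x y. cross z x \<noteq> 0 \<and> cross z y \<noteq> 0 \<and> x \<noteq> y \<and> K4_rigid z x y \<and>
    finite {Q. K4_lengths Q = K4_lengths (z, x, y)} \<and>
    (\<forall>x' y'. K4_lengths (z, x', y') = K4_lengths (z, x, y) \<longrightarrow> x' = x \<and> y' = y)"
proof -
  obtain z x0 y0 e1 where 0: "cross z x0 \<noteq> 0" "cross z y0 \<noteq> 0" "x0 \<noteq> y0" "e1 > 0"
    and uniq: "\<And>P Q. dist P (z, x0, y0) < e1 \<Longrightarrow> fst P = fst Q \<Longrightarrow> K4_lengths P = K4_lengths Q \<Longrightarrow> Q = P"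
    using K4_unique_over_base by blast
  obtain x1 y1 where 1: "x1 \<in> ball x0 (e1 / 2)" "y1 \<in> ball y0 (e1 / 2)" "K4_rigid z x1 y1"
    "cross z x1 \<noteq> 0" "cross z y1 \<noteq> 0" "x1 \<noteq> y1"
    by (rule K4_rigid_dense_nondegenerate[where ?V1.0 = "ball x0 (e1 / 2)" and ?V2.0 = "ball y0 (e1 / 2)",
          OF open_ball open_ball _ _ 0(3,1,2)])
       (use 0(4) in auto)
  have near: "dist (z, x1, y1) (z, x0, y0) < e1"
  proof -
    have "dist (z, x1, y1) (z, x0, y0) \<le> dist x1 x0 + dist y1 y0"
      by (simp add: dist_Pair_Pair sqrt_sum_squares_le_sum)
    then show ?thesis using 1(1,2) by (simp add: dist_commute)
  qed
  obtain e2 where e2: "e2 > 0" and inj: "\<And>P Q. dist P (z, x1, y1) < e2 \<Longrightarrow> dist Q (z, x1, y1) < e2 \<Longrightarrow>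
      K4_lengths P = K4_lengths Q \<Longrightarrow> P = Q"
    using K4_rigid_imp_locally_injective[OF 1(4,5,6,3)] by blast
  define W where "W = ball (z, x1, y1) e2 \<inter> ball (z, x0, y0) e1 \<inter>
    {P. cross (fst P) (fst (snd P)) \<noteq> 0 \<and> cross (fst P) (snd (snd P)) \<noteq> 0 \<and> fst (snd P) \<noteq> snd (snd P)}"
  have "open W" unfolding W_def
    by (intro open_Int open_ball open_Collect_conj open_Collect_neq continuous_intros)
  moreover have "(z, x1, y1) \<in> W" using e2 near 1 by (simp add: W_def dist_commute)
  moreover have "inj_on K4_lengths W"
    by (rule inj_onI, rule inj) (auto simp: W_def dist_commute)
  ultimately have "openin (top_of_set UNIV) (K4_lengths ` W)"
    by (intro invariance_of_domain_subspaces[of UNIV]) (auto intro: continuous_on_K4_lengths)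
  then have opn: "open (K4_lengths ` W)" by simp
  define S where "S = {P. (\<forall>l\<in>K4_edges. l P \<noteq> 0) \<and> \<not> inj (K4_derivative P)}"
  have "\<exists>c\<in>K4_lengths ` W. c \<notin> K4_lengths ` S"
  proof (rule regular_value_in_open[where 'n = 6 and f' = K4_derivative])
    show "(K4_lengths has_derivative K4_derivative P) (at P)" if "P \<in> S" for P
      by (rule has_derivative_K4_lengths) (use that in \<open>auto simp: S_def\<close>)
    show "\<not> inj (K4_derivative P)" if "P \<in> S" for P using that by (simp add: S_def)
    show "K4_lengths ` W \<noteq> {}" using \<open>(z, x1, y1) \<in> W\<close> by auto
  qed (use opn in auto)
  then obtain P where P: "P \<in> W" "K4_lengths P \<notin> K4_lengths ` S" by blast
  obtain z2 x2 y2 where P2: "P = (z2, x2, y2)" by (cases P) auto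
  have nd: "cross z2 x2 \<noteq> 0" "cross z2 y2 \<noteq> 0" "x2 \<noteq> y2" using P(1) by (auto simp: W_def P2)
  have rigid: "cross (fst Q) (fst (snd Q)) \<noteq> 0 \<and> cross (fst Q) (snd (snd Q)) \<noteq> 0 \<and>
      fst (snd Q) \<noteq> snd (snd Q) \<and> K4_rigid (fst Q) (fst (snd Q)) (snd (snd Q))"
    if Q: "K4_lengths Q = K4_lengths P" for Q
  proof -
    have eqs: "N (l Q) = N (l P)" if "l \<in> K4_edges" for l
      using Q that by (auto simp: K4_lengths_eq_iff)
    have nz: "l Q \<noteq> 0" if "l \<in> K4_edges" for l
      using eqs[OF that] K4_edges_nonzero[OF nd that] by (auto simp: P2) 
    have "Q \<notin> S" using P(2) Q by (metis imageI)
    then have "inj (K4_derivative Q)" using nz by (auto simp: S_def)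
    moreover have "linear (K4_derivative Q)"
      using has_derivative_K4_lengths[of Q] nz by (intro has_derivative_linear) auto
    ultimately have inj: "K4_derivative Q v = 0 \<Longrightarrow> v = 0" for v using linear_injective_0 by blast
    have "K4_rigid (fst Q) (fst (snd Q)) (snd (snd Q))"
      unfolding K4_rigid_def
    proof (intro allI impI)
      fix z' x' y'
      assume "nu (fst Q) \<bullet> z' = 0 \<and> nu (fst (snd Q)) \<bullet> x' = 0 \<and> nu (fst (snd Q) - fst Q) \<bullet> (x' - z') = 0 \<and>
        nu (snd (snd Q)) \<bullet> y' = 0 \<and> nu (snd (snd Q) - fst Q) \<bullet> (y' - z') = 0 \<and> nu (fst (snd Q) - snd (snd Q)) \<bullet> (x' - y') = 0"
      then have "K4_derivative Q (z', x', y') = 0" by (simp add: K4_derivative_def zero_prod_def)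
      from inj[OF this] show "z' = 0 \<and> x' = 0 \<and> y' = 0" by (simp add: zero_prod_def)
    qed
    moreover have "cross (fst Q) (fst (snd Q)) \<noteq> 0" "cross (fst Q) (snd (snd Q)) \<noteq> 0"
      using congruent_triangle_nondegenerate[OF nd(1), of "fst Q" "fst (snd Q)"]
        congruent_triangle_nondegenerate[OF nd(2), of "fst Q" "snd (snd Q)"] Q
      by (auto simp: K4_lengths_def P2)
    moreover have "fst (snd Q) \<noteq> snd (snd Q)"
      using nz[of "\<lambda>P. fst (snd P) - snd (snd P)"] by (simp add: K4_edges_def)
    ultimately show ?thesis by blast
  qed
  show ?thesis
  proof (intro exI conjI allI impI)
    show "cross z2 x2 \<noteq> 0" "cross z2 y2 \<noteq> 0" "x2 \<noteq> y2" by (rule nd)+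
    show "K4_rigid z2 x2 y2" using rigid[OF refl] by (simp add: P2)
    show "finite {Q. K4_lengths Q = K4_lengths (z2, x2, y2)}"
    proof (rule finite_K4_fibre)
      fix Q assume Q: "K4_lengths Q = K4_lengths (z2, x2, y2)"
      with rigid[of Q] have r: "cross (fst Q) (fst (snd Q)) \<noteq> 0" "cross (fst Q) (snd (snd Q)) \<noteq> 0"
        "fst (snd Q) \<noteq> snd (snd Q)" "K4_rigid (fst Q) (fst (snd Q)) (snd (snd Q))" by (auto simp: P2)
      obtain e where "e > 0" "\<And>P P'. dist P Q < e \<Longrightarrow> dist P' Q < e \<Longrightarrow> K4_lengths P = K4_lengths P' \<Longrightarrow> P = P'"
        using K4_rigid_imp_locally_injective[OF r] by (metis prod.collapse)
      with Q show "\<exists>e>0. \<forall>P. dist P Q < e \<longrightarrow> K4_lengths P = K4_lengths (z2, x2, y2) \<longrightarrow> P = Q"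
        by (intro exI[of _ e]) auto
    qed
    fix x' y' assume "K4_lengths (z2, x', y') = K4_lengths (z2, x2, y2)"
    then have "(z2, x', y') = (z2, x2, y2)"
      using P(1) by (intro uniq) (auto simp: W_def P2 dist_commute)
    then show "x' = x2" "y' = y2" by simp_all
  qed
qed

section \<open>The graph made of two complete graphs that share an edge\<close>

text \<open>A placement up to translation is a pair: \<open>(z, x, y)\<close> places
  \<open>v\<^sub>4, v\<^sub>1, v\<^sub>2\<close> and the second component places \<open>v\<^sub>5,
  v\<^sub>6\<close>, all relative to \<open>v\<^sub>3\<close>.\<close>

definition H_edges :: "((complex \<times> complex \<times> complex) \<times> complex \<times> complex \<Rightarrow> complex) set" where
  "H_edges = (\<lambda>l P. l (fst P)) ` K4_edges \<union>
     {\<lambda>P. fst (snd P), \<lambda>P. snd (snd P), \<lambda>P. fst (snd P) - fst (fst P), \<lambda>P. snd (snd P) - fst (fst P),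
      \<lambda>P. fst (snd P) - snd (snd P)}"

abbreviation act :: "(complex \<Rightarrow> complex) \<Rightarrow> (complex \<times> complex \<times> complex) \<times> complex \<times> complex \<Rightarrow>
    (complex \<times> complex \<times> complex) \<times> complex \<times> complex" where
  "act L \<equiv> map_prod (map_prod L (map_prod L L)) (map_prod L L)"

lemma linear_H_edges: "l \<in> H_edges \<Longrightarrow> linear l"
  unfolding H_edges_def
  by (auto intro!: linear_compose_sub linear_compose_fst linear_compose_snd linear_K4_edges
      linear_fst linear_snd)

lemma H_lengths_eq_iff:
  "(\<forall>l\<in>H_edges. N (l P) = N (l Q)) \<longleftrightarrow> K4_lengths (fst P) = K4_lengths (fst Q) \<and>
     N (fst (snd P)) = N (fst (snd Q)) \<and> N (snd (snd P)) = N (snd (snd Q)) \<and>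
     N (fst (snd P) - fst (fst P)) = N (fst (snd Q) - fst (fst Q)) \<and>
     N (snd (snd P) - fst (fst P)) = N (snd (snd Q) - fst (fst Q)) \<and>
     N (fst (snd P) - snd (snd P)) = N (fst (snd Q) - snd (snd Q))"
  by (auto simp: H_edges_def K4_lengths_eq_iff ball_Un)

text \<open>The first half is the \<open>K\<^sub>4\<close> of \<open>regular_K4\<close>, so that
  \<open>z\<close> has only finitely many positions \<open>z'\<close> in equivalent realisations.
  The second half is the degenerate \<open>K\<^sub>4\<close> with vertices \<open>0, z, s z,
  y\<close>. Its realisations over \<open>z'\<close> have the form \<open>0, z', s z', y'\<close>
  with finitely many \<open>y'\<close>, and unless \<open>z \<mapsto> z'\<close>, \<open>y
  \<mapsto> y'\<close> defines an isometry the lengths \<open>N (s z - y)\<close> and \<open>N (s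
  z' - y')\<close> differ for some \<open>s\<close> in every interval. A good \<open>s\<close>
  leaves only isometric copies over the base edge, and then uniqueness of the first half over its
  base settles \<open>x\<^sub>1, x\<^sub>2\<close>. The placement is infinitesimally rigid
  although the second half alone is not: \<open>s z\<close> is located by its distances from
  \<open>0\<close> and \<open>y\<close>.\<close>

theorem H_globally_rigid_open:
  "\<exists>P0. \<exists>e>0. \<forall>P Q. dist P P0 < e \<longrightarrow> (\<forall>l\<in>H_edges. N (l P) = N (l Q)) \<longrightarrow> (\<exists>L. linear_isometry L \<and> Q = act L P)"
proof -
  obtain z x1 x2 where K: "cross z x1 \<noteq> 0" "cross z x2 \<noteq> 0" "x1 \<noteq> x2" "K4_rigid z x1 x2"
    and fin: "finite {Q. K4_lengths Q = K4_lengths (z, x1, x2)}"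
    and uniq: "\<And>x' y'. K4_lengths (z, x', y') = K4_lengths (z, x1, x2) \<Longrightarrow> x' = x1 \<and> y' = x2"
    using regular_K4 by blast
  define F where "F = fst ` {Q. K4_lengths Q = K4_lengths (z, x1, x2)}"
  have F: "N z' = N z" if "z' \<in> F" for z' using that by (auto simp: F_def K4_lengths_def)
  have z0: "z \<noteq> 0" using K(1) by (auto simp: cross_algebra)
  define y where "y = \<i> * z"
  have zy: "cross z y \<noteq> 0" using z0 by (simp add: y_def cross_rotate)
  define J where "J = {j \<in> Sigma F (\<lambda>z'. {y'. N y' = N y \<and> N (y' - z') = N (y - z)}).
      \<not> (\<exists>L. linear_isometry L \<and> L z = fst j \<and> L y = snd j)}"
  have "finite (Sigma F (\<lambda>z'. {y'. N y' = N y \<and> N (y' - z') = N (y - z)}))"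
    using fin finite_triangle_apexes[OF zy F] by (intro finite_SigmaI) (auto simp: F_def)
  then have finJ: "finite J" by (simp add: J_def)
  define B where "B j = {s. N (- snd j + s *\<^sub>R fst j) = N (- y + s *\<^sub>R z)}" for j
  have "\<exists>s. (0::real) < s \<and> s < 1 \<and> (\<forall>j\<in>J. s \<notin> B j)"
  proof (rule avoid_finitely_many_closed[OF finJ])
    show "closed (B j)" for j unfolding B_def by (intro closed_Collect_eq continuous_intros)
    fix j and a b :: real assume j: "j \<in> J" and ab: "a < b"
    obtain z' y' where jj: "j = (z', y')" by (cases j)
    have z': "z' \<in> F" and y': "N y' = N y" "N (y' - z') = N (y - z)" using j by (auto simp: J_def jj)
    show "\<exists>s. a < s \<and> s < b \<and> s \<notin> B j"
    proof (rule ccontr)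
      assume "\<not> ?thesis"
      then have eq: "N (- y + s *\<^sub>R z) = N (- y' + s *\<^sub>R z')" if "a < s" "s < b" for s
        using that by (auto simp: B_def jj)
      have "cross z' y' \<noteq> 0" by (rule congruent_triangle_nondegenerate[OF zy F[OF z'] y'])
      then obtain L where L: "linear_isometry L" "L (- y) = - y'" "L z = z'"
        using isometry_of_equal_norms_on_lines[of "- y" z "- y'" z', OF _ _ ab eq] zy
        by (auto simp: cross_algebra cross_commute[of y] cross_commute[of y'])
      interpret linear L using L by (simp add: linear_isometry_def)
      have "L y = y'" using L(2) neg[of y] by simp
      with L j show False by (auto simp: J_def jj)
    qed
  qed simp
  then obtain s where s: "0 < s" "s < 1" "\<And>j. j \<in> J \<Longrightarrow> s \<notin> B j" by blast
  define u where "u = s *\<^sub>R z"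
  define P0 where "P0 = ((z, x1, x2), (u, y))"
  have cyu: "cross y u \<noteq> 0" using zy s by (simp add: u_def cross_algebra cross_commute[of y])
  have uz: "u - z = (s - 1) *\<^sub>R z" by (simp add: u_def algebra_simps)
  have inj: "\<exists>e>0. \<forall>P Q. dist P P0 < e \<longrightarrow> dist Q P0 < e \<longrightarrow> (0::real) = 0 \<longrightarrow>
      (\<forall>l\<in>H_edges. N (l P) = N (l Q)) \<longrightarrow> P = Q"
  proof (rule infinitesimally_rigid_imp_locally_injective[where I = H_edges and k = "\<lambda>P. 0::real"])
    show "linear l" if "l \<in> H_edges" for l using that by (rule linear_H_edges)
    show "linear (\<lambda>P :: (complex \<times> complex \<times> complex) \<times> complex \<times> complex. 0 :: real)" by (rule linear_zero)
    show "l P0 \<noteq> 0" if "l \<in> H_edges" for l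
      using that K4_edges_nonzero[OF K(1-3)] z0 s zy cyu uz
      by (auto simp: H_edges_def P0_def u_def cross_algebra)
    fix v :: "(complex \<times> complex \<times> complex) \<times> complex \<times> complex"
    assume v: "\<forall>l\<in>H_edges. nu (l P0) \<bullet> l v = 0"
    have "nu (l (z, x1, x2)) \<bullet> l (fst v) = 0" if "l \<in> K4_edges" for l
      using v that by (simp add: H_edges_def P0_def ball_Un)
    then have v1: "fst v = 0" using K(4)[folded K4_edges_iff_rigid] by blast
    have "snd (snd v) = 0" by (rule two_distances_infinitesimally_rigid[OF zy])
       (use v1 v in \<open>auto simp: H_edges_def P0_def\<close>)
    moreover from this have "fst (snd v) = 0" by (intro two_distances_infinitesimally_rigid[OF cyu])
       (use v in \<open>auto simp: H_edges_def P0_def\<close>)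
    ultimately show "v = 0" using v1 by (simp add: prod_eq_iff)
  qed
  obtain C where C: "C > 0" "\<And>P :: complex \<times> complex \<times> complex. norm P \<le> C * (N (fst P) + N (fst (snd P)) + N (snd (snd P)))"
    using K4_norm_bound by blast
  obtain c where c: "c > 0" "\<And>x. c * norm x \<le> N x" using N_lower by auto
  define h where "h P = C * (N (fst (fst P)) + N (fst (snd (fst P))) + N (snd (snd (fst P)))) +
      (N (fst (snd P)) / c + N (snd (snd P)) / c)" for P :: "(complex \<times> complex \<times> complex) \<times> complex \<times> complex"
  have "\<exists>e>0. \<forall>P Q. dist P P0 < e \<longrightarrow> (0::real) = 0 \<longrightarrow>
      (\<forall>l\<in>H_edges. N (l P) = N (l Q)) \<longrightarrow> (\<exists>L\<in>act ` {L. linear_isometry L}. Q = L P)"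
  proof (rule fibre_stability[OF linear_H_edges linear_zero _ _ _ _ inj, where h = h and G = "act ` {L. linear_isometry L}"])
    fix P Q :: "(complex \<times> complex \<times> complex) \<times> complex \<times> complex"
    assume eq: "\<forall>l\<in>H_edges. N (l P) = N (l Q)"
    have n: "norm a \<le> N a / c" for a using c by (simp add: pos_le_divide_eq mult.commute)
    have "norm Q \<le> norm (fst Q) + (norm (fst (snd Q)) + norm (snd (snd Q)))"
      using norm_Pair_le[of "fst Q" "snd Q"] norm_Pair_le[of "fst (snd Q)" "snd (snd Q)"] by simp
    also have "\<dots> \<le> h Q" unfolding h_def by (intro add_mono C(2) n)
    also have "h Q = h P" using eq unfolding H_lengths_eq_iff by (simp add: h_def K4_lengths_def)
    finally show "norm Q \<le> h P" .
  next
    show "isCont h P0" unfolding h_def by (intro continuous_intros) (use c in auto)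
  next
    fix Q assume "\<forall>l\<in>H_edges. N (l P0) = N (l Q)"
    note eqs = this[unfolded H_lengths_eq_iff]
    obtain z' x1' x2' u' y' where Q: "Q = ((z', x1', x2'), (u', y'))" by (metis surj_pair)
    have len: "K4_lengths (z', x1', x2') = K4_lengths (z, x1, x2)" using eqs by (simp add: Q P0_def)
    have zF: "z' \<in> F" unfolding F_def using len by force
    have e: "N u' = N u" "N y' = N y" "N (u' - z') = N (u - z)" "N (y' - z') = N (y - z)" "N (u' - y') = N (u - y)"
      using eqs by (auto simp: Q P0_def)
    have u': "u' = s *\<^sub>R z'"
      by (rule collinear_point_unique) (use s e(1,3) F[OF zF] uz in \<open>auto simp: u_def N_scale\<close>)
    have "N (- y' + s *\<^sub>R z') = N (- y + s *\<^sub>R z)" using e(5) by (simp add: u' u_def)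
    then have "s \<in> B (z', y')" by (simp add: B_def)
    then have "(z', y') \<notin> J" using s(3) by blast
    then obtain L where L: "linear_isometry L" "L z = z'" "L y = y'"
      using zF e(2,4) by (auto simp: J_def)
    obtain L' where L': "linear_isometry L'" "\<And>x. L' (L x) = x" "\<And>x. L (L' x) = x"
      using linear_isometry_inverse[OF L(1)] by metis
    have "K4_lengths (L' z', L' x1', L' x2') = K4_lengths (z, x1, x2)"
      using K4_lengths_isometry[OF L'(1), of "(z', x1', x2')"] len by simp
    moreover have "L' z' = z" using L'(2)[of z] L(2) by simp
    ultimately have "L' x1' = x1" "L' x2' = x2" using uniq[of "L' x1'" "L' x2'"] by auto
    then have "x1' = L x1" "x2' = L x2" using L'(3) by metis+
    moreover have "u' = L u"
      using L(1,2) by (simp add: u' u_def linear_isometry_def linear_scale)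
    ultimately have "Q = act L P0" using L by (simp add: Q P0_def)
    then show "\<exists>L\<in>act ` {L. linear_isometry L}. Q = L P0" using L(1) by blast
  next
    fix A assume "A \<in> act ` {L. linear_isometry L}"
    then obtain L where L: "linear_isometry L" "A = act L" by blast
    obtain L' where L': "linear_isometry L'" "\<And>x. L' (L x) = x" "\<And>x. L (L' x) = x"
      using linear_isometry_inverse[OF L(1)] by metis
    interpret linear L' using L' by (simp add: linear_isometry_def)
    have d: "N (L' a - L' b) = N (a - b)" "N (L' a) = N a" for a b
      using L' by (simp_all add: linear_isometry_def diff[symmetric])
    have "linear (act L')"
      by (rule linearI) (auto simp: add scaleR split_paired_all)
    moreover have "act L' (A P) = P" "A (act L' P) = P" for P
      using L' by (simp_all add: L(2) map_prod.compositionality[unfolded o_def] prod_eq_iff)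
    moreover have "\<forall>l\<in>H_edges. N (l (act L' P)) = N (l P)" for P
      unfolding H_lengths_eq_iff using K4_lengths_isometry[OF L'(1)] by (simp add: d)
    ultimately show "\<exists>L'. linear L' \<and> (\<forall>P. L' (A P) = P \<and> A (L' P) = P \<and> (0::real) = 0 \<and> (\<forall>l\<in>H_edges. N (l (L' P)) = N (l P)))"
      by (intro exI[of _ "act L'"]) blast
  qed
  then have "\<exists>e>0. \<forall>P Q. dist P P0 < e \<longrightarrow> (\<forall>l\<in>H_edges. N (l P) = N (l Q)) \<longrightarrow> (\<exists>L. linear_isometry L \<and> Q = act L P)"
    by auto
  then show ?thesis by blast
qed

end

section \<open>Passage to an abstract normed plane\<close>

lemma normed_plane_coordinates:
  fixes e f :: "'a::real_normed_vector"
  assumes plane: "normed_plane TYPE('a)" and ef: "e \<noteq> f" "independent {e, f}"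
  defines "\<Psi> \<equiv> \<lambda>z. Re z *\<^sub>R e + Im z *\<^sub>R f"
  shows "linear \<Psi>" "bij \<Psi>"
proof -
  show lin: "linear \<Psi>"
    by (rule linearI) (simp_all add: \<Psi>_def algebra_simps)
  have "\<Psi> z = 0 \<Longrightarrow> z = 0" for z
  proof -
    assume "\<Psi> z = 0"
    then have s: "(\<Sum>w\<in>{e, f}. (if w = e then Re z else Im z) *\<^sub>R w) = 0"
      using ef(1) by (simp add: \<Psi>_def)
    have "Re z = 0" using independentD[OF ef(2) _ _ s, of e] by simp
    moreover have "Im z = 0" using independentD[OF ef(2) _ _ s, of f] ef(1) by simp
    ultimately show "z = 0" by (simp add: complex_eq_iff)
  qed
  then have inj: "inj \<Psi>" using linear_injective_0[OF lin] by blast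
  have "x \<in> range \<Psi>" for x
  proof -
    have "x \<in> span {e, f}"
    proof (rule ccontr)
      assume x: "x \<notin> span {e, f}"
      then have ind: "independent {x, e, f}" using ef(2) by (rule independent_insertI)
      have x_ne: "x \<noteq> e" "x \<noteq> f" using x span_base[of _ "{e, f}"] by auto
      obtain B where B: "independent B" "(UNIV :: 'a set) \<subseteq> span B" "card B = dim (UNIV :: 'a set)"
        using basis_exists[of "UNIV :: 'a set"] by metis
      then have "card B = 2" using plane by (simp add: normed_plane_def)
      then have "finite B" by (metis card.infinite zero_neq_numeral)
      have "card {x, e, f} \<le> card B"
        using independent_span_bound[OF \<open>finite B\<close> ind] B(2) by blast
      with \<open>card B = 2\<close> x_ne ef(1) show False by simp
    qed
    then obtain a where "x - a *\<^sub>R e \<in> span {f}" by (auto simp: span_insert)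
    then obtain b where "x - a *\<^sub>R e = b *\<^sub>R f" by (auto simp: span_singleton)
    then have "x = \<Psi> (Complex a b)" by (simp add: \<Psi>_def algebra_simps)
    then show "x \<in> range \<Psi>" by blast
  qed
  with inj show "bij \<Psi>" by (auto simp: bij_def)
qed

text \<open>If, for some basis \<open>u, v\<close>, the norm were the Euclidean norm of the
  coordinates times \<open>norm (\<Psi> u)\<close>, then the standard inner product of the
  coordinates would give an inner product for it.\<close>

lemma noneuclidean_norm_planeI:
  fixes \<Psi> :: "complex \<Rightarrow> 'a::real_normed_vector"
  assumes lin: "linear \<Psi>" and bij: "bij \<Psi>" and ne: "\<not> euclidean_norm TYPE('a)"
    and an: "\<And>a b. (a, b) \<noteq> (0, 0) \<Longrightarrow> real_analytic2_at (\<lambda>s t. norm (\<Psi> (Complex s t))) a b"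
  shows "noneuclidean_norm_plane (\<lambda>z. norm (\<Psi> z))"
proof -
  interpret linear \<Psi> by (rule lin)
  have inj0: "\<Psi> z = 0 \<longleftrightarrow> z = 0" for z
    using bij linear_injective_0[OF lin] by (auto simp: bij_def zero)
  show ?thesis
  proof
    show "norm (\<Psi> x) = 0 \<longleftrightarrow> x = 0" for x by (simp add: inj0)
    show "norm (\<Psi> (r *\<^sub>R x)) = \<bar>r\<bar> * norm (\<Psi> x)" for r x by (simp add: scaleR)
    show "norm (\<Psi> (x + y)) \<le> norm (\<Psi> x) + norm (\<Psi> y)" for x y
      by (simp add: add norm_triangle_ineq)
    show "real_analytic2_at (\<lambda>s t. norm (\<Psi> (Complex s t))) a b" if "(a, b) \<noteq> (0, 0)" for a b
      by (rule an[OF that])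
    fix u v assume uv: "cross u v \<noteq> 0"
    show "\<exists>\<alpha> \<beta>. norm (\<Psi> (\<alpha> *\<^sub>R u + \<beta> *\<^sub>R v)) \<noteq> sqrt (\<alpha>\<^sup>2 + \<beta>\<^sup>2) * norm (\<Psi> u)"
    proof (rule ccontr)
      assume "\<not> ?thesis"
      then have circ: "norm (\<Psi> (\<alpha> *\<^sub>R u + \<beta> *\<^sub>R v)) = sqrt (\<alpha>\<^sup>2 + \<beta>\<^sup>2) * norm (\<Psi> u)" for \<alpha> \<beta> by blast
      define g where "g = inv \<Psi>"
      have g: "\<Psi> (g x) = x" for x using bij by (simp add: g_def bij_is_surj surj_f_inv_f)
      have ling: "g (x + y) = g x + g y" "g (r *\<^sub>R x) = r *\<^sub>R g x" for x y r
        using bij by (auto simp: bij_def inj_def add scaleR g intro!: injD[of \<Psi>])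
      define \<alpha> where "\<alpha> x = cross (g x) v / cross u v" for x
      define \<beta> where "\<beta> x = cross u (g x) / cross u v" for x
      have ab: "\<alpha> (x + y) = \<alpha> x + \<alpha> y" "\<alpha> (r *\<^sub>R x) = r * \<alpha> x" "\<beta> (x + y) = \<beta> x + \<beta> y" "\<beta> (r *\<^sub>R x) = r * \<beta> x" for x y r
        by (simp_all add: \<alpha>_def \<beta>_def ling cross_algebra add_divide_distrib)
      define B where "B x y = (norm (\<Psi> u))\<^sup>2 * (\<alpha> x * \<alpha> y + \<beta> x * \<beta> y)" for x y
      have nB: "norm x = sqrt (B x x)" for x
      proof -
        have "g x = \<alpha> x *\<^sub>R u + \<beta> x *\<^sub>R v" unfolding \<alpha>_def \<beta>_def by (rule basis_expansion[OF uv])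
        then have "norm x = sqrt ((\<alpha> x)\<^sup>2 + (\<beta> x)\<^sup>2) * norm (\<Psi> u)" using circ g[of x] by metis
        then show ?thesis by (simp add: B_def real_sqrt_mult power2_eq_square[symmetric])
      qed
      have "is_inner_product B"
        unfolding is_inner_product_def
      proof (intro conjI allI impI)
        show "bilinear B"
          unfolding bilinear_def by (auto intro!: linearI simp: B_def ab algebra_simps)
        show "B x y = B y x" for x y by (simp add: B_def mult.commute)
        fix x :: 'a assume "x \<noteq> 0"
        then have "sqrt (B x x) > 0" by (simp add: nB[symmetric])
        then show "B x x > 0" by simp
      qed
      then have "euclidean_norm TYPE('a)" using nB by (auto simp: euclidean_norm_def)
      with ne show False by simp
    qed
  qed
qed

theorem theorem5p4:
  fixes v :: "nat \<Rightarrow> 'v"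
  assumes "analytic_normed_plane TYPE('a::real_normed_vector)"
    and "\<not> euclidean_norm TYPE('a)"
    and "inj_on v {1..6}"
  shows "globally_rigid_graph TYPE('a) (v ` {1..6})
           ({{v i, v j} | i j. 1 \<le> i \<and> i < j \<and> j \<le> 4} \<union>
            {{v i, v j} | i j. 3 \<le> i \<and> i < j \<and> j \<le> 6})"
proof -
  let ?V = "v ` {1..6}"
  let ?E = "{{v i, v j} | i j. 1 \<le> i \<and> i < j \<and> j \<le> 4} \<union> {{v i, v j} | i j. 3 \<le> i \<and> i < j \<and> j \<le> 6}"
  obtain b1 b2 :: 'a where plane: "normed_plane TYPE('a)" and b: "b1 \<noteq> b2" "independent {b1, b2}"
    and an: "\<And>a b. (a, b) \<noteq> (0, 0) \<Longrightarrow> real_analytic2_at (\<lambda>x y. norm (x *\<^sub>R b1 + y *\<^sub>R b2)) a b"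
    using assms(1) unfolding analytic_normed_plane_def by blast
  define \<Psi> where "\<Psi> z = Re z *\<^sub>R b1 + Im z *\<^sub>R b2" for z
  have lin: "linear \<Psi>" and bij: "bij \<Psi>"
    using normed_plane_coordinates[OF plane b] by (simp_all add: \<Psi>_def[abs_def])
  define N where "N z = norm (\<Psi> z)" for z
  interpret noneuclidean_norm_plane N
    unfolding N_def[abs_def] by (rule noneuclidean_norm_planeI[OF lin bij assms(2)]) (simp add: \<Psi>_def an)
  interpret \<Psi>: linear \<Psi> by (rule lin)
  define g where "g = inv \<Psi>"
  have g: "\<Psi> (g x) = x" "g (\<Psi> z) = z" for x z
    using bij by (simp_all add: g_def bij_is_surj surj_f_inv_f bij_is_inj)
  have ling: "g (x + y) = g x + g y" "g (x - y) = g x - g y" "g (r *\<^sub>R x) = r *\<^sub>R g x" for x y r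
    using bij by (auto simp: bij_def \<Psi>.add \<Psi>.diff \<Psi>.scaleR g intro!: injD[of \<Psi>])
  have Ng: "N (g x) = norm x" for x by (simp add: N_def g)
  have Ngd: "N (g x - g y) = norm (x - y)" for x y by (simp add: Ng ling(2)[symmetric])
  obtain c where c: "c > 0" "\<And>x. c * norm x \<le> N x" using N_lower by auto
  have "bounded_linear g"
  proof (rule bounded_linear_intro[where K = "1 / c"])
    show "norm (g x) \<le> norm x * (1 / c)" for x
      using c(2)[of "g x"] c(1) by (simp add: Ng pos_le_divide_eq mult.commute)
  qed (simp_all add: ling)
  then have contg: "continuous_map euclidean euclidean g"
    by (simp add: linear_continuous_on)
  obtain P0 e where e: "e > 0" and rigid: "\<And>P Q. dist P P0 < e \<Longrightarrow> (\<forall>l\<in>H_edges. N (l P) = N (l Q)) \<Longrightarrow>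
      (\<exists>L. linear_isometry L \<and> Q = act L P)"
    using H_globally_rigid_open by blast
  obtain z0 x0 y0 u0 w0 where P0: "P0 = ((z0, x0, y0), (u0, w0))" by (metis surj_pair)
  define t where "t p i = g (p (v i) - p (v 3))" for p i
  define config where "config p = ((t p 4, t p 1, t p 2), (t p 5, t p 6))" for p
  define a where "a i = (if i = 4 then z0 else if i = 1 then x0 else if i = 2 then y0 else if i = 5 then u0
      else if i = 6 then w0 else 0)" for i :: nat
  let ?T = "product_topology (\<lambda>_. euclidean :: 'a topology) ?V"
  have top: "topspace ?T = placements ?V" by (simp add: placements_def)
  (* U is open and maps into the ball of rigid placements; the factor 1/5 bounds the product distance by the five
     coordinate distances. *)
  define U where "U = (\<Inter>i\<in>{1..6}. {p \<in> topspace ?T. t p i \<in> ball (a i) (e / 5)})"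
  have openU: "openin ?T U"
    unfolding U_def
  proof (rule openin_INT2)
    fix i assume i: "i \<in> {1..6::nat}"
    have "continuous_map ?T euclidean (\<lambda>p. p (v i) - p (v 3))"
      using i by (intro continuous_map_diff continuous_map_product_projection) auto
    from continuous_map_compose[OF this contg] have "continuous_map ?T euclidean (\<lambda>p. t p i)"
      by (simp add: t_def o_def)
    then show "openin ?T {p \<in> topspace ?T. t p i \<in> ball (a i) (e / 5)}"
      by (rule openin_continuous_map_preimage) simp
  qed auto
  have near: "dist (config p) P0 < e" if "p \<in> U" for p
  proof -
    have d: "dist (t p i) (a i) < e / 5" if "i \<in> {1..6}" for i
      using \<open>p \<in> U\<close> that by (auto simp: U_def dist_commute)
    have "dist (config p) P0 \<le>
        (dist (t p 4) z0 + (dist (t p 1) x0 + dist (t p 2) y0)) + (dist (t p 5) u0 + dist (t p 6) w0)"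
      unfolding config_def P0
      by (rule order_trans[OF dist_Pair_le] add_mono dist_Pair_le order_refl)+
    also have "\<dots> < e"
      using d[of 1] d[of 2] d[of 4] d[of 5] d[of 6] by (simp add: a_def)
    finally show ?thesis .
  qed
  have "U \<noteq> {}"
  proof -
    define p where "p = restrict (\<lambda>w. \<Psi> (a (the_inv_into {1..6} v w))) ?V"
    have pv: "p (v i) = \<Psi> (a i)" if "i \<in> {1..6}" for i
      using that assms(3) by (simp add: p_def the_inv_into_f_f)
    have "t p i = a i" if "i \<in> {1..6}" for i
      using pv[OF that] pv[of 3] by (simp add: t_def a_def \<Psi>.zero g)
    then have "p \<in> U" using e by (auto simp: U_def p_def placements_def)
    then show ?thesis by blast
  qed
  moreover have "U \<subseteq> {p \<in> placements ?V. globally_rigid_framework ?V ?E p}"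
  proof
    fix p assume p: "p \<in> U"
    have "congruent_frameworks ?V p q" if eq: "equivalent_frameworks ?E p q" for q
    proof -
      have E: "norm (p (v i) - p (v j)) = norm (q (v i) - q (v j))"
        if "1 \<le> i \<and> i < j \<and> j \<le> 4 \<or> 3 \<le> i \<and> i < j \<and> j \<le> 6" for i j
      proof -
        have "{v i, v j} \<in> ?E" using that by blast
        with eq show ?thesis unfolding equivalent_frameworks_def by blast
      qed
      have td: "N (t r i) = norm (r (v 3) - r (v i))" "N (t r i - t r j) = norm (r (v i) - r (v j))"
        "N (t r i - t r j) = norm (r (v j) - r (v i))" for r i j
        by (simp_all add: t_def Ng Ngd norm_minus_commute)
      have "\<forall>l\<in>H_edges. N (l (config p)) = N (l (config q))"
        unfolding H_lengths_eq_iff K4_lengths_def config_def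
        using E[of 3 4] E[of 1 3] E[of 2 3] E[of 1 4] E[of 2 4] E[of 1 2] E[of 3 5] E[of 3 6] E[of 4 5] E[of 4 6] E[of 5 6]
        by (simp add: td norm_minus_commute)
      from rigid[OF near[OF p] this] obtain L where L: "linear_isometry L" "config q = act L (config p)" by blast
      obtain L' where L': "\<And>x. L' (L x) = x" "\<And>x. L (L' x) = x"
        using linear_isometry_inverse[OF L(1)] by metis
      interpret L: linear L using L(1) by (simp add: linear_isometry_def)
      have NL: "N (L x) = N x" for x using L(1) by (simp add: linear_isometry_def)
      have tq: "t q i = L (t p i)" if "i \<in> {1..6}" for i
      proof (cases "i = 3")
        case True
        have "g 0 = 0" using ling(3)[of 0 0] by simp
        then show ?thesis using True by (simp add: t_def L.zero)
      next
        case False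
        with that have "i \<in> {1, 2, 4, 5, 6}" by auto
        with L(2) show ?thesis by (auto simp: config_def)
      qed
      (* The isometry L in coordinates, conjugated so that it takes the third vertex of p to that of q. *)
      define G where "G x = \<Psi> (L (g (x - p (v 3)))) + q (v 3)" for x
      have "is_isometry G"
        unfolding is_isometry_def
      proof
        show "bij G"
          by (rule o_bij[of "\<lambda>y. \<Psi> (L' (g (y - q (v 3)))) + p (v 3)"])
             (auto simp: G_def fun_eq_iff g L')
        show "\<forall>x y. dist (G x) (G y) = dist x y"
        proof (intro allI)
          fix x y
          have "dist (G x) (G y) = N (L (g (x - p (v 3))) - L (g (y - p (v 3))))"
            by (simp add: G_def dist_norm N_def \<Psi>.diff)
          also have "\<dots> = N (g (x - p (v 3)) - g (y - p (v 3)))" by (simp add: NL L.diff[symmetric])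
          also have "\<dots> = dist x y" by (simp add: Ngd dist_norm)
          finally show "dist (G x) (G y) = dist x y" .
        qed
      qed
      moreover have "q (v i) = G (p (v i))" if "i \<in> {1..6}" for i
      proof -
        have "G (p (v i)) = \<Psi> (t q i) + q (v 3)" unfolding tq[OF that] by (simp add: G_def t_def)
        then show ?thesis by (simp add: t_def g)
      qed
      ultimately show ?thesis unfolding congruent_frameworks_def by blast
    qed
    moreover have "p \<in> placements ?V" using p top by (force simp: U_def)
    ultimately show "p \<in> {p \<in> placements ?V. globally_rigid_framework ?V ?E p}"
      by (simp add: globally_rigid_framework_def)
  qed
  ultimately have "?T interior_of {p \<in> placements ?V. globally_rigid_framework ?V ?E p} \<noteq> {}"
    using interior_of_maximal[OF _ openU] by blast
  moreover have "simple_graph ?V ?E"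
    unfolding simple_graph_def
  proof (intro conjI ballI)
    fix E assume "E \<in> ?E"
    then obtain i j where ij: "E = {v i, v j}" "1 \<le> i" "i < j" "j \<le> 6" by force
    then have "v i \<noteq> v j" using inj_onD[OF assms(3), of i j] by auto
    with ij show "\<exists>x\<in>?V. \<exists>y\<in>?V. x \<noteq> y \<and> E = {x, y}" by (intro bexI[of _ "v i"] bexI[of _ "v j"]) auto
  qed simp
  ultimately show ?thesis by (simp add: globally_rigid_graph_def)
qed

end
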